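(* Let $p$ be a prime, fix an algebraic closure $\overline{\mathbb{Q}}$ of $\mathbb{Q}$ and a prime $\mathfrak{p}$ of the ring of integers $\mathcal{O}_{\overline{\mathbb{Q}}}$ lying over $p$; identify $\overline{\mathbb{F}}_p=\mathcal{O}_{\overline{\mathbb{Q}}}/\mathfrak{p}$ and let $\mathbb{F}_q\subset\overline{\mathbb{F}}_p$ be the subfield with $q$ elements. Let Gauss sums $G_q(a)$ and Jacobi sums $J_q(\mathbf{a})$ and the sets $A'_{d,w}$ be as in the context. \begin{enumerate} \item Fix a real number $\epsilon>0$ and a positive integer $n$. There exists a constant $C_{\epsilon,n}$ depending only on $\epsilon$ and $n$ such that if $d>C_{\epsilon,n}$, $q=p^f\equiv 1\pmod d$, $a\in(\mathbb{Z}/d\mathbb{Z})^\times$, and the degree of $G_q(a)$ over $\mathbb{Q}(\mu_p)$ is $\le n$, then $$\left|\frac{\operatorname{ord}_\wp G_q(a)}{(p-1)f}-\frac12\right|<\epsilon,$$ where $\wp$ is the prime of $\mathbb{Q}(\mu_{pd})$ under $\mathfrak{p}$. \item Fix a positive integer $n$. There exist constants $C_n$ and $\epsilon_n>0$ depending only on $n$ such that if $d>C_n$, $q=p^f\equiv 1\pmod d$, $w\ge 1$, $\mathbf{a}\in A'_{d,w}$, and the degree of $J_q(\mathbf{a})$ over $\mathbb{Q}$ is $\le n$, then $$\frac{\operatorname{ord}_\wp J_q(\mathbf{a})}{f}>\epsilon_n,$$ where $\wp$ is the prime of $\mathbb{Q}(\mu_d)$ under $\mathfrak{p}$. \end{e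numerate}
   Context: $\mu_d$ denotes the group of $d$-th roots of unity in $\overline{\mathbb{Q}}$. Reduction modulo $\mathfrak{p}$ gives an isomorphism from the group of roots of unity of order prime to $p$ in $\mathcal{O}_{\overline{\mathbb{Q}}}$ onto $\overline{\mathbb{F}}_p^\times$; let $t:\overline{\mathbb{F}}_p^\times\to\overline{\mathbb{Q}}^\times$ be its inverse (and its restriction to $\mathbb{F}_q^\times$). Fix a nontrivial additive character $\psi_p:\mathbb{F}_p\to\overline{\mathbb{Q}}^\times$ and put $\psi_q=\psi_p\circ\operatorname{tr}_{\mathbb{F}_q/\mathbb{F}_p}$. For a character $\chi$ of $\mathbb{F}_q^\times$, $G_q(\chi)=-\sum_{x\in\mathbb{F}_q^\times}\chi(x)\psi_q(x)$. For $d\mid q-1$ and $a\in\mathbb{Z}/d\mathbb{Z}$, $G_q(a):=G_q(t^{-a(q-1)/d})\in\mathbb{Q}(\mu_{pd})$. For $w\ge1$ and nontrivial characters $\chi_0,\dots,\chi_{w+1}$ of $\mathbb{F}_q^\times$ with trivial product, $J_q(\chi_0,\dots,\chi_{w+1})=\frac{1}{q-1}\sum_{x_0,\dots,x_{w+1}\in\mathbb{F}_q^\times,\ x_0+\cdots+x_{w+1}=0}\chi_0(x_0)\cdots\chi_{w+1}(x_{w+1})$. $A_{d,w}\subset(\mathbb{Z}/d\mathbb{Z})^{w+2}$ is the set of tuples $\mathbf{a}=(a_0,\dots,a_{w+1})$ with all $a_i\ne0$ and $\sum a_i=0$; $A'_{d,w}$ is the subset with $\gcd(d,a_0,\dots,a_{w+1})=1$.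 For $\mathbf{a}\in A_{d,w}$ and $q\equiv1\pmod d$, $J_q(\mathbf{a}):=J_q(t^{-a_0(q-1)/d},\dots,t^{-a_{w+1}(q-1)/d})\in\mathbb{Q}(\mu_d)$. $\operatorname{ord}_\wp$ is the normalized valuation at $\wp$ (so $\operatorname{ord}_\wp(q)=(p-1)f$ in $\mathbb{Q}(\mu_{pd})$ and $\operatorname{ord}_\wp(q)=f$ in $\mathbb{Q}(\mu_d)$). *)

theory Defs
  imports Complex_Main "HOL-Computational_Algebra.Polynomial" "HOL-Algebra.Ideal"
    "HOL-Library.FuncSet"
begin

text \<open>We take the algebraic closure of Q to be the algebraic numbers inside the complex numbers.\<close>

definition alg_int :: "complex \<Rightarrow> bool" where
  "alg_int x \<longleftrightarrow> (\<exists>P :: int poly. lead_coeff P = 1 \<and> poly (map_poly of_int P) x = 0)"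

definition AI_ring :: "complex ring" where
  "AI_ring = \<lparr>carrier = {x. alg_int x}, monoid.mult = (*), one = 1, zero = 0, add = (+)\<rparr>"

definition prime_over :: "complex set \<Rightarrow> nat \<Rightarrow> bool" where
  "prime_over P p \<longleftrightarrow> primeideal P AI_ring \<and> (of_nat p :: complex) \<in> P"

text \<open>The (Q-valued) valuation on the algebraic numbers attached to the prime P over p,
  normalised so that v(p) = 1: v(x) is the supremum of m/n (n > 0) such that
  x^n / p^m lies in the localisation of the algebraic integers at P.\<close>
definition val :: "complex set \<Rightarrow> nat \<Rightarrow> complex \<Rightarrow> real" where
  "val P p x = Sup {real_of_int m / real n | m n. n > 0 \<and>
      (\<exists>a b. alg_int a \<and> alg_int b \<and> b \<notin> P \<and> b * x ^ n = (of_nat p) powi m * a)}"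

definition mu :: "nat \<Rightarrow> complex set" where
  "mu m = {z. z ^ m = 1}"

definition cyc_field :: "nat \<Rightarrow> complex set" where
  "cyc_field m = {x. \<exists>r :: nat \<Rightarrow> rat.
      x = (\<Sum>k<m. of_rat (r k) * exp (2 * pi * \<i> * of_nat k / of_nat m))}"

definition alg_degree :: "complex set \<Rightarrow> complex \<Rightarrow> nat" where
  "alg_degree K x = (LEAST n. \<exists>Q :: complex poly. Q \<noteq> 0 \<and> degree Q = n \<and>
      (\<forall>i. coeff Q i \<in> K) \<and> poly Q x = 0)"

text \<open>Finite field model.  Reduction modulo P identifies mu (q-1) with F_q^*, the inverse
  being the Teichmueller map t.  Hence an element of F_q^* is represented by its lift
  z in mu (q-1), and t(x) = z.  For x in F_q with lift z, tr_{F_q/F_p}(x) is the reduction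
  of the algebraic integer sum_{i<f} z^(p^i); it lies in F_p = Z/p, i.e. it is the class
  of an integer k with sum - k in P.  A nontrivial additive character of F_p = Z/p is
  k \<mapsto> exp(2 pi i c k / p) with c not divisible by p.\<close>

definition trace_int :: "complex set \<Rightarrow> nat \<Rightarrow> nat \<Rightarrow> complex \<Rightarrow> int" where
  "trace_int P p f z = (SOME k. (\<Sum>i<f. z ^ (p ^ i)) - of_int k \<in> P)"

definition psi_q :: "complex set \<Rightarrow> nat \<Rightarrow> int \<Rightarrow> nat \<Rightarrow> complex \<Rightarrow> complex" where
  "psi_q P p c f z = exp (2 * pi * \<i> * of_int (c * trace_int P p f z) / of_nat p)"

definition chr :: "nat \<Rightarrow> nat \<Rightarrow> int \<Rightarrow> complex \<Rightarrow> complex" where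
  "chr q d a z = z powi (- (a * int ((q - 1) div d)))"

definition gauss :: "complex set \<Rightarrow> nat \<Rightarrow> int \<Rightarrow> nat \<Rightarrow> nat \<Rightarrow> int \<Rightarrow> complex" where
  "gauss P p c f d a = - (\<Sum>z\<in>mu (p ^ f - 1). chr (p ^ f) d a z * psi_q P p c f z)"

text \<open>Jacobi sum J_q(a_0,...,a_{w+1}); tuples (x_0,...,x_{w+1}) in (F_q^*)^{w+2} with
  x_0 + ... + x_{w+1} = 0 correspond to tuples of lifts whose sum reduces to 0 mod P.\<close>
definition jacobi :: "complex set \<Rightarrow> nat \<Rightarrow> nat \<Rightarrow> nat \<Rightarrow> (nat \<Rightarrow> int) \<Rightarrow> complex" where
  "jacobi P q d w a = (1 / of_nat (q - 1)) *
     (\<Sum>x \<in> {x \<in> PiE {..w+1} (\<lambda>_. mu (q - 1)). (\<Sum>i\<le>w+1. x i) \<in> P}.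
        \<Prod>i\<le>w+1. chr q d (a i) (x i))"

definition A'_set :: "nat \<Rightarrow> nat \<Rightarrow> (nat \<Rightarrow> int) set" where
  "A'_set d w = {a. (\<forall>i\<le>w+1. \<not> int d dvd a i) \<and> int d dvd (\<Sum>i\<le>w+1. a i) \<and>
                    Gcd (insert (int d) (a ` {..w+1})) = 1}"

end

theory Submission
  imports Defs "HOL-Analysis.Analysis" "HOL-Number_Theory.Number_Theory" "HOL-Real_Asymp.Real_Asymp"
begin

text \<open>Stickelberger's theorem gives the valuation of \<open>G\<^sub>q(a)\<close>, divided by \<open>f\<close>, as the mean of the
  fractional parts \<open>\<langle>p\<^sup>i a / d\<rangle>\<close>. If the degree of the sum is at most \<open>n\<close>, its stabiliser
  \<open>H\<close> in \<open>(\<int>/d)\<^sup>*\<close> has index at most \<open>n\<close> and contains \<open>p\<close>, so the mean may be taken over the multiples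
  \<open>t a / d\<close> with \<open>t \<in> H\<close> instead. These are nearly equidistributed for large \<open>d\<close>: an exponential sum over
  a subgroup of \<open>(\<int>/d)\<^sup>*\<close> at frequency \<open>k\<close> is at most \<open>\<surd>(d k)\<close> by Parseval, while \<open>\<phi>(d)\<close> is at least of
  the order \<open>d / log d\<close>. Hence each mean is close to \<open>1/2\<close>, which is the claim for Gauss sums.

  For Jacobi sums the valuation is the sum of the means for \<open>a\<^sub>0, \<dots>, a\<^sub>w\<^sub>+\<^sub>1\<close> minus \<open>1\<close>. Terms whose exact
  denominator is large contribute nearly \<open>1/2\<close>, terms with a small denominator contribute an amount
  bounded below. Three large denominators suffice; otherwise, since the \<open>a\<^sub>i\<close> sum to zero and
  generate \<open>\<int>/d\<close>, there are exactly two, both of them comparable to \<open>d\<close>, and at least one small one.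

  The upper bound in Stickelberger's theorem comes from \<open>G(k) G(1) = J \<sqdot> G(k + 1)\<close> with \<open>J\<close> integral
  and \<open>G(p k) = G(k)\<close>; since \<open>G(k) G(-k)\<close> is \<open>q\<close> up to a unit, the upper bounds for \<open>k\<close> and \<open>-k\<close>
  are both attained.\<close>

section \<open>Exponential sums over subgroups of the units modulo d\<close>

text \<open>Each \<open>t\<close> in the stabiliser leaves the sum, hence its valuation, unchanged,
  so the valuation may be averaged over \<open>H\<close>; \<open>p\<close> lies in \<open>H\<close>
  because z -> z^p permutes the roots of unity and preserves the additive character. The averaging
  is what makes the constants independent of \<open>p\<close> and \<open>f\<close>: the powers of
  \<open>p\<close> modulo \<open>d\<close> may form a tiny subgroup, far from equidistributed,
  whereas \<open>H\<close> has at least about d / (n log d) elements, well above the square root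
  size of the exponential sums. For Jacobi sums the \<open>a i\<close> generate Z/d only jointly, so
  a single one may have a small denominator however large \<open>d\<close> is; this is why
  equidistribution is also needed at divisors of \<open>d\<close>. The finite field is not
  constructed: its nonzero elements are roots of unity of order dividing q - 1, and equations in it
  are congruences modulo \<open>P\<close>. Galois conjugation is likewise expressed through rational
  polynomials evaluated at powers of a root of unity.\<close>

lemma cis_2pi_eq_1_iff: "cis (2 * pi * x) = 1 \<longleftrightarrow> x \<in> \<int>"
proof
  assume "cis (2 * pi * x) = 1"
  then have "cos (2 * pi * x) = 1" by (simp add: complex_eq_iff)
  then obtain k where "2 * pi * x = real_of_int k * 2 * pi"
    unfolding cos_one_2pi_int by auto
  then have "x = real_of_int k" by simp
  then show "x \<in> \<int>" by simp
qed (rule cis_multiple_2pi)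

lemma cis_2pi_cong:
  assumes "[a = b] (mod int d)"
  shows "cis (2 * pi * (real_of_int a / real d)) = cis (2 * pi * (real_of_int b / real d))"
proof (cases "d = 0")
  case False
  obtain k where k: "a = b + int d * k"
    using assms unfolding cong_iff_dvd_diff dvd_def by (metis add.commute diff_add_cancel)
  have "2 * pi * (real_of_int a / real d) = 2 * pi * (real_of_int b / real d) + 2 * pi * real_of_int k"
    using False by (simp add: k field_simps)
  then show ?thesis by (simp add: cis_mult[symmetric] cis_multiple_2pi)
qed simp

lemma sum_roots_of_unity_powers:
  fixes w :: complex
  assumes "w ^ d = 1" "w \<noteq> 1"
  shows "(\<Sum>b<d. w ^ b) = 0"
  using geometric_sum[OF assms(2), of d] assms(1) by simp

text \<open>Expanding the square gives sums over b of powers of a root of unity indexed by t - s.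
  Distinct elements of \<open>H\<close> are incongruent modulo \<open>d\<close>, so only the
  diagonal survives.\<close>

lemma parseval_subset:
  assumes "H \<subseteq> {..<d}"
  shows "(\<Sum>b<d. (norm (\<Sum>t\<in>H. cis (2 * pi * (real (t * b) / real d))))\<^sup>2) = real d * real (card H)"
proof (cases "d = 0")
  case False
  have fin: "finite H" using assms finite_subset by blast
  define w where "w s t = cis (2 * pi * ((real t - real s) / real d))" for s t :: nat
  have pw: "cis (2 * pi * (real (t * b) / real d)) * cnj (cis (2 * pi * (real (s * b) / real d))) = w s t ^ b"
    for s t b
    by (simp add: w_def cis_cnj cis_mult Complex.DeMoivre) (simp add: algebra_simps diff_divide_distrib)
  have ort: "(\<Sum>b<d. w s t ^ b) = (if s = t then of_nat d else 0)" if "s \<in> H" "t \<in> H" for s t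
  proof (cases "s = t")
    case True
    then show ?thesis by (simp add: w_def)
  next
    case ne: False
    have lt: "s < d" "t < d" using that assms by auto
    have "w s t ^ d = 1"
      using False cis_multiple_2pi[of "real t - real s"] by (simp add: w_def Complex.DeMoivre mult_ac)
    moreover have "w s t \<noteq> 1"
    proof
      assume "w s t = 1"
      then have "(real t - real s) / real d \<in> \<int>" by (simp only: w_def cis_2pi_eq_1_iff)
      then obtain k where "(real t - real s) / real d = of_int k" by (auto elim: Ints_cases)
      then have "real t - real s = of_int k * real d" using False by (simp add: field_simps)
      then have k: "int t - int s = k * int d"
        by (metis of_int_eq_iff of_int_diff of_int_mult of_int_of_nat_eq)
      have "\<bar>int t - int s\<bar> < int d" using lt by linarith
      then have "\<bar>k\<bar> * int d < 1 * int d" using k by (simp add: abs_mult)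
      then have "k = 0" using False by (simp add: mult_less_cancel_right)
      then show False using k ne by simp
    qed
    ultimately show ?thesis using ne sum_roots_of_unity_powers by simp
  qed
  have "complex_of_real (\<Sum>b<d. (norm (\<Sum>t\<in>H. cis (2 * pi * (real (t * b) / real d))))\<^sup>2)
      = (\<Sum>b<d. \<Sum>t\<in>H. \<Sum>s\<in>H. w s t ^ b)"
    by (simp only: of_real_sum complex_norm_square cnj_sum sum_product pw)
  also have "\<dots> = (\<Sum>t\<in>H. \<Sum>s\<in>H. \<Sum>b<d. w s t ^ b)"
    by (subst sum.swap, rule sum.cong[OF refl], rule sum.swap)
  also have "\<dots> = (\<Sum>t\<in>H. \<Sum>s\<in>H. if s = t then of_nat d else 0)"
    by (intro sum.cong refl ort)
  also have "\<dots> = of_real (real d * real (card H))"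
    using fin by (simp add: sum.delta)
  finally show ?thesis by (simp only: of_real_eq_iff)
qed (use assms in auto)

text \<open>In a finite group, nonemptiness and closure under multiplication already give a
  subgroup. Representatives lie below \<open>d\<close>, so for d = 1 the only element is 0; hence
  the recurring \<open>1 mod d\<close>.\<close>

definition unit_subgroup :: "nat \<Rightarrow> nat set \<Rightarrow> bool" where
  "unit_subgroup d H \<longleftrightarrow> H \<noteq> {} \<and> H \<subseteq> {t. t < d \<and> coprime t d} \<and>
     (\<forall>s\<in>H. \<forall>t\<in>H. s * t mod d \<in> H)"

lemma unit_subgroupD:
  assumes "unit_subgroup d H"
  shows "H \<noteq> {}" "finite H" "H \<subseteq> {..<d}" "card H > 0" "d > 0"
    "\<And>t. t \<in> H \<Longrightarrow> coprime t d" "\<And>t. t \<in> H \<Longrightarrow> t < d"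
    "\<And>s t. s \<in> H \<Longrightarrow> t \<in> H \<Longrightarrow> s * t mod d \<in> H"
proof -
  show "H \<noteq> {}" "H \<subseteq> {..<d}" "\<And>t. t \<in> H \<Longrightarrow> coprime t d" "\<And>t. t \<in> H \<Longrightarrow> t < d"
    "\<And>s t. s \<in> H \<Longrightarrow> t \<in> H \<Longrightarrow> s * t mod d \<in> H"
    using assms by (auto simp: unit_subgroup_def)
  then show "finite H" using finite_subset by blast
  then show "card H > 0" using \<open>H \<noteq> {}\<close> by (simp add: card_gt_0_iff)
  show "d > 0" using \<open>H \<noteq> {}\<close> \<open>H \<subseteq> {..<d}\<close> by (cases d) auto
qed

lemma unit_subgroup_mult_bij:
  assumes H: "unit_subgroup d H" and h: "h \<in> H"
  shows "bij_betw (\<lambda>t. h * t mod d) H H"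
proof -
  note U = unit_subgroupD[OF H]
  have "inj_on (\<lambda>t. h * t mod d) H"
  proof (rule inj_onI)
    fix s t assume st: "s \<in> H" "t \<in> H" "h * s mod d = h * t mod d"
    then have "[h * s = h * t] (mod d)" by (simp add: cong_def)
    then have "[s = t] (mod d)" using U(6)[OF h] by (simp add: cong_mult_lcancel_nat)
    then show "s = t" using U(7) st by (simp add: cong_def)
  qed
  moreover have "(\<lambda>t. h * t mod d) ` H \<subseteq> H" using U(8) h by auto
  ultimately show ?thesis
    using U(2) by (simp add: bij_betw_def endo_inj_surj)
qed

lemma card_le_mult_card_image:
  assumes "finite A" "\<And>y. y \<in> f ` A \<Longrightarrow> card {x \<in> A. f x = y} \<le> k"
  shows "card A \<le> k * card (f ` A)"
proof -
  have "card A = (\<Sum>x\<in>A. 1)" by simp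
  also have "\<dots> = (\<Sum>y\<in>f ` A. \<Sum>x\<in>{x \<in> A. f x = y}. 1)"
    by (rule sum.image_gen[OF assms(1)])
  also have "\<dots> \<le> (\<Sum>y\<in>f ` A. k)" using assms(2) by (intro sum_mono) simp
  finally show ?thesis by (simp add: mult.commute)
qed

text \<open>Every value of the exponential sum is repeated along an \<open>H\<close>-orbit, so
  Parseval's identity bounds it.\<close>

lemma exp_sum_unit_subgroup_bound:
  assumes H: "unit_subgroup d H" and a: "coprime a d" and k: "k > 0"
  shows "norm (\<Sum>t\<in>H. cis (2 * pi * (real (t * (k * a)) / real d))) \<le> sqrt (real d * real k)"
proof -
  note U = unit_subgroupD[OF H]
  define g where "g b = (\<Sum>t\<in>H. cis (2 * pi * (real (t * b) / real d)))" for b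
  have inv: "g (h * b mod d) = g b" if h: "h \<in> H" for h b
  proof -
    have "g b = (\<Sum>t\<in>H. cis (2 * pi * (real ((h * t mod d) * b) / real d)))"
      unfolding g_def by (rule sum.reindex_bij_betw[OF unit_subgroup_mult_bij[OF H h], symmetric])
    also have "\<dots> = (\<Sum>t\<in>H. cis (2 * pi * (real (t * (h * b mod d)) / real d)))"
    proof (rule sum.cong[OF refl])
      fix t
      have "[(h * t mod d) * b = t * (h * b mod d)] (mod d)"
        by (simp add: cong_def mod_mult_left_eq mod_mult_right_eq mult_ac)
      then have "[int ((h * t mod d) * b) = int (t * (h * b mod d))] (mod int d)"
        by (simp only: cong_int_iff)
      from cis_2pi_cong[OF this]
      show "cis (2 * pi * (real ((h * t mod d) * b) / real d)) = cis (2 * pi * (real (t * (h * b mod d)) / real d))"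
        by simp
    qed
    finally show ?thesis by (simp add: g_def)
  qed
  define orb where "orb = (\<lambda>h. h * (k * a) mod d) ` H"
  have orb: "orb \<noteq> {}" "finite orb" "orb \<subseteq> {..<d}" using U by (auto simp: orb_def)
  have "card H \<le> k * card orb" unfolding orb_def
  proof (rule card_le_mult_card_image[OF U(2)])
    fix y
    \<comment> \<open>Within a fibre h k is known modulo \<open>d\<close>, so its quotient by
      \<open>d\<close> determines h; that quotient takes at most \<open>k\<close> values. Thus the
      orbit map is at most \<open>k\<close>-to-one.\<close>
    have "inj_on (\<lambda>h. h * k div d) {h \<in> H. h * (k * a) mod d = y}"
    proof (rule inj_onI, clarify)
      fix s t assume st: "s \<in> H" "t \<in> H" "s * k div d = t * k div d"
        "t * (k * a) mod d = s * (k * a) mod d"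
      then have "[(t * k) * a = (s * k) * a] (mod d)" by (simp add: cong_def mult.assoc)
      then have "[t * k = s * k] (mod d)" using a by (simp add: cong_mult_rcancel_nat)
      then have "t * k = s * k" using st(3) unfolding cong_def by (metis div_mult_mod_eq)
      then show "s = t" using k by simp
    qed
    moreover have "(\<lambda>h. h * k div d) ` {h \<in> H. h * (k * a) mod d = y} \<subseteq> {..<k}"
      using U(5,7) k by (auto simp: less_mult_imp_div_less mult.commute)
    ultimately show "card {h \<in> H. h * (k * a) mod d = y} \<le> k"
      using card_inj_on_le[of _ _ "{..<k}"] by fastforce
  qed
  then have le: "real (card H) \<le> real k * real (card orb)"
    by (metis of_nat_le_iff of_nat_mult)
  have "real (card orb) * (norm (g (k * a)))\<^sup>2 = (\<Sum>b\<in>orb. (norm (g b))\<^sup>2)"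
    using inv by (subst sum_constant[symmetric], intro sum.cong) (auto simp: orb_def)
  also have "\<dots> \<le> (\<Sum>b<d. (norm (g b))\<^sup>2)"
    using orb by (intro sum_mono2) auto
  also have "\<dots> = real d * real (card H)" unfolding g_def by (rule parseval_subset[OF U(3)])
  also have "\<dots> \<le> real d * (real k * real (card orb))" using le by (intro mult_left_mono) auto
  finally have "real (card orb) * (norm (g (k * a)))\<^sup>2 \<le> real (card orb) * (real d * real k)"
    by (simp add: mult_ac)
  moreover have "real (card orb) > 0" using orb by (simp add: card_gt_0_iff)
  ultimately have "(norm (g (k * a)))\<^sup>2 \<le> real d * real k" by simp
  then show ?thesis unfolding g_def[symmetric] by (rule real_le_rsqrt)
qed

section \<open>The sawtooth function and the totient function\<close>

lemma dirichlet_kernel: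
  "sin (pi * x) * (1 + 2 * (\<Sum>k=1..K. cos (2 * pi * real k * x))) = sin ((2 * real K + 1) * pi * x)"
proof (induction K)
  case (Suc K)
  have "sin (pi * x) * (1 + 2 * (\<Sum>k=1..Suc K. cos (2 * pi * real k * x)))
    = sin ((2 * real K + 1) * pi * x) + 2 * sin (pi * x) * cos (2 * pi * real (Suc K) * x)"
    using Suc by (simp add: algebra_simps)
  also have "2 * sin (pi * x) * cos (2 * pi * real (Suc K) * x)
     = sin (pi * x + 2 * pi * real (Suc K) * x) + sin (pi * x - 2 * pi * real (Suc K) * x)"
    by (simp add: sin_add sin_diff)
  also have "pi * x - 2 * pi * real (Suc K) * x = - ((2 * real K + 1) * pi * x)"
    by (simp add: algebra_simps)
  also have "pi * x + 2 * pi * real (Suc K) * x = (2 * real (Suc K) + 1) * pi * x"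
    by (simp add: algebra_simps)
  finally show ?case by simp
qed simp

lemma sin_ge_half: 
  assumes "0 \<le> y" "y \<le> pi / 2"
  shows "sin y \<ge> y / 2"
proof -
  have "\<bar>sin y - y\<bar> \<le> y ^ 3 / 6"
    using Maclaurin_sin_bound[of y 3] assms
    by (simp add: sin_coeff_def lessThan_nat_numeral fact_numeral lessThan_Suc field_simps)
  moreover have "y ^ 3 / 6 \<le> y / 2"
  proof -
    have "y \<le> 1.6" using assms pi_approx by simp
    then have "y * y \<le> 1.6 * 1.6" using assms by (intro mult_mono) auto
    then have "y * (y * y) \<le> y * 3" using assms by (intro mult_left_mono) auto
    then show ?thesis by (simp add: power3_eq_cube)
  qed
  ultimately show ?thesis by linarith
qed

text \<open>The error of the \<open>K\<close>-th partial sum of the Fourier series of 1/2 - x on 0 <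
  x < 1. Its derivative is minus the Dirichlet kernel.\<close>

definition sawtooth_remainder :: "nat \<Rightarrow> real \<Rightarrow> real" where
  "sawtooth_remainder K x = 1 / 2 - x - (\<Sum>k=1..K. sin (2 * pi * real k * x) / (pi * real k))"

lemma sawtooth_remainder_deriv:
  "(sawtooth_remainder K has_real_derivative - (1 + 2 * (\<Sum>k=1..K. cos (2 * pi * real k * x)))) (at x)"
  unfolding sawtooth_remainder_def
  by (auto intro!: derivative_eq_intros sum.cong simp: sum_distrib_left)

text \<open>Integrating the Dirichlet kernel by parts: the boundary term is \<open>A\<close>, and the derivative
  of the rest is dominated by that of \<open>B\<close>.\<close>

lemma sawtooth_remainder_bound_left:
  assumes x: "0 < x" "x \<le> 1 / 2"
  shows "\<bar>sawtooth_remainder K x\<bar> \<le> 2 / ((2 * real K + 1) * x)"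
proof -
  define M where "M = 2 * real K + 1"
  have M: "M > 0" by (simp add: M_def)
  define A where "A x = cos (M * pi * x) / (M * pi * sin (pi * x))" for x :: real
  define B where "B x = 1 / (M * pi * sin (pi * x))" for x :: real
  let ?D = "sawtooth_remainder K"
  have sinpos: "sin (pi * y) > 0" if "x \<le> y" "y \<le> 1/2" for y
    using that x by (intro sin_gt_zero) (auto simp: field_simps)
  have cospos: "cos (pi * y) \<ge> 0" if "x \<le> y" "y \<le> 1/2" for y
    using that x by (intro cos_ge_zero) (auto simp: field_simps intro: order_trans[of _ 0])
  have dD: "(?D has_real_derivative - (sin (M * pi * y) / sin (pi * y))) (at y)" if "x \<le> y" "y \<le> 1/2" for y
  proof -
    have "1 + 2 * (\<Sum>k=1..K. cos (2 * pi * real k * y)) = sin (M * pi * y) / sin (pi * y)"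
      using dirichlet_kernel[of y K] sinpos[OF that] by (simp add: field_simps M_def)
    then show ?thesis using sawtooth_remainder_deriv[of K y] by simp
  qed
  have dA: "(A has_real_derivative - (sin (M * pi * y) / sin (pi * y))
      - cos (M * pi * y) * cos (pi * y) / (M * (sin (pi * y))\<^sup>2)) (at y)" if "x \<le> y" "y \<le> 1/2" for y
    unfolding A_def using sinpos[OF that] M
    by (auto intro!: derivative_eq_intros simp: field_simps power2_eq_square)
  have dB: "(B has_real_derivative - (cos (pi * y) / (M * (sin (pi * y))\<^sup>2))) (at y)" if "x \<le> y" "y \<le> 1/2" for y
    unfolding B_def using sinpos[OF that] M
    by (auto intro!: derivative_eq_intros simp: field_simps power2_eq_square)
  have bd: "\<bar>cos (M * pi * y) * cos (pi * y) / (M * (sin (pi * y))\<^sup>2)\<bar> \<le> cos (pi * y) / (M * (sin (pi * y))\<^sup>2)"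
    if "x \<le> y" "y \<le> 1/2" for y
  proof -
    have "\<bar>cos (M * pi * y) * cos (pi * y)\<bar> \<le> 1 * cos (pi * y)"
      unfolding abs_mult using cospos[OF that] by (intro mult_mono) auto
    then show ?thesis using M by (simp add: abs_divide abs_mult divide_right_mono)
  qed
  \<comment> \<open>The midpoint is the base point of the comparison because the remainder and the
    boundary term both vanish there: \<open>M\<close> is odd, so cos(M pi / 2) = 0.\<close>
  have half: "?D (1/2) = 0" "A (1/2) = 0" "B (1/2) \<ge> 0"
  proof -
    have "sin (2 * pi * real k * (1/2)) = 0" for k :: nat
      using sin_npi2[of k] by simp
    then show "?D (1/2) = 0" unfolding sawtooth_remainder_def by simp
    have "cos (M * pi * (1/2)) = 0"
    proof -
      have "M * pi * (1/2) = pi / 2 + real K * pi" by (simp add: M_def field_simps)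
      then show ?thesis by (simp only: cos_add cos_pi_half sin_npi)
    qed
    then show "A (1/2) = 0" by (simp add: A_def)
    show "B (1/2) \<ge> 0" using M by (simp add: B_def)
  qed
  have "?D x - A x + B x \<ge> ?D (1/2) - A (1/2) + B (1/2)"
  proof (rule DERIV_nonpos_imp_nonincreasing[of x "1/2" "\<lambda>y. ?D y - A y + B y"])
    fix y assume y: "x \<le> y" "y \<le> 1/2"
    show "\<exists>z. ((\<lambda>y. ?D y - A y + B y) has_real_derivative z) (at y) \<and> z \<le> 0"
      by (rule exI, rule conjI, rule DERIV_add[OF DERIV_diff[OF dD[OF y] dA[OF y]] dB[OF y]])
        (use bd[OF y] in linarith)
  qed (use x in auto)
  moreover have "?D x - A x - B x \<le> ?D (1/2) - A (1/2) - B (1/2)"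
  proof (rule DERIV_nonneg_imp_nondecreasing[of x "1/2" "\<lambda>y. ?D y - A y - B y"])
    fix y assume y: "x \<le> y" "y \<le> 1/2"
    show "\<exists>z. ((\<lambda>y. ?D y - A y - B y) has_real_derivative z) (at y) \<and> z \<ge> 0"
      by (rule exI, rule conjI, rule DERIV_diff[OF DERIV_diff[OF dD[OF y] dA[OF y]] dB[OF y]])
        (use bd[OF y] in linarith)
  qed (use x in auto)
  moreover have "\<bar>A x\<bar> \<le> B x"
    unfolding A_def B_def using M sinpos[of x] x
    by (simp add: abs_divide abs_mult divide_right_mono)
  ultimately have "\<bar>?D x\<bar> \<le> 2 * B x" using half by linarith
  also have "\<dots> \<le> 2 / (M * x)"
  proof -
    have "1 * x \<le> pi * (pi * x / 2)"
      using x pi_approx mult_mono[of 1 pi x "pi * x / 2"] by auto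
    also have "\<dots> \<le> pi * sin (pi * x)" using sin_ge_half[of "pi * x"] x by (intro mult_left_mono) auto
    finally have "x \<le> pi * sin (pi * x)" by simp
    then show ?thesis unfolding B_def using M x
      by (auto intro!: divide_left_mono mult_pos_pos sinpos simp: mult.assoc)
  qed
  finally show ?thesis by (simp add: M_def)
qed

text \<open>The reflection x -> 1 - x only changes the sign of the remainder, so the estimate on the
  left half carries over to the right half.\<close>

lemma sawtooth_remainder_bound:
  assumes x: "0 < x" "x < 1" and K: "K > 0"
  shows "\<bar>sawtooth_remainder K x\<bar> \<le> (1 / x + 1 / (1 - x)) / real K"
proof -
  have aux: "2 / ((2 * real K + 1) * y) \<le> 1 / y / real K" if "y > 0" for y
    using that K by (simp add: divide_simps)
  show ?thesis
  proof (cases "x \<le> 1/2")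
    case True
    have "\<bar>sawtooth_remainder K x\<bar> \<le> 1 / x / real K"
      using sawtooth_remainder_bound_left[OF x(1) True, of K] aux[OF x(1)] by linarith
    also have "\<dots> \<le> (1 / x + 1 / (1 - x)) / real K"
      using x by (intro divide_right_mono) auto
    finally show ?thesis .
  next
    case False
    have "sin (2 * pi * real k * (1 - x)) = - sin (2 * pi * real k * x)" for k :: nat
    proof -
      have "2 * pi * real k * (1 - x) = 2 * real k * pi - 2 * pi * real k * x" by (simp add: algebra_simps)
      then show ?thesis by (simp only: sin_diff sin_2npi cos_2npi)
    qed
    then have "sawtooth_remainder K (1 - x) = - sawtooth_remainder K x"
      by (simp add: sawtooth_remainder_def sum_negf)
    then have "\<bar>sawtooth_remainder K x\<bar> = \<bar>sawtooth_remainder K (1 - x)\<bar>" by simp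
    also have "\<dots> \<le> 1 / (1 - x) / real K"
      using sawtooth_remainder_bound_left[of "1 - x" K] aux[of "1 - x"] x False by force
    also have "\<dots> \<le> (1 / x + 1 / (1 - x)) / real K"
      using x by (intro divide_right_mono) auto
    finally show ?thesis .
  qed
qed

lemma sum_inverse_sqrt_le: "(\<Sum>k=1..K. 1 / sqrt (real k)) \<le> 2 * sqrt (real K)"
proof (induction K)
  case (Suc K)
  have "(sqrt (real K + 1) - sqrt (real K)) * (sqrt (real K + 1) + sqrt (real K)) = 1"
    by (simp add: algebra_simps)
  moreover have "(sqrt (real K + 1) - sqrt (real K)) * (sqrt (real K + 1) + sqrt (real K))
      \<le> (sqrt (real K + 1) - sqrt (real K)) * (2 * sqrt (real K + 1))"
    by (intro mult_left_mono) auto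
  ultimately have "1 \<le> (2 * sqrt (real K + 1) - 2 * sqrt (real K)) * sqrt (real K + 1)"
    by (simp add: algebra_simps)
  then have "1 / sqrt (real K + 1) \<le> 2 * sqrt (real K + 1) - 2 * sqrt (real K)"
    by (simp add: pos_divide_le_eq)
  then show ?case using Suc by (simp add: add.commute)
qed simp

lemma sum_inverse_le_ln: "n > 0 \<Longrightarrow> (\<Sum>k=1..n. 1 / real k) \<le> 1 + ln (real n)"
proof (induction n rule: nat_induct_non_zero)
  case (Suc n)
  have "1 / real (Suc n) \<le> ln (real (Suc n)) - ln (real n)"
  proof -
    have "ln (real n / real (Suc n)) \<le> real n / real (Suc n) - 1"
      using Suc by (intro ln_le_minus_one) auto
    also have "\<dots> = - (1 / real (Suc n))" by (simp add: field_simps)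
    finally show ?thesis using Suc by (simp add: ln_div)
  qed
  then show ?case using Suc by simp
qed simp

text \<open>The ratio totient(n) / n is the product of 1 - 1/p over the prime factors. For r
  distinct integers that are at least 2, such a product is at least (1/2)(2/3)...(r/(r+1)) =
  1/(r+1), by induction on the largest element; and r is at most log2 n since 2^r <= n.\<close>

lemma totient_ge:
  assumes "n > 0"
  shows "real n \<le> real (totient n) * (1 + log 2 (real n))"
proof -
  have aux: "1 \<le> (\<Prod>p\<in>A. 1 - 1 / real p) * (1 + real (card A))"
    if "finite A" "\<And>p. p \<in> A \<Longrightarrow> p \<ge> 2" for A :: "nat set"
    using that
  proof (induction A rule: finite_linorder_max_induct)
    case (insert b A)
    have "A \<subseteq> {2..<b}" using insert by force
    then have "card A \<le> b - 2" using card_mono[of "{2..<b}" A] by simp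
    then have b: "real (card A) + 2 \<le> real b" using insert.prems[of b] by simp
    have nb: "b \<notin> A" using insert by auto
    have "(1 - 1 / real b) * (2 + real (card A)) \<ge> (1 - 1 / (real (card A) + 2)) * (2 + real (card A))"
      using b by (intro mult_right_mono) (auto simp: frac_le)
    also have "(1 - 1 / (real (card A) + 2)) * (2 + real (card A)) = 1 + real (card A)"
      by (simp add: field_simps)
    finally have "1 + real (card A) \<le> (1 - 1 / real b) * (2 + real (card A))" .
    moreover have "0 \<le> (\<Prod>p\<in>A. 1 - 1 / real p)" 
      using insert.prems by (intro prod_nonneg) (force simp: field_simps)
    ultimately have "(\<Prod>p\<in>A. 1 - 1 / real p) * (1 + real (card A))
        \<le> (\<Prod>p\<in>A. 1 - 1 / real p) * ((1 - 1 / real b) * (2 + real (card A)))"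
      by (intro mult_left_mono)
    moreover have "1 \<le> (\<Prod>p\<in>A. 1 - 1 / real p) * (1 + real (card A))" using insert by auto
    ultimately show ?case using nb insert(1) by (simp add: mult_ac add_ac)
  qed simp
  let ?A = "prime_factors n"
  have "2 ^ card ?A = (\<Prod>p\<in>?A. 2 :: nat)" by simp
  also have "\<dots> \<le> (\<Prod>p\<in>?A. p)" by (intro prod_mono) (auto simp: in_prime_factors_iff prime_ge_2_nat)
  also have "\<dots> \<le> (\<Prod>p\<in>?A. p ^ multiplicity p n)"
  proof (intro prod_mono conjI)
    fix p assume "p \<in> ?A"
    then have "multiplicity p n \<ge> 1" "p \<ge> 1"
      using prime_factors_multiplicity prime_ge_1_nat by (auto simp: prime_factors_multiplicity)
    then show "p \<le> p ^ multiplicity p n" using power_increasing[of 1 "multiplicity p n" p] by simp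
  qed auto
  also have "\<dots> = n" using assms by (simp add: prime_factorization_nat[symmetric])
  finally have "2 ^ card ?A \<le> n" .
  then have "real (card ?A) \<le> log 2 (real n)"
    by (metis le_log2_of_power)
  have "real n * 1 \<le> real n * ((\<Prod>p\<in>?A. 1 - 1 / real p) * (1 + real (card ?A)))"
    by (intro mult_left_mono aux) (auto simp: in_prime_factors_iff prime_ge_2_nat)
  also have "\<dots> = real (totient n) * (1 + real (card ?A))"
    by (simp add: totient_formula2)
  also have "\<dots> \<le> real (totient n) * (1 + log 2 (real n))"
    using \<open>real (card ?A) \<le> log 2 (real n)\<close> by (intro mult_left_mono) auto
  finally show ?thesis by simp
qed

section \<open>Equidistribution of subgroup orbits\<close>

text \<open>For \<open>H\<close> the group generated by p modulo \<open>d\<close>, this is the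
  Stickelberger exponent of the Gauss sum divided by \<open>f\<close>.\<close>

definition orbit_mean :: "nat \<Rightarrow> nat set \<Rightarrow> int \<Rightarrow> real" where
  "orbit_mean d H a = (\<Sum>t\<in>H. frac (real_of_int (int t * a) / real d)) / real (card H)"

lemma frac_int_div_nat:
  assumes "d > 0"
  shows "frac (real_of_int x / real d) = real_of_int (x mod int d) / real d"
proof -
  have "real_of_int x / real d = real_of_int (x div int d) + real_of_int (x mod int d) / real d"
  proof -
    have "real_of_int x = real_of_int (x div int d * int d + x mod int d)" by simp
    then show ?thesis using assms by (simp only: of_int_add of_int_mult) (simp add: field_simps)
  qed
  moreover have "frac (real_of_int (x div int d) + real_of_int (x mod int d) / real d) = real_of_int (x mod int d) / real d"
  proof -
    have "real_of_int (x mod int d) < real_of_int (int d)"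
      using assms by (simp only: of_int_less_iff) simp
    then show ?thesis using assms by (simp add: frac_eq)
  qed
  ultimately show ?thesis by simp
qed

lemma frac_cong:
  assumes "[x = y] (mod int d)"
  shows "frac (real_of_int x / real d) = frac (real_of_int y / real d)"
  using assms by (cases "d = 0") (auto simp: frac_int_div_nat cong_def)

text \<open>The sawtooth is replaced by \<open>K\<close> harmonics and a remainder. The k-th
  harmonic contributes at most sqrt(d/k) by the exponential sum bound. The residues t a mod d are
  distinct and nonzero, so the remainders are dominated by a sum over all residues 1, ..., d - 1,
  which is harmonic.\<close>

lemma sum_sawtooth_unit_subgroup_bound:
  assumes H: "unit_subgroup d H" and a: "coprime a d" and d: "d \<ge> 2" and K: "K > 0"
  shows "\<bar>\<Sum>t\<in>H. 1 / 2 - frac (real (t * a) / real d)\<bar>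
    \<le> 2 * sqrt (real d * real K) + 2 * real d * (1 + ln (real d)) / real K"
proof -
  note U = unit_subgroupD[OF H]
  define X where "X t = frac (real (t * a) / real d)" for t
  have X: "X t = real (t * a mod d) / real d" for t
    using frac_int_div_nat[OF U(5), of "int (t * a)"]
    by (simp only: X_def of_int_of_nat_eq flip: zmod_int)
  have j: "t * a mod d \<in> {1..<d}" if "t \<in> H" for t
  proof -
    have "coprime (t * a) d" using U(6)[OF that] a by simp
    then have "\<not> d dvd t * a" using d coprime_absorb_right[of d "t * a"] by (auto simp: coprime_commute)
    then show ?thesis using U(5) by (auto simp: dvd_eq_mod_eq_0 Suc_le_eq)
  qed
  have inj: "inj_on (\<lambda>t. t * a mod d) H"
  proof (rule inj_onI)
    fix s t assume st: "s \<in> H" "t \<in> H" "s * a mod d = t * a mod d"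
    then have "[s * a = t * a] (mod d)" by (simp add: cong_def)
    then have "[s = t] (mod d)" using a by (simp add: cong_mult_rcancel_nat)
    then show "s = t" using U(7) st by (simp add: cong_def)
  qed
  have "(\<Sum>t\<in>H. 1 / 2 - X t) = (\<Sum>t\<in>H. (\<Sum>k=1..K. sin (2 * pi * real k * X t) / (pi * real k)) + sawtooth_remainder K (X t))"
    by (simp add: sawtooth_remainder_def)
  also have "\<dots> = (\<Sum>k=1..K. (\<Sum>t\<in>H. sin (2 * pi * real k * X t)) / (pi * real k)) + (\<Sum>t\<in>H. sawtooth_remainder K (X t))"
    by (simp add: sum.distrib sum_divide_distrib) (rule sum.swap)
  also have "\<bar>\<dots>\<bar> \<le> (\<Sum>k=1..K. sqrt (real d) / sqrt (real k)) + (\<Sum>t\<in>H. (1 / X t + 1 / (1 - X t)) / real K)"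
  proof (intro order_trans[OF abs_triangle_ineq] add_mono order_trans[OF sum_abs] sum_mono)
    fix k assume "k \<in> {1..K}"
    then have k: "k > 0" by simp
    have "sin (2 * pi * real k * X t) = Im (cis (2 * pi * (real (t * (k * a)) / real d)))" for t
    proof -
      have "[int (k * (t * a mod d)) = int (t * (k * a))] (mod int d)"
        unfolding cong_int_iff by (simp add: cong_def mod_mult_right_eq mult_ac)
      from cis_2pi_cong[OF this] 
      have "cis (2 * pi * (real (t * (k * a)) / real d)) = cis (2 * pi * (real (k * (t * a mod d)) / real d))"
        by simp
      also have "2 * pi * (real (k * (t * a mod d)) / real d) = 2 * pi * real k * X t"
        by (simp add: X)
      finally show ?thesis by simp
    qed
    then have "(\<Sum>t\<in>H. sin (2 * pi * real k * X t)) = Im (\<Sum>t\<in>H. cis (2 * pi * (real (t * (k * a)) / real d)))"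
      by simp
    then have "\<bar>\<Sum>t\<in>H. sin (2 * pi * real k * X t)\<bar> \<le> sqrt (real d * real k)"
      using order_trans[OF abs_Im_le_cmod exp_sum_unit_subgroup_bound[OF H a k]] by (simp only:)
    then have "\<bar>(\<Sum>t\<in>H. sin (2 * pi * real k * X t)) / (pi * real k)\<bar> \<le> sqrt (real d * real k) / (pi * real k)"
      using k by (simp add: abs_divide abs_mult divide_right_mono)
    also have "\<dots> \<le> sqrt (real d * real k) / (1 * real k)"
      using k pi_ge_two by (intro divide_left_mono mult_right_mono mult_pos_pos) auto
    also have "\<dots> = sqrt (real d) / sqrt (real k)"
      using k by (simp add: real_sqrt_mult field_simps)
    finally show "\<bar>(\<Sum>t\<in>H. sin (2 * pi * real k * X t)) / (pi * real k)\<bar> \<le> sqrt (real d) / sqrt (real k)" .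
  next
    fix t assume "t \<in> H"
    then show "\<bar>sawtooth_remainder K (X t)\<bar> \<le> (1 / X t + 1 / (1 - X t)) / real K"
      using j[of t] K by (intro sawtooth_remainder_bound) (auto simp: X)
  qed
  also have "(\<Sum>k=1..K. sqrt (real d) / sqrt (real k)) = sqrt (real d) * (\<Sum>k=1..K. 1 / sqrt (real k))"
    by (simp add: sum_distrib_left)
  also have "\<dots> \<le> sqrt (real d) * (2 * sqrt (real K))"
    by (intro mult_left_mono sum_inverse_sqrt_le) auto
  also have "\<dots> = 2 * sqrt (real d * real K)" by (simp add: real_sqrt_mult)
  also have "(\<Sum>t\<in>H. (1 / X t + 1 / (1 - X t)) / real K)
      = (\<Sum>i\<in>(\<lambda>t. t * a mod d) ` H. (1 / (real i / real d) + 1 / (1 - real i / real d)) / real K)"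
    by (subst sum.reindex[OF inj]) (simp add: X)
  also have "\<dots> \<le> (\<Sum>i\<in>{1..<d}. (1 / (real i / real d) + 1 / (1 - real i / real d)) / real K)"
    using j by (intro sum_mono2) auto
  also have "\<dots> = (\<Sum>i\<in>{1..<d}. (real d / real i + real d / real (d - i)) / real K)"
    by (intro sum.cong refl) (auto simp: of_nat_diff field_simps)
  also have "\<dots> = ((\<Sum>i\<in>{1..<d}. real d / real i) + (\<Sum>i\<in>{1..<d}. real d / real (d - i))) / real K"
    by (simp only: sum.distrib sum_divide_distrib[symmetric])
  also have "(\<Sum>i\<in>{1..<d}. real d / real (d - i)) = (\<Sum>i\<in>{1..<d}. real d / real i)"
    by (rule sum.reindex_bij_witness[of _ "\<lambda>i. d - i" "\<lambda>i. d - i"]) auto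
  also have "(\<Sum>i\<in>{1..<d}. real d / real i) = real d * (\<Sum>i\<in>{1..<d}. 1 / real i)"
    by (simp add: sum_distrib_left)
  also have "(real d * (\<Sum>i\<in>{1..<d}. 1 / real i) + real d * (\<Sum>i\<in>{1..<d}. 1 / real i)) / real K
      \<le> (real d * (1 + ln (real d)) + real d * (1 + ln (real d))) / real K"
  proof -
    have "(\<Sum>i\<in>{1..<d}. 1 / real i) \<le> (\<Sum>i\<in>{1..d}. 1 / real i)" by (intro sum_mono2) auto
    also have "\<dots> \<le> 1 + ln (real d)" using d by (intro sum_inverse_le_ln) auto
    finally show ?thesis by (intro divide_right_mono add_mono mult_left_mono) auto
  qed
  also have "\<dots> = 2 * real d * (1 + ln (real d)) / real K" by simp
  finally show ?thesis unfolding X_def by simp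
qed

lemma orbit_mean_unit_equidistributed:
  assumes "\<delta> > 0"
  shows "\<exists>B. \<forall>d>B. \<forall>H a. unit_subgroup d H \<longrightarrow> totient d \<le> n * card H \<longrightarrow> coprime a (int d) \<longrightarrow>
           \<bar>orbit_mean d H a - 1 / 2\<bar> < \<delta>"
proof -
  \<comment> \<open>\<open>R\<close> bounds the deviation of the mean when \<open>K\<close> is about
    sqrt x: the two error terms have orders x^(3/4) and sqrt x log x, and they are divided by the
    lower bound x / (n (1 + log2 x)) for \<open>card H\<close>.\<close>
  define R where "R x = real n * (1 + log 2 x) * (2 * sqrt (x * (sqrt x + 1)) + 2 * x * (1 + ln x) / sqrt x) / x" for x :: real
  have "(R \<longlongrightarrow> 0) at_top" unfolding R_def by real_asymp
  then have "((\<lambda>d. R (real d)) \<longlongrightarrow> 0) at_top"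
    by (rule filterlim_compose) (rule filterlim_real_sequentially)
  then have "eventually (\<lambda>d. R (real d) < \<delta>) at_top"
    using assms by (rule order_tendstoD)
  then obtain B0 where B0: "\<And>d. d \<ge> B0 \<Longrightarrow> R (real d) < \<delta>"
    unfolding eventually_at_top_linorder by blast
  show ?thesis
  proof (intro exI[of _ "max B0 2"] allI impI)
    fix d H and a :: int
    assume d: "d > max B0 2" and H: "unit_subgroup d H" and n: "totient d \<le> n * card H" and a: "coprime a (int d)"
    note U = unit_subgroupD[OF H]
    define a' where "a' = nat (a mod int d)"
    have a': "int a' = a mod int d" using d by (simp add: a'_def)
    have "coprime (int a') (int d)" using a d unfolding a' by simp
    then have cop: "coprime a' d" by simp
    have fr: "frac (real_of_int (int t * a) / real d) = frac (real (t * a') / real d)" for t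
    proof -
      have "[int t * a = int (t * a')] (mod int d)"
        by (simp add: a' cong_def mod_mult_right_eq)
      from frac_cong[OF this] show ?thesis by simp
    qed
    define K where "K = nat \<lceil>sqrt (real d)\<rceil>"
    have K: "K > 0" "sqrt (real d) \<le> real K" "real K \<le> sqrt (real d) + 1"
      using d by (auto simp: K_def)
    define c where "c = real (card H)"
    have c: "c > 0" using U(4) by (simp add: c_def)
    have "\<bar>\<Sum>t\<in>H. 1 / 2 - frac (real (t * a') / real d)\<bar>
        \<le> 2 * sqrt (real d * real K) + 2 * real d * (1 + ln (real d)) / real K"
      using d by (intro sum_sawtooth_unit_subgroup_bound[OF H cop _ K(1)]) auto
    also have "\<dots> \<le> 2 * sqrt (real d * (sqrt (real d) + 1)) + 2 * real d * (1 + ln (real d)) / sqrt (real d)"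
      using K d by (intro add_mono mult_left_mono real_sqrt_le_mono divide_left_mono mult_pos_pos) auto
    finally have 1: "\<bar>\<Sum>t\<in>H. 1 / 2 - frac (real (t * a') / real d)\<bar> \<le> \<dots>" .
    define E where "E = 2 * sqrt (real d * (sqrt (real d) + 1)) + 2 * real d * (1 + ln (real d)) / sqrt (real d)"
    have E: "E \<ge> 0" unfolding E_def using d by (intro add_nonneg_nonneg) auto
    have "orbit_mean d H a - 1 / 2 = - (\<Sum>t\<in>H. 1 / 2 - frac (real (t * a') / real d)) / c"
      using c by (simp only: orbit_mean_def fr sum_subtractf sum_constant flip: c_def) (simp add: field_simps)
    then have "\<bar>orbit_mean d H a - 1 / 2\<bar> \<le> E / c"
      using 1 c by (simp add: abs_divide E_def divide_right_mono)
    also have "\<dots> \<le> real n * (1 + log 2 (real d)) * E / real d"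
    proof -
      have "real d \<le> real (totient d) * (1 + log 2 (real d))" using U(5) by (rule totient_ge)
      also have "\<dots> \<le> (real n * c) * (1 + log 2 (real d))"
        using n d unfolding c_def by (intro mult_right_mono) (auto simp flip: of_nat_mult)
      finally have "E * real d \<le> E * ((real n * c) * (1 + log 2 (real d)))" using E by (intro mult_left_mono)
      then show ?thesis using c d by (simp add: field_simps)
    qed
    also have "\<dots> = R (real d)" by (simp add: R_def E_def)
    also have "\<dots> < \<delta>" using B0 d by simp
    finally show "\<bar>orbit_mean d H a - 1 / 2\<bar> < \<delta>" .
  qed
qed

text \<open>The witness adds m r, where r is the product of the primes of \<open>d\<close> that do
  not divide \<open>t\<close>. A prime of \<open>d\<close> then divides exactly one of t and m r,
  since those dividing t divide neither m nor r.\<close>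

lemma exists_coprime_in_residue_class:
  fixes t m d :: nat
  assumes "coprime t m" "d > 0"
  obtains s where "[s = t] (mod m)" "coprime s d"
proof
  define r where "r = \<Prod>{p \<in> prime_factors d. \<not> p dvd t}"
  show "[t + m * r = t] (mod m)" by (simp add: cong_def)
  show "coprime (t + m * r) d"
  proof (rule ccontr)
    assume "\<not> coprime (t + m * r) d"
    then have "gcd (t + m * r) d \<noteq> 1" using coprime_iff_gcd_eq_1 by blast
    then obtain p where "prime p" "p dvd gcd (t + m * r) d"
      using prime_factor_nat by blast
    then have p: "prime p" "p dvd t + m * r" "p dvd d" by auto
    have pd: "p \<in> prime_factors d" using p assms by (simp add: in_prime_factors_iff)
    show False
    proof (cases "p dvd t")
      case True
      then have "p dvd m * r" using p(2) by (simp add: dvd_add_right_iff)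
      then consider "p dvd m" | "p dvd r" using p(1) prime_dvd_mult_iff by blast
      then show False
      proof cases
        case 1
        then show False using True assms(1) p(1) by (meson coprime_common_divisor not_prime_unit)
      next
        case 2
        then obtain x where "x \<in> {p \<in> prime_factors d. \<not> p dvd t}" "p dvd x"
          unfolding r_def using p(1) prime_dvd_prod_iff[of "{p \<in> prime_factors d. \<not> p dvd t}" p "\<lambda>x. x"] by auto
        then show False using p(1) True primes_dvd_imp_eq[of p x] by (auto simp: in_prime_factors_iff)
      qed
    next
      case False
      then have "p dvd r" unfolding r_def using pd by (intro dvd_prodI[of _ _ "\<lambda>x. x", simplified]) auto
      then show False using False p(2) by (simp add: dvd_add_left_iff)
    qed
  qed
qed

section \<open>Passage from the modulus to one of its divisors\<close>

lemma unit_subgroup_one: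
  assumes H: "unit_subgroup d H"
  shows "1 mod d \<in> H"
proof -
  note U = unit_subgroupD[OF H]
  obtain h where h: "h \<in> H" using U(1) by blast
  then have "h \<in> (\<lambda>t. h * t mod d) ` H"
    using unit_subgroup_mult_bij[OF H h] by (simp add: bij_betw_def)
  then obtain t where t: "t \<in> H" "h * t mod d = h" by auto
  then have "[h * t = h * 1] (mod d)" using U(7)[OF h] by (simp add: cong_def)
  then have "[t = 1] (mod d)" using U(6)[OF h] by (simp only: cong_mult_lcancel_nat)
  then show ?thesis using t U(7)[OF t(1)] by (simp add: cong_def)
qed

lemma unit_subgroup_image:
  assumes H: "unit_subgroup d H" and "m dvd d"
  shows "unit_subgroup m ((\<lambda>t. t mod m) ` H)"
proof -
  note U = unit_subgroupD[OF H]
  have m: "m > 0" using U(5) assms(2) by (metis dvd_0_left neq0_conv)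
  have "s mod m * (t mod m) mod m \<in> (\<lambda>t. t mod m) ` H" if "s \<in> H" "t \<in> H" for s t
  proof -
    have "s mod m * (t mod m) mod m = (s * t mod d) mod m"
      using assms(2) by (simp add: mod_mult_eq mod_mod_cancel)
    then show ?thesis using U(8)[OF that] by blast
  qed
  moreover have "coprime (t mod m) m" if "t \<in> H" for t
    using U(6)[OF that] assms(2) m by (metis coprime_divisors coprime_mod_left_iff dvd_refl not_gr_zero)
  ultimately show ?thesis using U(1) m by (auto simp: unit_subgroup_def)
qed

text \<open>The fibres of reduction are cosets of its kernel: multiplication by an element h above u
  carries the kernel onto the fibre over u.\<close>

lemma unit_subgroup_fibre_card:
  assumes H: "unit_subgroup d H" and m: "m dvd d" and u: "u \<in> (\<lambda>t. t mod m) ` H"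
  shows "card {t \<in> H. t mod m = u} = card {t \<in> H. [t = 1] (mod m)}"
proof -
  note U = unit_subgroupD[OF H]
  obtain h where h: "h \<in> H" "u = h mod m" using u by blast
  note bij = unit_subgroup_mult_bij[OF H h(1)]
  have cop: "coprime h m" using U(6)[OF h(1)] m by (meson coprime_divisors dvd_refl)
  have iff: "h * t mod d mod m = u \<longleftrightarrow> [t = 1] (mod m)" for t
  proof -
    have "h * t mod d mod m = u \<longleftrightarrow> [h * t = h * 1] (mod m)"
      using m h by (simp add: mod_mod_cancel cong_def)
    also have "\<dots> \<longleftrightarrow> [t = 1] (mod m)" using cop by (rule cong_mult_lcancel_nat)
    finally show ?thesis .
  qed
  have "(\<lambda>t. h * t mod d) ` {t \<in> H. [t = 1] (mod m)} = {t \<in> H. t mod m = u}"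
  proof (intro equalityI subsetI)
    fix s assume s: "s \<in> {t \<in> H. t mod m = u}"
    then obtain t where "t \<in> H" "s = h * t mod d" using bij unfolding bij_betw_def by blast
    then show "s \<in> (\<lambda>t. h * t mod d) ` {t \<in> H. [t = 1] (mod m)}" using s iff by blast
  qed (use iff bij in \<open>auto simp: bij_betw_def\<close>)
  moreover have "inj_on (\<lambda>t. h * t mod d) {t \<in> H. [t = 1] (mod m)}"
    using bij unfolding bij_betw_def by (rule inj_on_subset[OF conjunct1]) auto
  from card_image[OF this] have "card ((\<lambda>t. h * t mod d) ` {t \<in> H. [t = 1] (mod m)})
    = card {t \<in> H. [t = 1] (mod m)}" .
  ultimately show ?thesis by (simp only:)
qed

lemma sum_unit_subgroup_mod:
  fixes \<phi> :: "nat \<Rightarrow> real"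
  assumes H: "unit_subgroup d H" and m: "m dvd d"
  shows "(\<Sum>t\<in>H. \<phi> (t mod m)) = real (card {t \<in> H. [t = 1] (mod m)}) * (\<Sum>u\<in>(\<lambda>t. t mod m) ` H. \<phi> u)"
proof -
  have "(\<Sum>t\<in>H. \<phi> (t mod m)) = (\<Sum>u\<in>(\<lambda>t. t mod m) ` H. \<Sum>t\<in>{t \<in> H. t mod m = u}. \<phi> (t mod m))"
    by (rule sum.image_gen[OF unit_subgroupD(2)[OF H]])
  also have "\<dots> = (\<Sum>u\<in>(\<lambda>t. t mod m) ` H. real (card {t \<in> H. [t = 1] (mod m)}) * \<phi> u)"
    by (intro sum.cong refl) (simp add: unit_subgroup_fibre_card[OF H m, symmetric] del: One_nat_def)
  finally show ?thesis by (simp add: sum_distrib_left)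
qed

lemma card_unit_subgroup_mod:
  assumes H: "unit_subgroup d H" and m: "m dvd d"
  shows "card H = card {t \<in> H. [t = 1] (mod m)} * card ((\<lambda>t. t mod m) ` H)"
proof -
  have "real (card H) = real (card {t \<in> H. [t = 1] (mod m)} * card ((\<lambda>t. t mod m) ` H))"
    using sum_unit_subgroup_mod[OF H m, of "\<lambda>_. 1"] by simp
  then show ?thesis by (simp only: of_nat_eq_iff)
qed

text \<open>Representatives here start at 0, those in \<open>totatives\<close> at 1. The two sets
  differ only for k = 1, where each has one element.\<close>

lemma card_coprime_less:
  assumes "k > 0"
  shows "card {t. t < k \<and> coprime t k} = totient k"
proof (cases "k = 1")
  case True
  then have "{t. t < k \<and> coprime t k} = {0}" by auto
  then show ?thesis using True by simp
next
  case False
  then have "{t. t < k \<and> coprime t k} = totatives k" using assms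
    by (auto simp: totatives_def intro: Nat.gr0I le_neq_implies_less)
  then show ?thesis by (simp add: totient_def)
qed

text \<open>The index cannot grow under reduction: the full unit group maps onto the units modulo
  \<open>m\<close>, and the kernel on \<open>H\<close> is contained in the kernel on the full
  group.\<close>

lemma unit_subgroup_index_image:
  assumes H: "unit_subgroup d H" and m: "m dvd d" and n: "totient d \<le> n * card H"
  shows "totient m \<le> n * card ((\<lambda>t. t mod m) ` H)"
proof -
  note U = unit_subgroupD[OF H]
  have m0: "m > 0" using U(5) m by (metis dvd_0_left neq0_conv)
  define V where "V k = {t. t < k \<and> coprime t k}" for k :: nat
  have cardV: "card (V k) = totient k" if "k > 0" for k
    using card_coprime_less[OF that] by (simp add: V_def)
  have V: "unit_subgroup d (V d)"
  proof -
    have "1 mod d \<in> V d" using U(5) by (simp add: V_def)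
    then show ?thesis using U(5) by (auto simp: unit_subgroup_def V_def)
  qed
  have im: "(\<lambda>t. t mod m) ` V d = V m"
  proof (intro equalityI subsetI)
    fix t assume "t \<in> V m"
    then have t: "t < m" "coprime t m" by (auto simp: V_def)
    obtain s where s: "[s = t] (mod m)" "coprime s d"
      using exists_coprime_in_residue_class[OF t(2) U(5)] by blast
    have "s mod d mod m = t" using s(1) t(1) m by (simp add: mod_mod_cancel cong_def)
    moreover have "s mod d \<in> V d" using s(2) U(5) by (simp add: V_def)
    ultimately show "t \<in> (\<lambda>t. t mod m) ` V d" by blast
  next
    fix t assume "t \<in> (\<lambda>t. t mod m) ` V d"
    then show "t \<in> V m" using unit_subgroup_image[OF V m] by (auto simp: unit_subgroup_def V_def)
  qed
  let ?c = "card {t \<in> H. [t = 1] (mod m)}" and ?\<kappa> = "card {t \<in> V d. [t = 1] (mod m)}"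
  have fin: "finite (V d)" using unit_subgroupD(2)[OF V] .
  have HV: "H \<subseteq> V d" using H by (auto simp: unit_subgroup_def V_def)
  have "?c \<le> ?\<kappa>" using HV fin by (intro card_mono) auto
  have "?\<kappa> * totient m = totient d"
    using card_unit_subgroup_mod[OF V m] cardV[OF U(5)] cardV[OF m0] im by simp
  also have "\<dots> \<le> n * (?c * card ((\<lambda>t. t mod m) ` H))" using n card_unit_subgroup_mod[OF H m] by simp
  also have "\<dots> \<le> n * (?\<kappa> * card ((\<lambda>t. t mod m) ` H))" using \<open>?c \<le> ?\<kappa>\<close> by simp
  finally have "?\<kappa> * totient m \<le> ?\<kappa> * (n * card ((\<lambda>t. t mod m) ` H))" by (simp add: mult_ac)
  moreover have "1 mod d \<in> {t \<in> V d. [t = 1] (mod m)}"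
    using unit_subgroup_one[OF V] m by (simp only: mem_Collect_eq cong_def mod_mod_cancel)
  then have "?\<kappa> > 0" using fin by (subst card_gt_0_iff) auto
  ultimately show ?thesis by simp
qed

text \<open>Since a / d = b / m, the summand depends only on t mod m, and all fibres of reduction on
  \<open>H\<close> have the same size.\<close>

lemma orbit_mean_reduce:
  assumes H: "unit_subgroup d H" and d: "d = g * m" and a: "a = int g * b"
  shows "orbit_mean d H a = orbit_mean m ((\<lambda>t. t mod m) ` H) b"
proof -
  note U = unit_subgroupD[OF H]
  have g: "g > 0" and m: "m dvd d" using U(5) d by auto
  let ?c = "card {t \<in> H. [t = 1] (mod m)}"
  let ?H = "(\<lambda>t. t mod m) ` H"
  have "?c > 0" using card_unit_subgroup_mod[OF H m] U(4) by (metis mult_is_0 neq0_conv)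
  have "frac (real_of_int (int t * a) / real d) = frac (real_of_int (int (t mod m) * b) / real m)" for t
  proof -
    have "real_of_int (int t * a) / real d = real_of_int (int t * b) / real m"
      using g d a by simp
    also have "frac \<dots> = frac (real_of_int (int (t mod m) * b) / real m)"
      by (intro frac_cong) (simp add: cong_def zmod_int mod_mult_left_eq)
    finally show ?thesis .
  qed
  then have "orbit_mean d H a = real ?c * (\<Sum>u\<in>?H. frac (real_of_int (int u * b) / real m)) / real (card H)"
    using sum_unit_subgroup_mod[OF H m, of "\<lambda>u. frac (real_of_int (int u * b) / real m)"]
    by (simp add: orbit_mean_def)
  also have "\<dots> = orbit_mean m ?H b"
    using \<open>?c > 0\<close> card_unit_subgroup_mod[OF H m] by (simp add: orbit_mean_def)
  finally show ?thesis .
qed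

text \<open>The denominator of a / d in lowest terms, equivalently the additive order of a in
  Z/d.\<close>

definition exact_order :: "nat \<Rightarrow> int \<Rightarrow> nat" where
  "exact_order d a = d div nat (gcd a (int d))"

lemma exact_order_decomp:
  assumes "d > 0"
  obtains g b where "g > 0" "d = g * exact_order d a" "a = int g * b" "coprime b (int (exact_order d a))"
proof -
  define g where "g = nat (gcd a (int d))"
  have g: "g > 0" "int g = gcd a (int d)" using assms by (auto simp: g_def)
  have "g dvd d" using g(2) by (metis gcd_dvd2 of_nat_dvd_iff)
  then have d: "d = g * exact_order d a" by (simp add: exact_order_def g_def[symmetric])
  have "int g dvd a" using g(2) by simp
  then obtain b where b: "a = int g * b" by blast
  have "gcd (int g * b) (int g * int (exact_order d a)) = int g"
    using g(2) b d by (metis of_nat_mult)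
  then have "int g * gcd b (int (exact_order d a)) = int g"
    by (simp add: gcd_mult_left)
  then have "coprime b (int (exact_order d a))"
    using g(1) by (auto simp: coprime_iff_gcd_eq_1)
  with that g d b show thesis by blast
qed

lemma dvd_exact_order_mult: "d > 0 \<Longrightarrow> int d dvd int (exact_order d a) * a"
proof -
  assume "d > 0"
  then obtain g b where gb: "d = g * exact_order d a" "a = int g * b"
    using exact_order_decomp by blast
  have "int (exact_order d a) * a = int (g * exact_order d a) * b" by (subst gb(2)) simp
  then show ?thesis using gb(1) by (metis dvd_triv_left)
qed

text \<open>Writing a / d in lowest terms makes the numerator a unit, and the image of
  \<open>H\<close> still has index at most \<open>n\<close>. Hence the threshold is imposed on the
  denominator and not on \<open>d\<close>.\<close>

lemma orbit_mean_equidistributed: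
  assumes "\<delta> > 0"
  shows "\<exists>B. \<forall>d H a. unit_subgroup d H \<longrightarrow> totient d \<le> n * card H \<longrightarrow> exact_order d a > B \<longrightarrow>
           \<bar>orbit_mean d H a - 1 / 2\<bar> < \<delta>"
proof -
  obtain B where B: "\<And>d H a. d > B \<Longrightarrow> unit_subgroup d H \<Longrightarrow> totient d \<le> n * card H \<Longrightarrow>
      coprime a (int d) \<Longrightarrow> \<bar>orbit_mean d H a - 1 / 2\<bar> < \<delta>"
    using orbit_mean_unit_equidistributed[OF assms, of n] by blast
  show ?thesis
  proof (intro exI[of _ B] allI impI)
    fix d H and a :: int
    assume H: "unit_subgroup d H" "totient d \<le> n * card H" "exact_order d a > B"
    define m where "m = exact_order d a"
    obtain g b where gb: "g > 0" "d = g * m" "a = int g * b" "coprime b (int m)"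
      using exact_order_decomp[OF unit_subgroupD(5)[OF H(1)], of a] unfolding m_def by metis
    have md: "m dvd d" using gb by simp
    show "\<bar>orbit_mean d H a - 1 / 2\<bar> < \<delta>"
      unfolding orbit_mean_reduce[OF H(1) gb(2,3)]
      using H unit_subgroup_image[OF H(1) md] unit_subgroup_index_image[OF H(1) md H(2)] gb(4)
      by (intro B) (auto simp: m_def)
  qed
qed

text \<open>Multiplying by a unit keeps the denominator of a / d, so every fractional part in the
  mean is a positive multiple of its inverse.\<close>

lemma orbit_mean_ge:
  assumes H: "unit_subgroup d H" and a: "\<not> int d dvd a"
  shows "orbit_mean d H a \<ge> 1 / real (exact_order d a)"
proof -
  note U = unit_subgroupD[OF H]
  define m where "m = exact_order d a"
  obtain g b where gb: "g > 0" "d = g * m" "a = int g * b" "coprime b (int m)"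
    using exact_order_decomp[OF U(5), of a] unfolding m_def by metis
  have m: "m > 0" using gb(2) U(5) by (metis mult_0_right not_gr_zero)
  have ge: "frac (real_of_int (int t * a) / real d) \<ge> 1 / real m" if t: "t \<in> H" for t
  proof -
    have "\<not> int d dvd int t * a"
      using a U(6)[OF t] by (metis coprime_commute coprime_dvd_mult_right_iff coprime_int_iff)
    then have "\<not> int m dvd int t * b" using gb by (auto simp: mult.left_commute)
    then have "(int t * b) mod int m \<ge> 1" using m by (simp add: dvd_eq_mod_eq_0 order_le_neq_trans int_one_le_iff_zero_less)
    then have "1 \<le> real_of_int ((int t * b) mod int m)" by (simp only: of_int_1_le_iff)
    moreover have "real_of_int (int t * a) / real d = real_of_int (int t * b) / real m"
      using gb by simp
    ultimately show ?thesis using m frac_int_div_nat[OF m, of "int t * b"] by (simp add: divide_right_mono)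
  qed
  have "real (card H) * (1 / real m) \<le> (\<Sum>t\<in>H. frac (real_of_int (int t * a) / real d))"
    using ge by (intro sum_bounded_below)
  then show ?thesis using U(4) by (simp add: orbit_mean_def m_def field_simps)
qed

text \<open>The \<open>a i\<close> together with \<open>d\<close> generate the integers, so a
  multiplier that kills every \<open>a i\<close> modulo \<open>d\<close> also kills 1.\<close>

lemma A'_set_dvd:
  assumes a: "a \<in> A'_set d w" and M: "\<And>i. i \<le> w + 1 \<Longrightarrow> int d dvd int M * a i"
  shows "d dvd M"
proof -
  have "int d dvd Gcd ((*) (int M) ` insert (int d) (a ` {..w+1}))"
    using M by (intro Gcd_greatest) auto
  also have "\<dots> = normalize (int M * Gcd (insert (int d) (a ` {..w+1})))"
    by (rule Gcd_mult)
  also have "\<dots> = int M" using a by (simp add: A'_set_def)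
  finally show ?thesis by simp
qed

lemma sum_orbit_mean_gt:
  "\<exists>C \<epsilon>. \<epsilon> > 0 \<and> (\<forall>d H w a. d > C \<longrightarrow> unit_subgroup d H \<longrightarrow> totient d \<le> n * card H \<longrightarrow>
     w \<ge> 1 \<longrightarrow> a \<in> A'_set d w \<longrightarrow> (\<Sum>i\<le>w+1. orbit_mean d H (a i)) > 1 + \<epsilon>)"
proof -
  \<comment> \<open>With tolerance 1/12, three large denominators contribute at least 3 * 5/12 =
    5/4, which leaves room for an \<epsilon> of at most 1/8.\<close>
  obtain B where B: "\<And>d H a. unit_subgroup d H \<Longrightarrow> totient d \<le> n * card H \<Longrightarrow> exact_order d a > B \<Longrightarrow>
      \<bar>orbit_mean d H a - 1 / 2\<bar> < 1 / 12"
    using orbit_mean_equidistributed[of "1/12" n] by auto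
  define B0 where "B0 = max B 1"
  have B0: "B0 \<ge> 1" "B0 \<ge> B" by (auto simp: B0_def)
  \<comment> \<open>A small denominator contributes at least 1/B0 = 4 \<eta>. Two means within
    \<eta> of 1/2 lose less than 2 \<eta>, so the total exceeds 1 + 2 \<eta>.\<close>
  define \<eta> where "\<eta> = 1 / (4 * real B0)"
  have \<eta>: "\<eta> > 0" "1 / real B0 = 4 * \<eta>" using B0 by (auto simp: \<eta>_def)
  obtain B1 where B1: "\<And>d H a. unit_subgroup d H \<Longrightarrow> totient d \<le> n * card H \<Longrightarrow> exact_order d a > B1 \<Longrightarrow>
      \<bar>orbit_mean d H a - 1 / 2\<bar> < \<eta>"
    using orbit_mean_equidistributed[of \<eta> n] \<eta> by auto
  \<comment> \<open>Every exact order up to \<open>B0\<close> divides the factorial, so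
    \<open>L\<close> kills all terms with small denominator at once.\<close>
  define L :: nat where "L = fact B0"
  have L: "L > 0" by (simp add: L_def)
  define \<epsilon> where "\<epsilon> = \<eta> / 2"
  have \<epsilon>: "\<epsilon> > 0" "\<epsilon> \<le> 1 / 8" using B0 by (auto simp: \<epsilon>_def \<eta>_def field_simps)
  show ?thesis
  \<comment> \<open>The threshold serves twice: it rules out that \<open>d\<close> divides
    \<open>L\<close>, and a denominator m with d <= L m must exceed \<open>B1\<close>.\<close>
  proof (intro exI[of _ "L * max B1 1"] exI[of _ \<epsilon>] conjI allI impI \<epsilon>)
    fix d H w and a :: "nat \<Rightarrow> int"
    assume d: "d > L * max B1 1" and H: "unit_subgroup d H" and n: "totient d \<le> n * card H"
      and w: "w \<ge> 1" and a: "a \<in> A'_set d w"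
    note U = unit_subgroupD[OF H]
    let ?I = "{..w+1}" and ?m = "\<lambda>i. orbit_mean d H (a i)"
    have nd: "\<not> int d dvd a i" if "i \<in> ?I" for i using a that by (auto simp: A'_set_def)
    have sum0: "int d dvd (\<Sum>i\<in>?I. a i)" using a by (auto simp: A'_set_def)
    have pos: "?m i \<ge> 0" for i by (simp add: orbit_mean_def sum_nonneg)
    have dL: "\<not> d dvd L"
    proof
      assume "d dvd L"
      then have "d \<le> L * 1" using L by (simp add: dvd_imp_le)
      also have "\<dots> \<le> L * max B1 1" by (intro mult_le_mono2) auto
      finally show False using d by simp
    qed
    define S where "S = {i \<in> ?I. exact_order d (a i) > B0}"
    have S: "finite S" "S \<subseteq> ?I" by (auto simp: S_def)
    have out: "int d dvd int L * a i" if "i \<in> ?I - S" for i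
    proof -
      have le: "exact_order d (a i) \<le> B0" using that by (auto simp: S_def)
      moreover have "exact_order d (a i) \<ge> 1"
        using exact_order_decomp[OF U(5), of "a i"] U(5) by (metis One_nat_def Suc_leI mult_0_right not_gr_zero)
      ultimately have "exact_order d (a i) dvd L" by (simp add: L_def dvd_fact)
      then show ?thesis using dvd_exact_order_mult[OF U(5), of "a i"] 
        by (metis dvd_trans mult_dvd_mono dvd_refl of_nat_dvd_iff)
    qed
    have sumS: "int d dvd int L * (\<Sum>i\<in>S. a i)"
    proof -
      have "int L * (\<Sum>i\<in>?I. a i) = int L * (\<Sum>i\<in>S. a i) + (\<Sum>i\<in>?I - S. int L * a i)"
        using sum.subset_diff[OF S(2), of a] by (simp add: algebra_simps sum_distrib_left)
      moreover have "int d dvd (\<Sum>i\<in>?I - S. int L * a i)" using out by (intro dvd_sum) auto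
      moreover have "int d dvd int L * (\<Sum>i\<in>?I. a i)" using sum0 by simp
      ultimately show ?thesis by (metis dvd_add_left_iff)
    qed
    consider "card S \<ge> 3" | "card S = 2" | "card S \<le> 1" by linarith
    then show "(\<Sum>i\<in>?I. ?m i) > 1 + \<epsilon>"
    proof cases
      case 1
      have "real (card S) * (5 / 12) \<le> (\<Sum>i\<in>S. ?m i)"
      proof (intro sum_bounded_below)
        fix i assume "i \<in> S"
        then have "\<bar>?m i - 1 / 2\<bar> < 1 / 12" using B0 by (intro B H n) (auto simp: S_def)
        then show "5 / 12 \<le> ?m i" by linarith
      qed
      moreover have "real (card S) \<ge> 3" using 1 by simp
      moreover have "(\<Sum>i\<in>S. ?m i) \<le> (\<Sum>i\<in>?I. ?m i)" using S pos by (intro sum_mono2) auto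
      ultimately show ?thesis using \<epsilon> by linarith
    next
      case 2
      then obtain i j where ij: "S = {i, j}" "i \<noteq> j" by (meson card_2_iff)
      \<comment> \<open>\<open>L\<close> times the order of \<open>a i\<close> kills
        \<open>a i\<close>, hence also \<open>a j\<close> through the relation \<open>sumS\<close>,
        and all small terms. So it kills everything, is divisible by \<open>d\<close>, and the order
        of \<open>a i\<close> is at least d / L.\<close>
      have large: "exact_order d (a i) > B1" if ij: "S = {i, j}" "i \<noteq> j" for i j
      proof -
        let ?M = "L * exact_order d (a i)"
        have mi: "int d dvd int ?M * a i"
          using dvd_exact_order_mult[OF U(5), of "a i"] by (simp add: mult.assoc)
        have "int d dvd int (exact_order d (a i)) * (int L * (a i + a j))"
          using sumS ij by simp
        then have "int d dvd int ?M * a i + int ?M * a j" by (simp add: algebra_simps)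
        then have mj: "int d dvd int ?M * a j" using mi dvd_add_right_iff by blast
        have "d dvd ?M"
        proof (rule A'_set_dvd[OF a])
          fix k assume "k \<le> w + 1"
          show "int d dvd int ?M * a k"
          proof (cases "k \<in> S")
            case True
            then show ?thesis using mi mj ij by auto
          next
            case False
            then have "int d dvd int L * a k" using \<open>k \<le> w + 1\<close> out by simp
            then show ?thesis by (simp add: mult.assoc mult.left_commute[of "int L"])
          qed
        qed
        moreover have "?M > 0" using exact_order_decomp[OF U(5), of "a i"] U(5) L 
          by (metis mult_0_right mult_pos_pos not_gr_zero)
        ultimately have "d \<le> ?M" by (simp add: dvd_imp_le)
        then have "L * max B1 1 < L * exact_order d (a i)" using d by linarith
        then show ?thesis by simp
      qed
      have "\<bar>?m i - 1 / 2\<bar> < \<eta>" using large[OF ij] by (intro B1 H n)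
      moreover have "\<bar>?m j - 1 / 2\<bar> < \<eta>" using large[of j i] ij by (intro B1 H n) auto
      \<comment> \<open>There are w + 2 >= 3 indices, so one of them has a small denominator; its
        mean lifts the sum above 1.\<close>
      moreover obtain k where k: "k \<in> ?I - S"
      proof -
        have "card S < card ?I" using 2 w by simp
        then have "\<not> ?I \<subseteq> S" using card_mono[OF S(1)] by (metis not_less)
        then show ?thesis using that by blast
      qed
      moreover have "?m k \<ge> 1 / real B0"
      proof -
        have "exact_order d (a k) \<le> B0" using k by (auto simp: S_def)
        moreover have "exact_order d (a k) > 0"
          using exact_order_decomp[OF U(5), of "a k"] U(5) by (metis mult_0_right not_gr_zero)
        ultimately have "1 / real B0 \<le> 1 / real (exact_order d (a k))" by (simp add: frac_le)
        also have "\<dots> \<le> ?m k" using k by (intro orbit_mean_ge H nd) auto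
        finally show ?thesis .
      qed
      moreover have "(\<Sum>i\<in>{i,j,k}. ?m i) \<le> (\<Sum>i\<in>?I. ?m i)"
        using S k pos ij by (intro sum_mono2) auto
      moreover have "(\<Sum>i\<in>{i,j,k}. ?m i) = ?m i + ?m j + ?m k" using ij k by auto
      ultimately show ?thesis using \<eta> \<epsilon>_def by linarith
    next
      case 3
      \<comment> \<open>With at most one large term, \<open>sumS\<close> shows that \<open>L\<close>
        kills that term too. Then \<open>d\<close> divides \<open>L\<close>, against the choice of
        the threshold.\<close>
      have "int d dvd int L * a i" if "i \<le> w + 1" for i
      proof (cases "i \<in> S")
        case True
        then have "S = {i}" using 3 card_le_Suc0_iff_eq[OF S(1)] by auto
        then show ?thesis using sumS by simp
      qed (use out that in auto)
      then have "d dvd L" by (rule A'_set_dvd[OF a])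
      then show ?thesis using dL by simp
    qed
  qed
qed

section \<open>Algebraic integers modulo a prime above p\<close>

lemma alg_int_iff: "alg_int x \<longleftrightarrow> algebraic_int x"
  unfolding alg_int_def algebraic_int_altdef_ipoly by auto

lemma alg_int_of_int [simp]: "alg_int (of_int k)"
  by (simp add: alg_int_iff int_imp_algebraic_int)

lemma alg_int_of_nat [simp]: "alg_int (of_nat k)"
  by (metis alg_int_of_int of_int_of_nat_eq)

lemma alg_int_0 [simp]: "alg_int 0" and alg_int_1 [simp]: "alg_int 1"
  using alg_int_of_nat[of 0] alg_int_of_nat[of 1] by simp_all

lemma alg_int_root_of_unity:
  assumes "z ^ n = 1" "n > 0"
  shows "alg_int z"
  unfolding alg_int_iff
  by (rule algebraic_int_root[of 1 "Polynomial.monom 1 n"])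
    (use assms in \<open>auto simp: poly_monom degree_monom_eq\<close>)

locale prime_above =
  fixes P :: "complex set" and p :: nat
  assumes prime_p: "prime p" and over: "prime_over P p"
begin

lemma primeideal_P: "primeideal P AI_ring" using over by (simp add: prime_over_def)

lemma AI_ring_sel [simp]:
  "carrier AI_ring = {x. alg_int x}" "x \<otimes>\<^bsub>AI_ring\<^esub> y = x * y" "x \<oplus>\<^bsub>AI_ring\<^esub> y = x + y"
  "\<one>\<^bsub>AI_ring\<^esub> = 1" "\<zero>\<^bsub>AI_ring\<^esub> = 0"
  by (simp_all add: AI_ring_def)

lemma ring_AI: "cring AI_ring" using primeideal_P by (simp add: primeideal_def)

text \<open>A prime ideal of \<open>AI_ring\<close> comes with the fact that \<open>AI_ring\<close>
  is a commutative ring, and closure is read off from this.\<close>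

lemma alg_int_mult [intro]: "alg_int x \<Longrightarrow> alg_int y \<Longrightarrow> alg_int (x * y)"
  and alg_int_add [intro]: "alg_int x \<Longrightarrow> alg_int y \<Longrightarrow> alg_int (x + y)"
  using cring.cring_simprules(1,5)[OF ring_AI, of x y] by simp_all

lemma alg_int_uminus [intro]: "alg_int x \<Longrightarrow> alg_int (- x)"
  using alg_int_mult[of "-1" x] alg_int_of_int[of "-1"] by simp

lemma alg_int_diff [intro]: "alg_int x \<Longrightarrow> alg_int y \<Longrightarrow> alg_int (x - y)"
  using alg_int_add[of x "- y"] by auto

lemma alg_int_sum [intro]: "(\<And>i. i \<in> A \<Longrightarrow> alg_int (g i)) \<Longrightarrow> alg_int (\<Sum>i\<in>A. g i)"
  by (induction A rule: infinite_finite_induct) auto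

lemma alg_int_prod [intro]: "(\<And>i. i \<in> A \<Longrightarrow> alg_int (g i)) \<Longrightarrow> alg_int (\<Prod>i\<in>A. g i)"
  by (induction A rule: infinite_finite_induct) auto

lemma alg_int_power [intro]: "alg_int x \<Longrightarrow> alg_int (x ^ n)"
  by (induction n) auto

lemma P_alg: "x \<in> P \<Longrightarrow> alg_int x"
  using primeideal_P by (auto simp: primeideal_def ideal_def additive_subgroup_def subgroup_def AI_ring_def)

lemma P_add: "x \<in> P \<Longrightarrow> y \<in> P \<Longrightarrow> x + y \<in> P"
  using primeideal_P additive_subgroup.a_closed[of P AI_ring x y]
  by (simp add: primeideal_def ideal_def)

lemma P_mult: "alg_int a \<Longrightarrow> x \<in> P \<Longrightarrow> a * x \<in> P"
  using primeideal_P ideal.I_l_closed[of P AI_ring x a] by (simp add: primeideal_def)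

lemma P_mult': "x \<in> P \<Longrightarrow> alg_int a \<Longrightarrow> x * a \<in> P"
  using P_mult by (simp add: mult.commute)

lemma P_0 [simp]: "0 \<in> P"
  using primeideal_P additive_subgroup.zero_closed[of P AI_ring] by (simp add: primeideal_def ideal_def)

lemma P_uminus: "x \<in> P \<Longrightarrow> - x \<in> P"
  using P_mult[of "-1" x] alg_int_of_int[of "-1"] by simp

lemma P_diff: "x \<in> P \<Longrightarrow> y \<in> P \<Longrightarrow> x - y \<in> P"
  using P_add[of x "- y"] P_uminus[of y] by simp

lemma P_minus_commute: "x - y \<in> P \<Longrightarrow> y - x \<in> P"
  using P_uminus[of "x - y"] by simp

lemma P_sum: "(\<And>i. i \<in> A \<Longrightarrow> g i \<in> P) \<Longrightarrow> (\<Sum>i\<in>A. g i) \<in> P"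
  by (induction A rule: infinite_finite_induct) (auto intro: P_add)

lemma P_trans: "x - y \<in> P \<Longrightarrow> y - z \<in> P \<Longrightarrow> x - z \<in> P"
  using P_add[of "x - y" "y - z"] by simp

lemma P_cong: "x - y \<in> P \<Longrightarrow> x \<in> P \<longleftrightarrow> y \<in> P"
  using P_add[of "x - y" y] P_diff[of x "x - y"] by auto

lemma P_prime: "alg_int x \<Longrightarrow> alg_int y \<Longrightarrow> x * y \<in> P \<Longrightarrow> x \<in> P \<or> y \<in> P"
  using primeideal.I_prime[OF primeideal_P, of x y] by simp

lemma one_notin_P: "1 \<notin> P"
proof
  assume "1 \<in> P"
  then have "P = carrier AI_ring" using P_mult'[of 1] P_alg by auto
  then show False using primeideal.I_notcarr[OF primeideal_P] by simp
qed

lemma notin_P_mult: "alg_int x \<Longrightarrow> alg_int y \<Longrightarrow> x \<notin> P \<Longrightarrow> y \<notin> P \<Longrightarrow> x * y \<notin> P"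
  using P_prime by blast

lemma P_power: "alg_int x \<Longrightarrow> x ^ n \<in> P \<Longrightarrow> x \<in> P"
  by (induction n) (use one_notin_P P_prime in auto)

lemma notin_P_prod: "finite A \<Longrightarrow> (\<And>i. i \<in> A \<Longrightarrow> alg_int (g i) \<and> g i \<notin> P) \<Longrightarrow> (\<Prod>i\<in>A. g i) \<notin> P"
  by (induction A rule: finite_induct) (simp_all add: one_notin_P notin_P_mult alg_int_prod)

lemma prod_in_P: "finite A \<Longrightarrow> (\<And>i. i \<in> A \<Longrightarrow> alg_int (g i)) \<Longrightarrow> (\<Prod>i\<in>A. g i) \<in> P \<Longrightarrow> \<exists>i\<in>A. g i \<in> P"
  using notin_P_prod[of A g] by blast

lemma p_in_P: "of_nat p \<in> P" using over by (simp add: prime_over_def)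

lemma of_int_in_P_iff: "of_int k \<in> P \<longleftrightarrow> int p dvd k"
proof
  assume "int p dvd k"
  then obtain m where "k = int p * m" by blast
  then show "of_int k \<in> P" using P_mult'[OF p_in_P, of "of_int m"] by simp
next
  assume k: "of_int k \<in> P"
  show "int p dvd k"
  proof (rule ccontr)
    assume "\<not> int p dvd k"
    then have "coprime (int p) k" using prime_p by (simp add: prime_imp_coprime)
    then obtain u v where "u * int p + v * k = 1"
      by (metis bezout_int coprime_imp_gcd_eq_1)
    then have "of_int u * of_nat p + of_int v * of_int k = (1 :: complex)"
      by (metis of_int_1 of_int_add of_int_mult of_int_of_nat_eq)
    moreover have "of_int u * of_nat p + of_int v * of_int k \<in> P"
      using k p_in_P by (intro P_add P_mult) auto
    ultimately show False using one_notin_P by simp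
  qed
qed

lemma of_nat_in_P_iff: "of_nat k \<in> P \<longleftrightarrow> p dvd k"
  using of_int_in_P_iff[of "int k"] by simp

section \<open>Congruences modulo \<open>P\<close> and the Frobenius map\<close>

lemma P_diff_mult:
  assumes "x - y \<in> P" "x' - y' \<in> P" "alg_int x" "alg_int y'"
  shows "x * x' - y * y' \<in> P"
proof -
  have "x * x' - y * y' = x * (x' - y') + y' * (x - y)" by (simp add: algebra_simps)
  then show ?thesis using assms by (auto intro!: P_add P_mult)
qed

lemma P_diff_power:
  assumes "x - y \<in> P" "alg_int x" "alg_int y"
  shows "x ^ n - y ^ n \<in> P"
  using assms by (induction n) (simp_all add: P_diff_mult alg_int_power)

text \<open>The multiple of l is kept explicit and l is any prime. The case l = p gives the
  Frobenius map modulo \<open>P\<close>; other primes l occur when roots of unity are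
  conjugated.\<close>

lemma frobenius_add:
  assumes l: "prime l" and xy: "alg_int x" "alg_int y"
  shows "\<exists>w. alg_int w \<and> (x + y) ^ l = x ^ l + y ^ l + of_nat l * w"
proof -
  have l2: "l \<ge> 2" using l by (rule prime_ge_2_nat)
  define c where "c k = (l choose k) div l" for k
  have c: "of_nat (l choose k) = (of_nat l * of_nat (c k) :: complex)" if "k \<in> {1..<l}" for k
  proof -
    have "l dvd (l choose k)" using that l by (intro dvd_choose_prime) auto
    then show ?thesis by (simp add: c_def flip: of_nat_mult)
  qed
  have "(x + y) ^ l = (\<Sum>k\<in>{..l}. of_nat (l choose k) * x ^ k * y ^ (l - k))" by (simp add: binomial_ring)
  also have "{..l} = insert 0 (insert l {1..<l})" using l2 by auto
  also have "(\<Sum>k\<in>\<dots>. of_nat (l choose k) * x ^ k * y ^ (l - k))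
      = y ^ l + (x ^ l + (\<Sum>k\<in>{1..<l}. of_nat (l choose k) * x ^ k * y ^ (l - k)))"
    using l2 by simp
  also have "(\<Sum>k\<in>{1..<l}. of_nat (l choose k) * x ^ k * y ^ (l - k))
      = of_nat l * (\<Sum>k\<in>{1..<l}. of_nat (c k) * x ^ k * y ^ (l - k))"
    unfolding sum_distrib_left by (intro sum.cong refl) (subst c, auto simp: mult_ac)
  finally have "(x + y) ^ l = x ^ l + y ^ l + of_nat l * (\<Sum>k\<in>{1..<l}. of_nat (c k) * x ^ k * y ^ (l - k))"
    by simp
  moreover have "alg_int (\<Sum>k\<in>{1..<l}. of_nat (c k) * x ^ k * y ^ (l - k))"
    by (intro alg_int_sum alg_int_mult alg_int_power alg_int_of_nat xy)
  ultimately show ?thesis by blast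
qed

lemma frobenius_add_P:
  assumes "alg_int x" "alg_int y"
  shows "(x + y) ^ p - (x ^ p + y ^ p) \<in> P"
proof -
  obtain w where "alg_int w" "(x + y) ^ p = x ^ p + y ^ p + of_nat p * w"
    using frobenius_add[OF prime_p assms] by blast
  then show ?thesis using P_mult'[OF p_in_P] by simp
qed

lemma frobenius_add_P_power:
  assumes "alg_int x" "alg_int y"
  shows "(x + y) ^ (p ^ i) - (x ^ (p ^ i) + y ^ (p ^ i)) \<in> P"
proof (induction i)
  case (Suc i)
  have "((x + y) ^ (p ^ i)) ^ p - (x ^ (p ^ i) + y ^ (p ^ i)) ^ p \<in> P"
    using assms by (intro P_diff_power Suc) auto
  moreover have "(x ^ (p ^ i) + y ^ (p ^ i)) ^ p - ((x ^ (p ^ i)) ^ p + (y ^ (p ^ i)) ^ p) \<in> P"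
    using assms by (intro frobenius_add_P) auto
  ultimately have "((x + y) ^ (p ^ i)) ^ p - ((x ^ (p ^ i)) ^ p + (y ^ (p ^ i)) ^ p) \<in> P" by (rule P_trans)
  then show ?case by (simp add: power_mult[symmetric] mult.commute)
qed simp

lemma frobenius_sum_P_power:
  assumes "\<And>i. i \<in> A \<Longrightarrow> alg_int (g i)"
  shows "(\<Sum>i\<in>A. g i) ^ (p ^ k) - (\<Sum>i\<in>A. g i ^ (p ^ k)) \<in> P"
  using assms
proof (induction A rule: infinite_finite_induct)
  case (insert a A)
  have "(g a + (\<Sum>i\<in>A. g i)) ^ (p ^ k) - (g a ^ (p ^ k) + (\<Sum>i\<in>A. g i) ^ (p ^ k)) \<in> P"
    using insert by (intro frobenius_add_P_power) auto
  moreover have "(g a ^ (p ^ k) + (\<Sum>i\<in>A. g i) ^ (p ^ k)) - (g a ^ (p ^ k) + (\<Sum>i\<in>A. g i ^ (p ^ k))) \<in> P"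
    using insert by simp
  ultimately show ?case using insert(1,2) P_trans by simp
qed (use prime_gt_0_nat[OF prime_p] in \<open>simp_all add: power_0_left\<close>)

end

section \<open>Teichmueller lifts\<close>

lemma power_minus_one_eq_prod_mu:
  assumes "n > 0"
  shows "x ^ n - 1 = (\<Prod>u\<in>mu n. x - u)"
proof -
  have mu: "finite (mu n)" "card (mu n) = n"
    using assms card_roots_unity_eq[of n] finite_roots_unity[of n] by (auto simp: mu_def)
  define A where "A = Polynomial.monom 1 n - (1 :: complex poly)"
  define B where "B = (\<Prod>u\<in>mu n. [:- u, 1:])"
  have B: "degree B = n" "lead_coeff B = 1"
  proof -
    show "degree B = n" using mu by (simp add: B_def degree_prod_eq_sum_degree)
    have "lead_coeff B = (\<Prod>u\<in>mu n. lead_coeff [:- u, 1:])" unfolding B_def by (rule lead_coeff_prod)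
    then show "lead_coeff B = 1" by simp
  qed
  have A: "degree A = n" "lead_coeff A = 1"
  proof -
    show "degree A = n" unfolding A_def diff_conv_add_uminus using assms
      by (subst degree_add_eq_left) (simp_all add: degree_monom_eq)
    then show "lead_coeff A = 1" using assms by (simp add: A_def)
  qed
  have "A - B = 0"
  proof (rule ccontr)
    assume ne: "A - B \<noteq> 0"
    have "degree (A - B) \<le> n" using A B by (intro degree_diff_le) auto
    moreover have "poly.coeff (A - B) n = 0" using A B by simp
    ultimately have "degree (A - B) < n"
      using ne by (metis le_neq_implies_less leading_coeff_0_iff)
    moreover have "mu n \<subseteq> {x. poly (A - B) x = 0}"
    proof
      fix u assume u: "u \<in> mu n"
      have "poly A u = 0" using u by (simp add: A_def poly_monom mu_def)
      moreover have "poly B u = 0" using u mu by (auto simp: B_def poly_prod)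
      ultimately show "u \<in> {x. poly (A - B) x = 0}" by simp
    qed
    then have "n \<le> card {x. poly (A - B) x = 0}"
      using card_mono[OF poly_roots_finite[OF ne]] mu by metis
    ultimately show False using card_poly_roots_bound[OF ne] by linarith
  qed
  then have "poly A x = poly B x" by simp
  then show ?thesis by (simp add: A_def B_def poly_monom poly_prod)
qed

lemma sum_mu_powi:
  assumes "n > 0"
  shows "(\<Sum>z\<in>mu n. z powi j) = (if int n dvd j then of_nat n else 0)"
proof -
  have mu: "finite (mu n)" "card (mu n) = n"
    using assms card_roots_unity_eq[of n] finite_roots_unity[of n] by (auto simp: mu_def)
  have nz: "z \<noteq> 0" if "z \<in> mu n" for z using that assms by (auto simp: mu_def power_0_left)
  show ?thesis
  proof (cases "int n dvd j")
    case True
    then obtain k where "j = int n * k" by blast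
    then have "z powi j = 1" if "z \<in> mu n" for z
      using that by (simp add: power_int_mult mu_def)
    then show ?thesis using True mu by simp
  next
    case False
    define w where "w = cis (2 * pi * (1 / real n))"
    have w: "w \<in> mu n" using assms cis_multiple_2pi[of 1] by (simp add: w_def mu_def Complex.DeMoivre)
    have "w powi j = cis (2 * pi * (real_of_int j / real n))"
      by (simp add: w_def cis_power_int mult_ac)
    moreover have "real_of_int j / real n \<notin> \<int>"
    proof
      assume "real_of_int j / real n \<in> \<int>"
      then obtain k where "real_of_int j / real n = of_int k" by (auto elim: Ints_cases)
      then have "real_of_int j = of_int (int n * k)" using assms by (simp add: field_simps)
      then have "j = int n * k" by (simp only: of_int_eq_iff)
      then show False using False by simp
    qed
    ultimately have ne: "w powi j \<noteq> 1" using cis_2pi_eq_1_iff by metis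
    have "bij_betw (\<lambda>z. w * z) (mu n) (mu n)"
    proof (rule bij_betwI[of _ _ _ "\<lambda>z. z / w"])
      show "(\<lambda>z. w * z) \<in> mu n \<rightarrow> mu n" "(\<lambda>z. z / w) \<in> mu n \<rightarrow> mu n"
        using w by (auto simp: mu_def power_mult_distrib power_divide)
    qed (use nz[OF w] in auto)
    then have "(\<Sum>z\<in>mu n. z powi j) = (\<Sum>z\<in>mu n. (w * z) powi j)"
      by (rule sum.reindex_bij_betw[symmetric])
    also have "\<dots> = w powi j * (\<Sum>z\<in>mu n. z powi j)"
      by (simp add: power_int_mult_distrib sum_distrib_left)
    finally show ?thesis using ne False by auto
  qed
qed

locale finite_lift = prime_above +
  fixes f :: nat
  assumes f_pos: "f > 0"
begin

definition N :: nat where "N = p ^ f - 1"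
abbreviation "F \<equiv> insert 0 (mu N)"

lemma q_ge_2: "p ^ f \<ge> 2"
  using prime_ge_2_nat[OF prime_p] f_pos self_le_power[of p f] by linarith

lemma N_pos: "N > 0" and Suc_N: "Suc N = p ^ f"
  using q_ge_2 by (simp_all add: N_def)

lemma N_notin_P: "of_nat N \<notin> P"
proof
  assume "of_nat N \<in> P"
  then have "p dvd N" by (simp only: of_nat_in_P_iff)
  moreover have "p dvd Suc N" unfolding Suc_N using f_pos by simp
  ultimately have "p dvd 1" by (metis Suc_eq_plus1 dvd_add_right_iff)
  then show False using prime_p by simp
qed

lemma finite_mu [simp]: "finite (mu N)" and card_mu [simp]: "card (mu N) = N"
  using N_pos card_roots_unity_eq[of N] finite_roots_unity[of N] by (auto simp: mu_def)

lemma mu_power_q: "z \<in> mu N \<Longrightarrow> z ^ (p ^ f) = z"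
  unfolding Suc_N[symmetric] by (simp add: mu_def)

lemma alg_int_mu: "z \<in> mu N \<Longrightarrow> alg_int z"
  using alg_int_root_of_unity N_pos by (auto simp: mu_def)

lemma mu_nz: "z \<in> mu N \<Longrightarrow> z \<noteq> 0"
  using N_pos by (auto simp: mu_def power_0_left)

lemma mu_1 [simp]: "1 \<in> mu N"
  and mu_mult: "z \<in> mu N \<Longrightarrow> w \<in> mu N \<Longrightarrow> z * w \<in> mu N"
  and mu_divide: "z \<in> mu N \<Longrightarrow> w \<in> mu N \<Longrightarrow> z / w \<in> mu N"
  and mu_power: "z \<in> mu N \<Longrightarrow> z ^ k \<in> mu N"
  by (auto simp: mu_def power_mult_distrib power_divide) (metis mult.commute power_mult power_one)

lemma mu_powi: "z \<in> mu N \<Longrightarrow> z powi k \<in> mu N"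
  using mu_power mu_divide[OF mu_1 mu_power] by (cases "k \<ge> 0") (auto simp: power_int_def divide_inverse power_inverse)

lemma mu_notin_P: "z \<in> mu N \<Longrightarrow> z \<notin> P"
proof
  assume z: "z \<in> mu N" "z \<in> P"
  then have "z * z ^ (N - 1) \<in> P" by (intro P_mult' alg_int_power alg_int_mu)
  moreover have "z * z ^ (N - 1) = 1"
    using z N_pos power_Suc[of z "N - 1"] by (simp add: mu_def)
  ultimately show False using one_notin_P by simp
qed

text \<open>For z different from 1 the powers of z sum to 0, while the congruence makes this sum
  equal to \<open>N\<close> modulo \<open>P\<close>; but \<open>N\<close> is prime to p.\<close>

lemma mu_eq_1_if_cong:
  assumes z: "z \<in> mu N" and "z - 1 \<in> P"
  shows "z = 1"
proof (rule ccontr)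
  assume "z \<noteq> 1"
  then have "(\<Sum>j<N. z ^ j) = 0" using z by (intro sum_roots_of_unity_powers) (auto simp: mu_def)
  moreover have "(\<Sum>j<N. z ^ j - 1 ^ j) \<in> P"
    using assms alg_int_mu by (intro P_sum P_diff_power) auto
  ultimately have "- of_nat N \<in> P" by (simp only: sum_subtractf) simp
  then show False using P_uminus N_notin_P by fastforce
qed

lemma mu_eq_if_cong:
  assumes z: "z \<in> mu N" "w \<in> mu N" and "z - w \<in> P"
  shows "z = w"
proof -
  have "(z - w) * (1 / w) \<in> P" using assms mu_divide[OF mu_1] by (intro P_mult' alg_int_mu) auto
  then have "z / w - 1 \<in> P" using mu_nz[OF z(2)] by (simp add: field_simps)
  then show ?thesis using mu_eq_1_if_cong[OF mu_divide[OF z]] mu_nz[OF z(2)] by simp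
qed

lemma F_eq_if_cong:
  assumes "z \<in> F" "w \<in> F" "z - w \<in> P"
  shows "z = w"
  using assms mu_eq_if_cong[of z w] mu_notin_P[of z] mu_notin_P[of w] P_uminus[of "- w"]
  by (cases "z = 0"; cases "w = 0") simp_all

text \<open>The algebraic integers whose residue lies in the field with q elements, described as the
  fixed points of the q-power map. Unlike the set \<open>F\<close> of representatives, it is closed
  under addition.\<close>

definition FF :: "complex set" where
  "FF = {x. alg_int x \<and> x ^ (p ^ f) - x \<in> P}"

lemma FF_alg: "x \<in> FF \<Longrightarrow> alg_int x" by (simp add: FF_def)

lemma F_subset_FF: "F \<subseteq> FF"
proof -
  have "(0::complex) ^ (p ^ f) = 0" using prime_gt_0_nat[OF prime_p] by (simp add: power_0_left)
  then have "0 \<in> FF" unfolding FF_def by (simp only: mem_Collect_eq diff_zero alg_int_0 P_0 simp_thms)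
  then show ?thesis using alg_int_mu mu_power_q by (auto simp: FF_def)
qed

lemma FF_add: "x \<in> FF \<Longrightarrow> y \<in> FF \<Longrightarrow> x + y \<in> FF"
proof -
  assume xy: "x \<in> FF" "y \<in> FF"
  then have "(x + y) ^ (p ^ f) - (x ^ (p ^ f) + y ^ (p ^ f)) \<in> P" by (intro frobenius_add_P_power FF_alg)
  moreover have "(x ^ (p ^ f) + y ^ (p ^ f)) - (x + y) \<in> P"
    using P_add[of "x ^ (p ^ f) - x" "y ^ (p ^ f) - y"] xy by (simp add: FF_def algebra_simps)
  ultimately show ?thesis using xy P_trans by (auto simp: FF_def)
qed

lemma FF_sum: "(\<And>i. i \<in> A \<Longrightarrow> g i \<in> FF) \<Longrightarrow> (\<Sum>i\<in>A. g i) \<in> FF"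
  by (induction A rule: infinite_finite_induct) (use F_subset_FF in \<open>auto intro: FF_add\<close>)

lemma FF_of_nat: "of_nat k \<in> FF"
  by (induction k) (use F_subset_FF mu_1 in \<open>auto intro!: FF_add\<close>)

text \<open>x^q - x factors as x times the product of x - u over \<open>mu N\<close>; it lies in the
  prime ideal \<open>P\<close>, so one factor does.\<close>

lemma teichmueller_exists:
  assumes x: "x \<in> FF"
  shows "\<exists>u\<in>F. x - u \<in> P"
proof -
  have "x * (\<Prod>u\<in>mu N. x - u) = x ^ Suc N - x"
    unfolding power_minus_one_eq_prod_mu[OF N_pos, symmetric] by (simp add: algebra_simps)
  also have "\<dots> \<in> P" using x unfolding Suc_N by (simp add: FF_def)
  finally have "x * (\<Prod>u\<in>mu N. x - u) \<in> P" .
  then consider "x \<in> P" | "(\<Prod>u\<in>mu N. x - u) \<in> P"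
    using P_prime[OF FF_alg[OF x]] alg_int_prod[of "mu N" "\<lambda>u. x - u"]
      alg_int_diff[OF FF_alg[OF x] alg_int_mu] by blast
  then show ?thesis
  proof cases
    case 2
    then show ?thesis using prod_in_P[of "mu N" "\<lambda>u. x - u"] FF_alg[OF x] alg_int_mu by auto
  qed auto
qed

definition teich :: "complex \<Rightarrow> complex" where
  "teich x = (SOME u. u \<in> F \<and> x - u \<in> P)"

lemma teich: assumes "x \<in> FF" shows "teich x \<in> F" "x - teich x \<in> P"
  using someI_ex[of "\<lambda>u. u \<in> F \<and> x - u \<in> P"] teichmueller_exists[OF assms] unfolding teich_def by blast+

lemma teich_eq: "u \<in> F \<Longrightarrow> x - u \<in> P \<Longrightarrow> x \<in> FF \<Longrightarrow> teich x = u"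
  using F_eq_if_cong[OF teich(1)[of x], of u] P_trans[OF P_minus_commute[OF teich(2)[of x]], of u] by blast

lemma teich_translate_bij:
  assumes w: "w \<in> F"
  shows "bij_betw (\<lambda>x. teich (x + w)) F F"
proof -
  have FF: "x + w \<in> FF" if "x \<in> F" for x using that w F_subset_FF FF_add by blast
  have "inj_on (\<lambda>x. teich (x + w)) F"
  proof (rule inj_onI)
    fix x y assume xy: "x \<in> F" "y \<in> F" "teich (x + w) = teich (y + w)"
    then have "(x + w) - (y + w) \<in> P"
      using P_trans[OF teich(2)[OF FF[OF xy(1)], unfolded xy(3)] P_minus_commute[OF teich(2)[OF FF[OF xy(2)]]]]
      by simp
    then show "x = y" using xy F_eq_if_cong by simp
  qed
  moreover have "(\<lambda>x. teich (x + w)) ` F \<subseteq> F" using teich(1) FF by blast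
  moreover have "finite F" by simp
  ultimately show ?thesis unfolding bij_betw_def using endo_inj_surj by blast
qed

end

context prime_above
begin

text \<open>The case f = 1 of the lifting: 0, ..., p - 1 have p distinct lifts in a set of p
  elements, hence exhaust it, and y shares its lift with one of them. This makes the trace an
  integer modulo \<open>P\<close>.\<close>

lemma cong_int_if_frobenius_fixed:
  assumes y: "alg_int y" "y ^ p - y \<in> P"
  shows "\<exists>k::int. y - of_int k \<in> P"
proof -
  interpret F1: finite_lift P p 1 by unfold_locales simp
  have yF: "y \<in> F1.FF" using y unfolding F1.FF_def by (simp only: mem_Collect_eq power_one_right simp_thms)
  have inj: "inj_on (\<lambda>k. F1.teich (of_nat k)) {..<p}"
  proof (rule inj_onI)
    fix i j assume ij: "i \<in> {..<p}" "j \<in> {..<p}" "F1.teich (of_nat i) = F1.teich (of_nat j)"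
    then have "of_nat i - of_nat j \<in> P"
      using P_trans[OF F1.teich(2)[OF F1.FF_of_nat[of i], unfolded ij(3)]
          P_minus_commute[OF F1.teich(2)[OF F1.FF_of_nat[of j]]]]
      by simp
    then have "of_int (int i - int j) \<in> P" by simp
    then have "int p dvd int i - int j" by (simp only: of_int_in_P_iff)
    then have "[i = j] (mod p)" by (simp only: cong_iff_dvd_diff flip: cong_int_iff)
    then show "i = j" using ij by (simp add: cong_def)
  qed
  have sub: "(\<lambda>k. F1.teich (of_nat k)) ` {..<p} \<subseteq> insert 0 (mu F1.N)"
    using F1.teich(1)[OF F1.FF_of_nat] by blast
  have "card (insert 0 (mu F1.N)) = p"
    using F1.mu_nz F1.card_mu F1.finite_mu F1.Suc_N by (subst card_insert_disjoint) auto
  then have "(\<lambda>k. F1.teich (of_nat k)) ` {..<p} = insert 0 (mu F1.N)"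
    using sub card_image[OF inj] F1.finite_mu by (intro card_subset_eq) auto
  then obtain k where k: "F1.teich y = F1.teich (of_nat k)" using F1.teich(1)[OF yF] by auto
  have "y - of_nat k \<in> P"
    using P_trans[OF F1.teich(2)[OF yF, unfolded k] P_minus_commute[OF F1.teich(2)[OF F1.FF_of_nat[of k]]]]
    by simp
  then show ?thesis by (intro exI[of _ "int k"]) simp
qed

end

section \<open>Gauss and Jacobi sums\<close>

context finite_lift
begin

abbreviation T :: "complex \<Rightarrow> complex" where "T x \<equiv> (\<Sum>i<f. x ^ (p ^ i))"

lemma alg_int_T: "x \<in> FF \<Longrightarrow> alg_int (T x)"
  by (intro alg_int_sum alg_int_power FF_alg)

lemma T_power_p_shift:
  "(\<Sum>i<f. (x ^ (p ^ i)) ^ p) = T x - x + x ^ (p ^ f)"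
proof -
  have "(\<Sum>i<f. (x ^ (p ^ i)) ^ p) = (\<Sum>i<f. x ^ (p ^ Suc i))"
    by (intro sum.cong refl) (simp add: power_mult[symmetric] mult.commute)
  moreover have "x ^ (p ^ 0) + (\<Sum>i<f. x ^ (p ^ Suc i)) = (\<Sum>i<Suc f. x ^ (p ^ i))"
    by (simp only: sum.lessThan_Suc_shift)
  ultimately show ?thesis by (simp add: algebra_simps)
qed

lemma T_cong_int: "x \<in> FF \<Longrightarrow> \<exists>k::int. T x - of_int k \<in> P"
proof (rule cong_int_if_frobenius_fixed)
  assume x: "x \<in> FF"
  then show "alg_int (T x)" by (rule alg_int_T)
  have "T x ^ (p ^ 1) - (\<Sum>i<f. (x ^ (p ^ i)) ^ (p ^ 1)) \<in> P"
    using x by (intro frobenius_sum_P_power alg_int_power FF_alg)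
  moreover have "(\<Sum>i<f. (x ^ (p ^ i)) ^ (p ^ 1)) - T x \<in> P"
    using x unfolding power_one_right T_power_p_shift by (simp add: FF_def)
  ultimately show "T x ^ p - T x \<in> P" using P_trans by fastforce
qed

lemma trace_int_cong: "x \<in> FF \<Longrightarrow> T x - of_int (trace_int P p f x) \<in> P"
  unfolding trace_int_def by (rule someI_ex[OF T_cong_int])

lemma T_add: "x \<in> FF \<Longrightarrow> y \<in> FF \<Longrightarrow> T (x + y) - (T x + T y) \<in> P"
  unfolding sum.distrib[symmetric] sum_subtractf[symmetric]
  by (intro P_sum frobenius_add_P_power FF_alg)

lemma T_cong: "x \<in> FF \<Longrightarrow> y \<in> FF \<Longrightarrow> x - y \<in> P \<Longrightarrow> T x - T y \<in> P"
  unfolding sum_subtractf[symmetric] by (intro P_sum P_diff_power FF_alg)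

lemma T_mu_power_p: "z \<in> mu N \<Longrightarrow> T (z ^ p) = T z"
  using T_power_p_shift[of z] mu_power_q[of z] by (simp add: power_mult[symmetric] mult.commute)

text \<open>Only the term i = 0 of the trace survives, because p^i - 1 lies strictly between 0 and
  \<open>N\<close> for 0 < i < f. The identity yields both the nontriviality of the additive
  character and the leading coefficient of \<open>G 1\<close>.\<close>

lemma sum_mu_inverse_T: "(\<Sum>z\<in>mu N. inverse z * T z) = of_nat N"
proof -
  have "(\<Sum>z\<in>mu N. inverse z * T z) = (\<Sum>z\<in>mu N. \<Sum>i<f. z powi (int (p ^ i) - 1))"
    unfolding sum_distrib_left
    by (intro sum.cong refl) (simp add: power_int_diff mu_nz field_simps flip: of_nat_power)
  also have "\<dots> = (\<Sum>i<f. \<Sum>z\<in>mu N. z powi (int (p ^ i) - 1))" by (rule sum.swap)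
  also have "\<dots> = (\<Sum>i<f. if i = 0 then of_nat N else 0)"
  proof (intro sum.cong refl)
    fix i assume i: "i \<in> {..<f}"
    have "int N dvd int (p ^ i) - 1 \<longleftrightarrow> i = 0"
    proof
      assume dvd: "int N dvd int (p ^ i) - 1"
      show "i = 0"
      proof (rule ccontr)
        assume "i \<noteq> 0"
        have p2: "p \<ge> 2" using prime_p by (rule prime_ge_2_nat)
        have "p ^ i < p ^ f" using i p2 by (intro power_strict_increasing) auto
        moreover have "p ^ i \<ge> 2" using self_le_power[of p i] p2 \<open>i \<noteq> 0\<close> by linarith
        ultimately have "0 < int (p ^ i) - 1" "int (p ^ i) - 1 < int N" using Suc_N by linarith+
        then show False using dvd zdvd_not_zless by blast
      qed
    qed simp
    then show "(\<Sum>z\<in>mu N. z powi (int (p ^ i) - 1)) = (if i = 0 then of_nat N else 0)"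
      using sum_mu_powi[OF N_pos] by simp
  qed
  also have "\<dots> = of_nat N" using f_pos by simp
  finally show ?thesis .
qed

end

section \<open>The additive character and its Gauss sums\<close>

locale gauss_sums = finite_lift +
  fixes c :: int
  assumes c: "\<not> int p dvd c"
begin

abbreviation \<psi> :: "complex \<Rightarrow> complex" where "\<psi> \<equiv> psi_q P p c f"

text \<open>\<open>trace_int\<close> is a choice among integers congruent modulo p, so any integer
  representing the trace computes the character.\<close>

lemma psi_eq:
  assumes "x \<in> FF" "T x - of_int k \<in> P"
  shows "\<psi> x = cis (2 * pi * (real_of_int (c * k) / real p))"
proof -
  let ?t = "trace_int P p f x"
  have "of_int (?t - k) \<in> P"
    using P_trans[OF P_minus_commute[OF trace_int_cong[OF assms(1)]] assms(2)] by simp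
  then have "int p dvd ?t - k" by (simp only: of_int_in_P_iff)
  then have "[c * ?t = c * k] (mod int p)" by (intro cong_mult cong_refl) (simp add: cong_iff_dvd_diff)
  from cis_2pi_cong[OF this] show ?thesis
    by (simp add: psi_q_def cis_conv_exp mult_ac)
qed

lemma psi_add:
  assumes "x \<in> FF" "y \<in> FF"
  shows "\<psi> (x + y) = \<psi> x * \<psi> y"
proof -
  obtain k l where kl: "T x - of_int k \<in> P" "T y - of_int l \<in> P" using T_cong_int assms by blast
  have "T (x + y) - of_int (k + l) \<in> P"
    using P_trans[OF T_add[OF assms]] P_add[OF kl] by (simp add: algebra_simps)
  then have "\<psi> (x + y) = cis (2 * pi * (real_of_int (c * (k + l)) / real p))"
    using assms FF_add by (intro psi_eq)
  then show ?thesis using psi_eq[OF assms(1) kl(1)] psi_eq[OF assms(2) kl(2)]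
    by (simp add: cis_mult algebra_simps add_divide_distrib)
qed

lemma psi_cong:
  assumes "x \<in> FF" "y \<in> FF" "x - y \<in> P"
  shows "\<psi> x = \<psi> y"
proof -
  obtain k where k: "T y - of_int k \<in> P" using T_cong_int assms by blast
  then have "T x - of_int k \<in> P" using P_trans T_cong[OF assms] by blast
  then show ?thesis using psi_eq[OF assms(1)] psi_eq[OF assms(2) k] by simp
qed

lemma psi_0 [simp]: "\<psi> 0 = 1"
proof -
  have "\<psi> 0 = cis (2 * pi * (real_of_int (c * 0) / real p))"
    using F_subset_FF prime_gt_0_nat[OF prime_p] by (intro psi_eq) (auto simp: power_0_left)
  then show ?thesis by simp
qed

lemma psi_mult_p: "z \<in> mu N \<Longrightarrow> \<psi> (z ^ p) = \<psi> z"
  by (simp add: psi_q_def trace_int_def T_mu_power_p)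

lemma psi_power_p: "\<psi> x ^ p = 1"
proof -
  have "\<psi> x = cis (2 * pi * (real_of_int (c * trace_int P p f x) / real p))"
    by (simp add: psi_q_def cis_conv_exp mult_ac)
  then have "\<psi> x ^ p = cis (2 * pi * real_of_int (c * trace_int P p f x))"
    using prime_gt_0_nat[OF prime_p] by (simp add: Complex.DeMoivre)
  also have "\<dots> = 1" by (rule cis_multiple_2pi) simp
  finally show ?thesis .
qed

lemma alg_int_psi: "alg_int (\<psi> x)"
  using alg_int_root_of_unity[OF psi_power_p] prime_gt_0_nat[OF prime_p] by blast

text \<open>A trivial character would put every trace into \<open>P\<close>, and
  \<open>sum_mu_inverse_T\<close> would then put \<open>N\<close> into \<open>P\<close>.\<close>

lemma psi_nontrivial: "\<exists>z\<in>mu N. \<psi> z \<noteq> 1"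
proof (rule ccontr)
  assume "\<not> (\<exists>z\<in>mu N. \<psi> z \<noteq> 1)"
  then have one: "\<psi> z = 1" if "z \<in> mu N" for z using that by blast
  have "T z \<in> P" if z: "z \<in> mu N" for z
  proof -
    have zF: "z \<in> FF" using z F_subset_FF by auto
    obtain k where k: "T z - of_int k \<in> P" using T_cong_int zF by blast
    then have "cis (2 * pi * (real_of_int (c * k) / real p)) = 1" using one[OF z] psi_eq[OF zF k] by simp
    then have "real_of_int (c * k) / real p \<in> \<int>" by (simp only: cis_2pi_eq_1_iff)
    then obtain m where "real_of_int (c * k) / real p = of_int m" by (auto elim: Ints_cases)
    then have "real_of_int (c * k) = of_int (m * int p)"
      using prime_gt_0_nat[OF prime_p] by (simp add: field_simps)
    then have "c * k = m * int p" by (simp only: of_int_eq_iff)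
    then have "int p dvd c * k" by simp
    then have "int p dvd k" using c prime_p by (simp add: prime_dvd_mult_iff)
    then have "of_int k \<in> P" by (simp only: of_int_in_P_iff)
    then show ?thesis using P_cong[OF k] by simp
  qed
  then have "(\<Sum>z\<in>mu N. inverse z * T z) \<in> P"
    using alg_int_mu[OF mu_divide[OF mu_1]] by (intro P_sum[of "mu N"] P_mult) (auto simp: divide_inverse)
  then show False unfolding sum_mu_inverse_T using N_notin_P by simp
qed

text \<open>Translating by some w with \<psi> w different from 1 shows that the sum over all of
  \<open>F\<close> vanishes; the value -1 accounts for the omitted term at 0.\<close>

lemma sum_psi: "(\<Sum>z\<in>mu N. \<psi> z) = - 1"
proof -
  obtain w where w: "w \<in> mu N" "\<psi> w \<noteq> 1" using psi_nontrivial by blast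
  have "(\<Sum>x\<in>F. \<psi> x) = (\<Sum>x\<in>F. \<psi> (teich (x + w)))"
    using w by (intro sum.reindex_bij_betw[OF teich_translate_bij, symmetric]) simp
  also have "\<dots> = (\<Sum>x\<in>F. \<psi> x * \<psi> w)"
  proof (intro sum.cong refl)
    fix x assume "x \<in> F"
    then have FF: "x \<in> FF" "w \<in> FF" "x + w \<in> FF" using w F_subset_FF FF_add by blast+
    have "\<psi> (teich (x + w)) = \<psi> (x + w)"
      using teich[OF FF(3)] F_subset_FF FF(3) P_minus_commute by (intro psi_cong) blast+
    then show "\<psi> (teich (x + w)) = \<psi> x * \<psi> w" using psi_add FF by simp
  qed
  also have "\<dots> = (\<Sum>x\<in>F. \<psi> x) * \<psi> w" by (rule sum_distrib_right[symmetric])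
  finally have "(\<Sum>x\<in>F. \<psi> x) = 0" using w(2) by simp
  moreover have "(\<Sum>x\<in>F. \<psi> x) = 1 + (\<Sum>z\<in>mu N. \<psi> z)"
    using mu_nz by (subst sum.insert) auto
  ultimately show ?thesis by (simp add: eq_neg_iff_add_eq_0 add.commute)
qed

text \<open>The index runs over all exponents modulo \<open>N\<close>, not only over multiples of
  \<open>N div d\<close>, because the recursion for Stickelberger's theorem goes from k - 1 to
  k.\<close>

definition G :: "int \<Rightarrow> complex" where
  "G k = - (\<Sum>z\<in>mu N. z powi (- k) * \<psi> z)"

lemma alg_int_G: "alg_int (G k)"
  unfolding G_def by (intro alg_int_uminus alg_int_sum alg_int_mult alg_int_psi alg_int_mu mu_powi)

lemma mu_powi_cong:
  assumes "[k = l] (mod int N)" "z \<in> mu N"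
  shows "z powi k = z powi l"
proof -
  obtain m where "k = l + int N * m"
    using assms(1) unfolding cong_iff_dvd_diff dvd_def by (metis add.commute diff_add_cancel)
  then show ?thesis using assms(2) mu_nz[OF assms(2)] by (simp add: power_int_add power_int_mult mu_def)
qed

lemma G_cong: "[k = l] (mod int N) \<Longrightarrow> G k = G l"
  unfolding G_def by (intro arg_cong[where f = uminus] sum.cong refl arg_cong2[where f = "(*)"] mu_powi_cong)
    (auto simp: cong_minus_minus_iff)

lemma G_trivial: "int N dvd k \<Longrightarrow> G k = 1"
  using G_cong[of k 0] sum_psi by (simp add: cong_0_iff G_def)

text \<open>Raising to the power p permutes \<open>mu N\<close> and leaves the trace, hence the
  additive character, unchanged.\<close>

lemma G_mult_p: "G (int p * k) = G k"
proof -
  have bij: "bij_betw (\<lambda>z. z ^ p) (mu N) (mu N)"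
  proof (rule bij_betwI[of _ _ _ "\<lambda>z. z ^ (p ^ (f - 1))"])
    have "p * p ^ (f - 1) = p ^ f" using f_pos by (metis power_eq_if not_gr_zero)
    then show "(z ^ p) ^ (p ^ (f - 1)) = z" "(z ^ (p ^ (f - 1))) ^ p = z" if "z \<in> mu N" for z
      using mu_power_q[OF that] by (simp_all add: power_mult[symmetric] mult.commute)
  qed (auto intro: mu_power)
  have "G k = - (\<Sum>z\<in>mu N. (z ^ p) powi (- k) * \<psi> (z ^ p))"
    unfolding G_def by (subst sum.reindex_bij_betw[OF bij]) simp
  also have "\<dots> = G (int p * k)"
  proof -
    have "(z ^ p) powi (- k) = z powi (- (int p * k))" for z :: complex
      by (metis mult_minus_right power_int_mult power_int_of_nat)
    then show ?thesis unfolding G_def using psi_mult_p by simp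
  qed
  finally show ?thesis by simp
qed

text \<open>Character sums over tuples with prescribed sum; \<open>J_part I k 0\<close> is the Jacobi sum up to
  the factor \<open>1 / N\<close>.\<close>

definition tuples :: "'i set \<Rightarrow> complex \<Rightarrow> ('i \<Rightarrow> complex) set" where
  "tuples I s = {x \<in> PiE I (\<lambda>_. mu N). (\<Sum>i\<in>I. x i) - s \<in> P}"

definition J_part :: "'i set \<Rightarrow> ('i \<Rightarrow> int) \<Rightarrow> complex \<Rightarrow> complex" where
  "J_part I k s = (\<Sum>x\<in>tuples I s. \<Prod>i\<in>I. x i powi (- k i))"

lemma alg_int_J_part: "alg_int (J_part I k s)"
  unfolding J_part_def by (intro alg_int_sum alg_int_prod alg_int_mu mu_powi) (auto simp: tuples_def)

lemma J_part_scale: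
  assumes I: "finite I" and s: "s \<in> mu N"
  shows "J_part I k (s * r) = s powi (- (\<Sum>i\<in>I. k i)) * J_part I k r"
proof -
  have snz: "s \<noteq> 0" using mu_nz[OF s] .
  have "bij_betw (\<lambda>x. \<lambda>i\<in>I. s * x i) (tuples I r) (tuples I (s * r))"
  proof (rule bij_betwI[of _ _ _ "\<lambda>x. \<lambda>i\<in>I. x i / s"])
    show "(\<lambda>x. \<lambda>i\<in>I. s * x i) \<in> tuples I r \<rightarrow> tuples I (s * r)"
    proof
      fix x assume x: "x \<in> tuples I r"
      have "(\<Sum>i\<in>I. s * x i) - s * r = s * ((\<Sum>i\<in>I. x i) - r)" by (simp add: sum_distrib_left algebra_simps)
      also have "\<dots> \<in> P" using x by (intro P_mult alg_int_mu s) (simp add: tuples_def)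
      finally show "(\<lambda>i\<in>I. s * x i) \<in> tuples I (s * r)" using x s by (auto simp: tuples_def intro!: mu_mult)
    qed
    show "(\<lambda>x. \<lambda>i\<in>I. x i / s) \<in> tuples I (s * r) \<rightarrow> tuples I r"
    proof
      fix x assume x: "x \<in> tuples I (s * r)"
      have "(\<Sum>i\<in>I. x i / s) - r = (1 / s) * ((\<Sum>i\<in>I. x i) - s * r)"
        using snz by (simp add: sum_divide_distrib field_simps)
      also have "\<dots> \<in> P" using x by (intro P_mult alg_int_mu mu_divide s mu_1) (simp add: tuples_def)
      finally show "(\<lambda>i\<in>I. x i / s) \<in> tuples I r" using x s by (auto simp: tuples_def intro!: mu_divide)
    qed
  qed (use snz in \<open>auto simp: tuples_def PiE_def extensional_def fun_eq_iff\<close>)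
  then have "J_part I k (s * r) = (\<Sum>x\<in>tuples I r. \<Prod>i\<in>I. (\<lambda>i\<in>I. s * x i) i powi (- k i))"
    unfolding J_part_def by (rule sum.reindex_bij_betw[symmetric])
  also have "\<dots> = (\<Sum>x\<in>tuples I r. (\<Prod>i\<in>I. s powi (- k i)) * (\<Prod>i\<in>I. x i powi (- k i)))"
    by (simp add: power_int_mult_distrib prod.distrib)
  also have "(\<Prod>i\<in>I. s powi (- k i)) = s powi (- (\<Sum>i\<in>I. k i))"
    using I by (induction I rule: finite_induct) (use snz in \<open>simp_all add: power_int_add power_int_diff divide_inverse power_int_minus\<close>)
  finally show ?thesis by (simp add: J_part_def sum_distrib_left)
qed

lemma sum_over_tuples:
  fixes h :: "complex \<Rightarrow> complex"
  assumes I: "finite I"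
  shows "(\<Sum>x\<in>PiE I (\<lambda>_. mu N). h (teich (\<Sum>i\<in>I. x i)) * g x) = (\<Sum>s\<in>F. h s * (\<Sum>x\<in>tuples I s. g x))"
proof -
  let ?X = "PiE I (\<lambda>_. mu N)"
  have fin: "finite ?X" using I by (intro finite_PiE) auto
  have FF: "(\<Sum>i\<in>I. x i) \<in> FF" if "x \<in> ?X" for x
    using that F_subset_FF by (intro FF_sum) auto
  have set_eq: "{x \<in> ?X. teich (\<Sum>i\<in>I. x i) = s} = tuples I s" if "s \<in> F" for s
    using teich(2)[OF FF] teich_eq[OF that _ FF] by (auto simp: tuples_def)
  have "(\<Sum>x\<in>?X. h (teich (\<Sum>i\<in>I. x i)) * g x)
      = (\<Sum>s\<in>F. \<Sum>x\<in>{x \<in> ?X. teich (\<Sum>i\<in>I. x i) = s}. h (teich (\<Sum>i\<in>I. x i)) * g x)"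
    using teich(1)[OF FF] fin by (intro sum.group[symmetric]) auto
  also have "\<dots> = (\<Sum>s\<in>F. \<Sum>x\<in>{x \<in> ?X. teich (\<Sum>i\<in>I. x i) = s}. h s * g x)"
    by (intro sum.cong refl) auto
  also have "\<dots> = (\<Sum>s\<in>F. h s * (\<Sum>x\<in>tuples I s. g x))"
    by (intro sum.cong refl) (simp only: set_eq sum_distrib_left)
  finally show ?thesis .
qed

lemma psi_sum: "finite I \<Longrightarrow> (\<And>i. i \<in> I \<Longrightarrow> x i \<in> FF) \<Longrightarrow> \<psi> (\<Sum>i\<in>I. x i) = (\<Prod>i\<in>I. \<psi> (x i))"
  by (induction I rule: finite_induct) (simp_all add: psi_add FF_sum)

text \<open>The product expands over tuples, which are grouped by the lift s of their sum. For s
  different from 0, scaling reduces to s = 1, and what remains of the sum over s is again a Gauss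
  sum.\<close>

lemma prod_G_eq:
  assumes I: "finite I"
  shows "(\<Prod>i\<in>I. - G (k i)) = J_part I k 0 - J_part I k 1 * G (\<Sum>i\<in>I. k i)"
proof -
  let ?X = "PiE I (\<lambda>_. mu N)"
  have "(\<Prod>i\<in>I. - G (k i)) = (\<Prod>i\<in>I. \<Sum>z\<in>mu N. z powi (- k i) * \<psi> z)" by (simp add: G_def)
  also have "\<dots> = (\<Sum>x\<in>?X. \<Prod>i\<in>I. x i powi (- k i) * \<psi> (x i))"
    using I by (intro prod_sum_PiE) auto
  also have "\<dots> = (\<Sum>x\<in>?X. \<psi> (teich (\<Sum>i\<in>I. x i)) * (\<Prod>i\<in>I. x i powi (- k i)))"
  proof (intro sum.cong refl)
    fix x assume x: "x \<in> ?X"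
    have xF: "x i \<in> FF" if "i \<in> I" for i using x that F_subset_FF by auto
    then have sF: "(\<Sum>i\<in>I. x i) \<in> FF" by (rule FF_sum)
    have "\<psi> (teich (\<Sum>i\<in>I. x i)) = \<psi> (\<Sum>i\<in>I. x i)"
      using teich[OF sF] F_subset_FF sF P_minus_commute by (intro psi_cong) blast+
    also have "\<dots> = (\<Prod>i\<in>I. \<psi> (x i))" using I xF by (rule psi_sum)
    finally show "(\<Prod>i\<in>I. x i powi (- k i) * \<psi> (x i)) = \<psi> (teich (\<Sum>i\<in>I. x i)) * (\<Prod>i\<in>I. x i powi (- k i))"
      by (simp add: prod.distrib)
  qed
  also have "\<dots> = (\<Sum>s\<in>F. \<psi> s * J_part I k s)"
    unfolding J_part_def by (rule sum_over_tuples[OF I])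
  also have "\<dots> = J_part I k 0 + (\<Sum>s\<in>mu N. \<psi> s * J_part I k s)"
    using mu_nz by (subst sum.insert) auto
  also have "(\<Sum>s\<in>mu N. \<psi> s * J_part I k s) = (\<Sum>s\<in>mu N. J_part I k 1 * (s powi (- (\<Sum>i\<in>I. k i)) * \<psi> s))"
  proof (intro sum.cong refl)
    fix s assume "s \<in> mu N"
    from J_part_scale[OF I this, of k 1]
    show "\<psi> s * J_part I k s = J_part I k 1 * (s powi (- (\<Sum>i\<in>I. k i)) * \<psi> s)"
      by (simp only: mult_1_right) (simp only: mult_ac)
  qed
  also have "\<dots> = - J_part I k 1 * G (\<Sum>i\<in>I. k i)" by (simp add: G_def sum_distrib_left sum_negf)
  finally show ?thesis by simp
qed

lemma exists_mu_powi_neq_1: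
  assumes "\<not> int N dvd K"
  shows "\<exists>s\<in>mu N. s powi K \<noteq> 1"
proof (rule ccontr)
  assume "\<not> ?thesis"
  then have "(\<Sum>s\<in>mu N. s powi K) = of_nat N" by simp
  then show False using sum_mu_powi[OF N_pos, of K] assms N_pos by simp
qed

lemma J_part_0_eq_0:
  assumes "finite I" "\<not> int N dvd (\<Sum>i\<in>I. k i)"
  shows "J_part I k 0 = 0"
proof -
  obtain s where "s \<in> mu N" "s powi (- (\<Sum>i\<in>I. k i)) \<noteq> 1"
    using exists_mu_powi_neq_1[of "- (\<Sum>i\<in>I. k i)"] assms(2) by auto
  then show ?thesis using J_part_scale[OF assms(1), of s k 0] by simp
qed

text \<open>Summing the product of characters over all tuples gives 0, since the j-th factor is
  nontrivial. As \<open>J_part I k s\<close> is constant in nonzero s, this expresses the value at 1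
  through the value at 0 and eliminates it from \<open>prod_G_eq\<close>.\<close>

lemma prod_G_trivial:
  assumes I: "finite I" and K: "int N dvd (\<Sum>i\<in>I. k i)" and j: "j \<in> I" "\<not> int N dvd k j"
  shows "of_nat N * (\<Prod>i\<in>I. - G (k i)) = of_nat (p ^ f) * J_part I k 0"
proof -
  let ?X = "PiE I (\<lambda>_. mu N)"
  have "(\<Prod>i\<in>I. \<Sum>z\<in>mu N. z powi (- k i)) = 0"
    using j sum_mu_powi[OF N_pos] by (intro prod_zero I bexI[of _ j]) auto
  also have "(\<Prod>i\<in>I. \<Sum>z\<in>mu N. z powi (- k i)) = (\<Sum>x\<in>?X. \<Prod>i\<in>I. x i powi (- k i))"
    using I by (intro prod_sum_PiE) auto
  also have "\<dots> = (\<Sum>s\<in>F. J_part I k s)"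
    using sum_over_tuples[OF I, of "\<lambda>_. 1" "\<lambda>x. \<Prod>i\<in>I. x i powi (- k i)"]
    unfolding J_part_def mult_1 .
  also have "\<dots> = J_part I k 0 + (\<Sum>s\<in>mu N. J_part I k s)" using mu_nz by (subst sum.insert) auto
  also have "(\<Sum>s\<in>mu N. J_part I k s) = (\<Sum>s\<in>mu N. J_part I k 1)"
  proof (intro sum.cong refl)
    fix s assume s: "s \<in> mu N"
    have "s powi (- (\<Sum>i\<in>I. k i)) = s powi 0" using K s by (intro mu_powi_cong) (auto simp: cong_0_iff)
    then show "J_part I k s = J_part I k 1" using J_part_scale[OF I s, of k 1] by simp
  qed
  finally have "of_nat N * J_part I k 1 = - J_part I k 0" by (simp add: eq_neg_iff_add_eq_0 add.commute)
  moreover have "(\<Prod>i\<in>I. - G (k i)) = J_part I k 0 - J_part I k 1"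
    using prod_G_eq[OF I, of k] G_trivial[OF K] by simp
  ultimately have "of_nat N * (\<Prod>i\<in>I. - G (k i)) = of_nat (Suc N) * J_part I k 0"
    by (simp only: right_diff_distrib of_nat_Suc) (simp add: algebra_simps)
  then show ?thesis by (simp only: Suc_N)
qed

text \<open>The case of two factors, with the booleans as index set. The part at 0 vanishes by
  scaling, so the quotient is a Jacobi sum and hence integral.\<close>

lemma G_mult:
  assumes "\<not> int N dvd k + l"
  shows "\<exists>A. alg_int A \<and> G k * G l = A * G (k + l)"
proof -
  let ?k = "\<lambda>b. if b then k else l"
  have UB: "(UNIV :: bool set) = {True, False}" by auto
  have "(\<Prod>i\<in>UNIV. - G (?k i)) = - J_part UNIV ?k 1 * G (\<Sum>i\<in>UNIV. ?k i)"
    using prod_G_eq[of "UNIV :: bool set" ?k] J_part_0_eq_0[of "UNIV :: bool set" ?k] assms by (simp add: UB)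
  then have "G k * G l = - J_part UNIV ?k 1 * G (k + l)" by (simp add: UB)
  then show ?thesis using alg_int_J_part alg_int_uminus by blast
qed

text \<open>Two factors with trivial product. As \<open>N\<close> lies outside \<open>P\<close>,
  this bounds the valuation of the product from below by \<open>f\<close>.\<close>

lemma G_mult_uminus:
  assumes "\<not> int N dvd k"
  shows "\<exists>A. alg_int A \<and> of_nat N * (G k * G (- k)) = of_nat (p ^ f) * A"
proof -
  let ?k = "\<lambda>b. if b then k else - k"
  have UB: "(UNIV :: bool set) = {True, False}" by auto
  have "of_nat N * (\<Prod>i\<in>UNIV. - G (?k i)) = of_nat (p ^ f) * J_part UNIV ?k 0"
    using assms by (intro prod_G_trivial[of _ _ True]) (auto simp: UB)
  then have "of_nat N * (G k * G (- k)) = of_nat (p ^ f) * J_part UNIV ?k 0" by (simp add: UB)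
  then show ?thesis using alg_int_J_part by blast
qed

end

section \<open>Valuations and Stickelberger's theorem\<close>

context prime_above
begin

text \<open>An exact value is witnessed by units of the localisation at \<open>P\<close>; with such a witness the
  supremum in the definition of \<^const>\<open>val\<close> is attained.\<close>

definition has_val :: "complex \<Rightarrow> real \<Rightarrow> bool" where
  "has_val x r \<longleftrightarrow> (\<exists>n m a b. n > 0 \<and> alg_int a \<and> alg_int b \<and> a \<notin> P \<and> b \<notin> P \<and>
     b * x ^ n = of_nat p powi m * a \<and> r = real_of_int m / real n)"

lemma of_nat_p_nz: "(of_nat p :: complex) \<noteq> 0"
  using prime_gt_0_nat[OF prime_p] by simp

lemma notin_P_power: "alg_int x \<Longrightarrow> x \<notin> P \<Longrightarrow> x ^ n \<notin> P"
  using P_power by blast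

text \<open>Cross-multiplying the witness with a fraction m'/n' > r would equate a product of
  elements outside \<open>P\<close> with a positive power of p times an algebraic integer.\<close>

lemma has_val_imp_val:
  assumes "has_val x r"
  shows "val P p x = r"
proof -
  obtain n m a b where 1: "n > 0" "alg_int a" "alg_int b" "a \<notin> P" "b \<notin> P"
    "b * x ^ n = of_nat p powi m * a" "r = real_of_int m / real n"
    using assms unfolding has_val_def by blast
  show ?thesis unfolding val_def
  proof (rule cSup_eq_maximum)
    show "r \<in> {real_of_int m / real n |m n. 0 < n \<and>
        (\<exists>a b. alg_int a \<and> alg_int b \<and> b \<notin> P \<and> b * x ^ n = of_nat p powi m * a)}"
      using 1 by blast
    fix y assume "y \<in> {real_of_int m / real n |m n. 0 < n \<and>
        (\<exists>a b. alg_int a \<and> alg_int b \<and> b \<notin> P \<and> b * x ^ n = of_nat p powi m * a)}"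
    then obtain m' n' a' b' where 2: "y = real_of_int m' / real n'" "n' > 0" "alg_int a'" "alg_int b'" "b' \<notin> P"
      "b' * x ^ n' = of_nat p powi m' * a'" by blast
    show "y \<le> r"
    proof (rule ccontr)
      assume "\<not> y \<le> r"
      then have "real_of_int (m * int n') < real_of_int (m' * int n)" using 1(1,7) 2(1,2) by (simp add: field_simps)
      then have lt: "m * int n' < m' * int n" by (simp only: of_int_less_iff)
      define e where "e = nat (m' * int n - m * int n')"
      have e: "m' * int n = m * int n' + int e" "e > 0" using lt by (auto simp: e_def)
      have pw: "(of_nat p powi u * v) ^ s = of_nat p powi (u * int s) * v ^ s" for u s and v :: complex
        by (simp add: power_mult_distrib power_int_power')
      have "b ^ n' * (b' * x ^ n') ^ n = b' ^ n * (b * x ^ n) ^ n'"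
        by (simp add: power_mult_distrib power_mult[symmetric] mult_ac)
      then have "b ^ n' * (of_nat p powi (m' * int n) * a' ^ n) = b' ^ n * (of_nat p powi (m * int n') * a ^ n')"
        unfolding 1(6) 2(6) pw .
      then have "of_nat p powi (m * int n') * (b' ^ n * a ^ n') = of_nat p powi (m * int n') * (of_nat p ^ e * (b ^ n' * a' ^ n))"
        unfolding e(1) using of_nat_p_nz by (simp add: power_int_add mult_ac)
      then have "b' ^ n * a ^ n' = of_nat p ^ e * (b ^ n' * a' ^ n)"
        using of_nat_p_nz by (simp only: mult_cancel_left power_int_eq_0_iff) blast
      moreover have "of_nat p ^ e * (b ^ n' * a' ^ n) \<in> P"
      proof -
        have "of_nat p ^ e = of_nat p * (of_nat p :: complex) ^ (e - 1)" using e(2) by (metis power_eq_if not_gr_zero)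
        then show ?thesis using 1 2 p_in_P by (auto intro!: P_mult')
      qed
      ultimately have "b' ^ n * a ^ n' \<in> P" by simp
      then show False using 1 2 notin_P_mult[of "b' ^ n" "a ^ n'"] notin_P_power alg_int_power by blast
    qed
  qed
qed

lemma has_val_unit: "alg_int u \<Longrightarrow> u \<notin> P \<Longrightarrow> has_val u 0"
  unfolding has_val_def
  by (intro exI[of _ "1::nat"] exI[of _ "0::int"] exI[of _ u] exI[of _ "1::complex"]) (simp add: one_notin_P)

lemma has_val_mult:
  assumes "has_val x r" "has_val y s"
  shows "has_val (x * y) (r + s)"
proof -
  obtain n m a b where 1: "n > 0" "alg_int a" "alg_int b" "a \<notin> P" "b \<notin> P"
    "b * x ^ n = of_nat p powi m * a" "r = real_of_int m / real n"
    using assms(1) unfolding has_val_def by blast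
  obtain n' m' a' b' where 2: "n' > 0" "alg_int a'" "alg_int b'" "a' \<notin> P" "b' \<notin> P"
    "b' * y ^ n' = of_nat p powi m' * a'" "s = real_of_int m' / real n'"
    using assms(2) unfolding has_val_def by blast
  have pw: "(of_nat p powi u * v) ^ s = of_nat p powi (u * int s) * v ^ s" for u s and v :: complex
    by (simp add: power_mult_distrib power_int_power')
  have "(b ^ n' * b' ^ n) * (x * y) ^ (n * n') = (b * x ^ n) ^ n' * (b' * y ^ n') ^ n"
    by (simp add: power_mult_distrib power_mult[symmetric] mult_ac)
  also have "\<dots> = of_nat p powi (m * int n' + m' * int n) * (a ^ n' * a' ^ n)"
    unfolding 1(6) 2(6) pw using of_nat_p_nz by (simp add: power_int_add mult_ac)
  finally have eq: "(b ^ n' * b' ^ n) * (x * y) ^ (n * n') = \<dots>" .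
  have "r + s = real_of_int (m * int n' + m' * int n) / real (n * n')"
    using 1 2 by (simp add: field_simps)
  moreover have "b ^ n' * b' ^ n \<notin> P" "a ^ n' * a' ^ n \<notin> P"
    using 1 2 by (simp_all add: notin_P_mult notin_P_power alg_int_power)
  moreover have "alg_int (b ^ n' * b' ^ n)" "alg_int (a ^ n' * a' ^ n)"
    using 1 2 by (intro alg_int_mult alg_int_power; simp)+
  moreover have "n * n' > 0" using 1 2 by simp
  ultimately show ?thesis unfolding has_val_def using eq by blast
qed

lemma has_val_prod:
  "finite I \<Longrightarrow> (\<And>i. i \<in> I \<Longrightarrow> has_val (g i) (r i)) \<Longrightarrow> has_val (\<Prod>i\<in>I. g i) (\<Sum>i\<in>I. r i)"
  by (induction I rule: finite_induct) (auto intro!: has_val_mult has_val_unit simp: one_notin_P)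

lemma has_val_uminus: "has_val x r \<Longrightarrow> has_val (- x) r"
  using has_val_mult[OF has_val_unit[of "-1"], of x r] P_uminus[of "-1"] one_notin_P alg_int_of_int[of "-1"]
  by auto

lemma has_val_p_power: "has_val (of_nat p powi m) (real_of_int m)"
  unfolding has_val_def
  by (intro exI[of _ "1::nat"] exI[of _ m] exI[of _ "1::complex"]) (simp add: one_notin_P)

end

context finite_lift
begin

text \<open>The Stickelberger exponent: for 0 <= k < N it is the sum of the base p digits of k,
  divided by p - 1.\<close>

definition stick :: "int \<Rightarrow> real" where
  "stick k = (\<Sum>i<f. frac (real_of_int (int (p ^ i) * k) / real N))"

lemma stick_cong: "[k = l] (mod int N) \<Longrightarrow> stick k = stick l"
  unfolding stick_def by (intro sum.cong refl frac_cong cong_mult) auto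

lemma p_power_cong_1: "[int (p ^ f) = 1] (mod int N)"
  unfolding Suc_N[symmetric] by (simp add: cong_iff_dvd_diff)

lemma stick_mult_p: "stick (int p * k) = stick k"
proof -
  let ?g = "\<lambda>i. frac (real_of_int (int (p ^ i) * k) / real N)"
  have "stick (int p * k) = (\<Sum>i<f. ?g (Suc i))"
    unfolding stick_def by (intro sum.cong refl) (simp add: mult_ac)
  moreover have "?g 0 + (\<Sum>i<f. ?g (Suc i)) = stick k + ?g f"
    using sum.lessThan_Suc_shift[of ?g f] sum.lessThan_Suc[of ?g f] unfolding stick_def by linarith
  moreover have "?g f = ?g 0"
    using cong_mult[OF p_power_cong_1 cong_refl[of k]] by (intro frac_cong) simp
  ultimately show ?thesis by simp
qed

text \<open>Multiplication by \<open>p^i\<close> modulo \<open>N\<close> rotates the base \<open>p\<close> digits, so lowering a nonzero last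
  digit of \<open>k\<close> lowers every rotation of \<open>k\<close> without a borrow.\<close>

lemma stick_step:
  assumes k: "1 \<le> k" "k < int N" and pk: "\<not> int p dvd k"
  shows "stick k = stick (k - 1) + 1 / (real p - 1)"
proof -
  have p2: "p \<ge> 2" using prime_p by (rule prime_ge_2_nat)
  have step: "frac (real_of_int (int (p ^ i) * k) / real N)
      = frac (real_of_int (int (p ^ i) * (k - 1)) / real N) + real (p ^ i) / real N" if i: "i < f" for i
  proof -
    define Q where "Q = int (p ^ i)"
    have Q: "Q > 0" using p2 by (simp add: Q_def)
    define r where "r = (Q * k) mod int N"
    define m where "m = (Q * k) div int N"
    have rm: "Q * k = m * int N + r" by (simp add: r_def m_def)
    have r: "0 \<le> r" "r < int N" using N_pos by (auto simp: r_def)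
    have m: "0 \<le> m" "m < Q"
    proof -
      show "0 \<le> m" using Q k N_pos by (simp add: m_def pos_imp_zdiv_nonneg_iff)
      have "m * int N \<le> Q * k" using rm r by linarith
      also have "\<dots> < Q * int N" using Q k by simp
      finally show "m < Q" using N_pos by simp
    qed
    have q: "int N + 1 = Q * int (p ^ (f - i))"
    proof -
      have "p ^ f = p ^ i * p ^ (f - i)" using i by (simp flip: power_add)
      then have "int (Suc N) = Q * int (p ^ (f - i))" unfolding Suc_N Q_def by (metis of_nat_mult)
      then show ?thesis by simp
    qed
    \<comment> \<open>\<open>Q\<close> divides N + 1, so r and m agree modulo \<open>Q\<close>. If r
      < Q they would coincide, and k would be a multiple of p^(f - i), contrary to
      \<open>pk\<close>.\<close>
    have rmQ: "r - m = Q * (k - m * int (p ^ (f - i)))"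
      using rm q by (simp add: algebra_simps) (metis add.commute distrib_left mult.assoc mult.commute mult_1 )
    have "r \<ge> Q"
    proof (rule ccontr)
      assume "\<not> Q \<le> r"
      then have "\<bar>r - m\<bar> < Q" using r m by linarith
      then have "Q * \<bar>k - m * int (p ^ (f - i))\<bar> < Q * 1" unfolding rmQ using Q by (simp add: abs_mult)
      then have "\<bar>k - m * int (p ^ (f - i))\<bar> < 1" using Q by (simp only: mult_less_cancel_left_pos)
      then have "k = m * int (p ^ (f - i))" by simp
      moreover have "int p dvd int (p ^ (f - i))" using i by simp
      ultimately show False using pk by simp
    qed
    have "(Q * (k - 1)) mod int N = (r - Q) mod int N"
    proof -
      have "Q * (k - 1) = (r - Q) + int N * m" using rm by (simp add: algebra_simps)
      then show ?thesis by simp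
    qed
    also have "\<dots> = r - Q" using r \<open>r \<ge> Q\<close> Q by (intro mod_pos_pos_trivial) auto
    finally have "(Q * (k - 1)) mod int N = r - Q" .
    then show ?thesis
      unfolding Q_def[symmetric] frac_int_div_nat[OF N_pos] r_def[symmetric]
      by (simp add: Q_def diff_divide_distrib)
  qed
  have "(\<Sum>i<f. real (p ^ i)) * (real p - 1) = real N"
  proof -
    have "(\<Sum>i<f. real p ^ i) = (real p ^ f - 1) / (real p - 1)"
      using p2 by (intro geometric_sum) simp
    moreover have "real p ^ f - 1 = real N" using arg_cong[OF Suc_N, of real] by simp
    ultimately show ?thesis using p2 by simp
  qed
  then have "(\<Sum>i<f. real (p ^ i) / real N) = 1 / (real p - 1)"
    using N_pos p2 by (simp add: sum_divide_distrib[symmetric] field_simps)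
  then show ?thesis unfolding stick_def using step by (simp add: sum.distrib)
qed

lemma stick_0 [simp]: "stick 0 = 0" by (simp add: stick_def)

lemma coprime_p_N: "coprime (p ^ i) N"
proof -
  have "\<not> p dvd N" using N_notin_P by (simp only: of_nat_in_P_iff not_False_eq_True)
  then have "coprime p N" using prime_imp_coprime[OF prime_p] by blast
  then show ?thesis by simp
qed

lemma stick_uminus:
  assumes "\<not> int N dvd k"
  shows "stick k + stick (- k) = real f"
proof -
  have "frac (real_of_int (int (p ^ i) * k) / real N) + frac (real_of_int (int (p ^ i) * - k) / real N) = 1" for i
  proof -
    have nd: "\<not> int N dvd int (p ^ i) * k"
      using assms coprime_p_N[of i] coprime_dvd_mult_right_iff[of "int N" "int (p ^ i)" k]
      by (simp add: coprime_commute)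
    have "real_of_int (int (p ^ i) * k) / real N \<notin> \<int>"
    proof
      assume "real_of_int (int (p ^ i) * k) / real N \<in> \<int>"
      then obtain m where "real_of_int (int (p ^ i) * k) / real N = of_int m" by (auto elim: Ints_cases)
      then have "real_of_int (int (p ^ i) * k) = of_int (int N * m)" using N_pos by (simp add: field_simps)
      then have "int (p ^ i) * k = int N * m" by (simp only: of_int_eq_iff)
      then show False using nd by simp
    qed
    then show ?thesis using frac_neg[of "real_of_int (int (p ^ i) * k) / real N"] by simp
  qed
  then have "(\<Sum>i<f. frac (real_of_int (int (p ^ i) * k) / real N) + frac (real_of_int (int (p ^ i) * - k) / real N)) = (\<Sum>i<f. 1)"
    by (intro sum.cong refl)
  then show ?thesis unfolding stick_def by (simp add: sum.distrib)
qed

end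

section \<open>The element 1 - \<zeta> and the valuation of Gauss sums\<close>

context gauss_sums
begin

definition \<zeta> :: complex where "\<zeta> = cis (2 * pi * (real_of_int c / real p))"

lemma zeta_power: "\<zeta> ^ j = cis (2 * pi * (real_of_int (c * int j) / real p))"
  by (simp add: \<zeta>_def Complex.DeMoivre mult_ac)

lemma zeta_power_p: "\<zeta> ^ p = 1"
  using prime_gt_0_nat[OF prime_p] cis_multiple_2pi[of "of_int c"] by (simp add: \<zeta>_def Complex.DeMoivre)

lemma alg_int_zeta: "alg_int \<zeta>"
  using alg_int_root_of_unity[OF zeta_power_p] prime_gt_0_nat[OF prime_p] by blast

text \<open>By the Frobenius congruence (\<zeta> - 1)^p is \<zeta>^p - 1 = 0 modulo
  \<open>P\<close>, and \<open>P\<close> is prime.\<close>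

lemma zeta_cong_1: "\<zeta> - 1 \<in> P"
proof -
  have "(\<zeta> - 1 + 1) ^ p - ((\<zeta> - 1) ^ p + 1 ^ p) \<in> P"
    by (intro frobenius_add_P alg_int_diff alg_int_zeta) auto
  then have "- ((\<zeta> - 1) ^ p) \<in> P" by (simp add: zeta_power_p)
  then have "(\<zeta> - 1) ^ p \<in> P" using P_uminus by fastforce
  then show ?thesis by (rule P_power[OF alg_int_diff[OF alg_int_zeta alg_int_1]])
qed

lemma quantum_int_cong: "(\<Sum>j<m. \<zeta> ^ j) - of_nat m \<in> P"
proof -
  have "(\<Sum>j<m. \<zeta> ^ j - 1 ^ j) \<in> P"
    by (intro P_sum P_diff_power zeta_cong_1 alg_int_zeta) auto
  then show ?thesis by (simp add: sum_subtractf)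
qed

lemma one_minus_zeta_power: "1 - \<zeta> ^ m = (1 - \<zeta>) * (\<Sum>j<m. \<zeta> ^ j)"
  by (rule one_diff_power_eq)

lemma alg_int_quantum: "alg_int (\<Sum>j<m. \<zeta> ^ j)"
  by (intro alg_int_sum alg_int_power alg_int_zeta)

text \<open>Evaluating 1 + X + ... + X^(p-1) at 1 writes p as the product of the 1 - \<zeta>^j. Each
  of these is 1 - \<zeta> times a geometric sum congruent to j modulo \<open>P\<close>, so 1 -
  \<zeta> has valuation 1/(p - 1).\<close>

lemma zeta_prime_factorization:
  "\<exists>\<eta>. alg_int \<eta> \<and> \<eta> \<notin> P \<and> of_nat p = (1 - \<zeta>) ^ (p - 1) * \<eta>"
proof -
  have p0: "p > 0" using prime_p by (rule prime_gt_0_nat)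
  have mu: "finite (mu p)" "card (mu p) = p"
    using p0 card_roots_unity_eq[of p] finite_roots_unity[of p] by (auto simp: mu_def)
  have inj: "inj_on (\<lambda>j. \<zeta> ^ j) {..<p}"
  proof (rule inj_onI)
    fix i j assume ij: "i \<in> {..<p}" "j \<in> {..<p}" "\<zeta> ^ i = \<zeta> ^ j"
    have "cis (2 * pi * (real_of_int (c * (int i - int j)) / real p)) = \<zeta> ^ i / \<zeta> ^ j"
      unfolding zeta_power cis_divide by (simp add: algebra_simps diff_divide_distrib)
    also have "\<dots> = 1" using ij by (simp add: \<zeta>_def)
    finally have "real_of_int (c * (int i - int j)) / real p \<in> \<int>" by (simp only: cis_2pi_eq_1_iff)
    then obtain m where "real_of_int (c * (int i - int j)) / real p = of_int m" by (auto elim: Ints_cases)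
    then have "real_of_int (c * (int i - int j)) = of_int (int p * m)" using p0 by (simp add: field_simps)
    then have "c * (int i - int j) = int p * m" by (simp only: of_int_eq_iff)
    then have "int p dvd c * (int i - int j)" by simp
    then have "int p dvd int i - int j" using c prime_p by (simp add: prime_dvd_mult_iff)
    then have "[i = j] (mod p)" by (simp only: cong_iff_dvd_diff flip: cong_int_iff)
    then show "i = j" using ij by (simp add: cong_def)
  qed
  have sub: "(\<lambda>j. \<zeta> ^ j) ` {..<p} \<subseteq> mu p"
    by (auto simp: mu_def) (metis mult.commute power_mult power_one zeta_power_p)
  have im: "mu p = (\<lambda>j. \<zeta> ^ j) ` {..<p}"
    using card_subset_eq[OF mu(1) sub] card_image[OF inj] mu(2) by simp
  have split: "{..<p} = insert 0 {1..<p}" using p0 by auto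
  define B where "B = (\<Prod>j\<in>{1..<p}. [:- (\<zeta> ^ j), 1:])"
  define A where "A = (\<Sum>j<p. Polynomial.monom 1 j :: complex poly)"
  have "[:-1, 1:] * A = [:-1, 1:] * B"
  proof -
    have "poly ([:-1, 1:] * A) x = poly ([:-1, 1:] * B) x" for x
    proof -
      have "poly ([:-1, 1:] * A) x = x ^ p - 1"
        using power_diff_1_eq[of x p] by (simp add: A_def poly_sum poly_monom algebra_simps)
      also have "\<dots> = (\<Prod>j<p. x - \<zeta> ^ j)"
        unfolding power_minus_one_eq_prod_mu[OF p0] im by (subst prod.reindex[OF inj]) simp
      also have "\<dots> = poly ([:-1, 1:] * B) x"
        unfolding split by (subst prod.insert) (auto simp: B_def poly_prod algebra_simps)
      finally show ?thesis .
    qed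
    then show ?thesis by (simp only: poly_eq_poly_eq_iff[symmetric] fun_eq_iff) simp
  qed
  then have "A = B" by (simp only: mult_cancel_left) auto
  then have "poly A 1 = poly B 1" by simp
  then have "of_nat p = (\<Prod>j\<in>{1..<p}. 1 - \<zeta> ^ j)"
    by (simp add: A_def B_def poly_sum poly_monom poly_prod)
  also have "\<dots> = (1 - \<zeta>) ^ (p - 1) * (\<Prod>j\<in>{1..<p}. \<Sum>i<j. \<zeta> ^ i)"
    unfolding one_minus_zeta_power prod.distrib by simp
  finally have "of_nat p = (1 - \<zeta>) ^ (p - 1) * (\<Prod>j\<in>{1..<p}. \<Sum>i<j. \<zeta> ^ i)" .
  moreover have "(\<Prod>j\<in>{1..<p}. \<Sum>i<j. \<zeta> ^ i) \<notin> P"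
  proof (intro notin_P_prod conjI alg_int_quantum)
    fix j assume j: "j \<in> {1..<p}"
    then have "of_nat j \<notin> P" using nat_dvd_not_less[of j p] by (simp add: of_nat_in_P_iff)
    then show "(\<Sum>i<j. \<zeta> ^ i) \<notin> P" using P_cong[OF quantum_int_cong] by simp
  qed simp
  moreover have "alg_int (\<Prod>j\<in>{1..<p}. \<Sum>i<j. \<zeta> ^ i)" by (intro alg_int_prod alg_int_quantum)
  ultimately show ?thesis by blast
qed

text \<open>For N >= 2 the inverses of \<open>mu N\<close> sum to 0, so \<psi> z may be replaced by
  \<psi> z - 1, which is divisible by 1 - \<zeta> with quotient congruent to the trace of z. The
  cofactor \<open>U\<close> is then \<open>N\<close> modulo \<open>P\<close>.\<close>

lemma G_one_factorization:
  assumes "N \<ge> 2"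
  shows "\<exists>U. alg_int U \<and> U \<notin> P \<and> G 1 = (1 - \<zeta>) * U"
proof -
  define m where "m z = nat (trace_int P p f z mod int p)" for z
  have p0: "p > 0" using prime_p by (rule prime_gt_0_nat)
  have m: "int (m z) = trace_int P p f z mod int p" for z using p0 by (simp add: m_def)
  have Tm: "T z - of_nat (m z) \<in> P" if "z \<in> mu N" for z
  proof -
    have "of_int (trace_int P p f z - int (m z)) \<in> P"
      unfolding of_int_in_P_iff m by (metis cong_iff_dvd_diff cong_mod_right cong_refl)
    then show ?thesis using P_trans[OF trace_int_cong] that F_subset_FF by fastforce
  qed
  have psi: "\<psi> z = \<zeta> ^ m z" if "z \<in> mu N" for z
    using psi_eq[of z "int (m z)"] Tm[OF that] that F_subset_FF unfolding zeta_power by auto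
  define U where "U = (\<Sum>z\<in>mu N. inverse z * (\<Sum>j<m z. \<zeta> ^ j))"
  have inv: "alg_int (inverse z)" if "z \<in> mu N" for z
    using alg_int_mu[OF mu_divide[OF mu_1 that]] by (simp add: divide_inverse)
  have "(\<Sum>z\<in>mu N. inverse z) = 0"
    using sum_mu_powi[OF N_pos, of "-1"] assms by (simp add: power_int_minus)
  then have "G 1 = (\<Sum>z\<in>mu N. inverse z * (1 - \<psi> z))"
    by (simp add: G_def power_int_minus right_diff_distrib sum_subtractf)
  also have "\<dots> = (\<Sum>z\<in>mu N. (1 - \<zeta>) * (inverse z * (\<Sum>j<m z. \<zeta> ^ j)))"
    by (intro sum.cong refl) (simp add: psi one_minus_zeta_power mult_ac)
  also have "\<dots> = (1 - \<zeta>) * U" by (simp add: U_def sum_distrib_left)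
  finally have "G 1 = (1 - \<zeta>) * U" .
  moreover have "alg_int U" unfolding U_def using inv by (intro alg_int_sum[of "mu N"] alg_int_mult alg_int_quantum)
  moreover have "U \<notin> P"
  proof -
    have "(\<Sum>z\<in>mu N. inverse z * ((\<Sum>j<m z. \<zeta> ^ j) - T z)) \<in> P"
    proof (rule P_sum)
      fix z assume z: "z \<in> mu N"
      show "inverse z * ((\<Sum>j<m z. \<zeta> ^ j) - T z) \<in> P"
        using P_trans[OF quantum_int_cong P_minus_commute[OF Tm[OF z]]] by (intro P_mult inv z)
    qed
    then have "U - of_nat N \<in> P"
      unfolding sum_mu_inverse_T[symmetric] U_def by (simp add: right_diff_distrib sum_subtractf)
    then show ?thesis using P_cong N_notin_P by blast
  qed
  ultimately show ?thesis by blast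
qed

text \<open>The induction builds k digit by digit. A factor p changes neither \<open>G\<close> nor
  \<open>stick\<close>; raising the last digit by 1 multiplies by \<open>G 1\<close>, up to an
  integral factor. \<open>S\<close> is the digit sum, and the result bounds the valuation of
  \<open>G k\<close> from above.\<close>

lemma G_one_power_factorization:
  assumes "1 \<le> k" "k < N"
  shows "\<exists>A S. alg_int A \<and> real S = (real p - 1) * stick (int k) \<and> G 1 ^ S = A * G (int k)"
  using assms
proof (induction k rule: less_induct)
  case (less k)
  have p2: "p \<ge> 2" using prime_p by (rule prime_ge_2_nat)
  show ?case
  proof (cases "p dvd k")
    case True
    then obtain l where l: "k = p * l" by blast
    have l1: "1 \<le> l" using less.prems l by (cases l) auto
    then have "l < k" using l p2 by simp
    from less.IH[OF this l1] show ?thesis using \<open>l < k\<close> less.prems by (simp add: l stick_mult_p G_mult_p)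
  next
    case False
    then have step: "stick (int k) = stick (int k - 1) + 1 / (real p - 1)"
      using less.prems by (intro stick_step) auto
    show ?thesis
    proof (cases "k = 1")
      case True
      then show ?thesis using step p2 by (intro exI[of _ 1] exI[of _ "1::nat"]) (simp add: True)
    next
      case ne: False
      then obtain A S where AS: "alg_int A" "real S = (real p - 1) * stick (int (k - 1))" "G 1 ^ S = A * G (int (k - 1))"
      proof -
        have "k - 1 < k" "1 \<le> k - 1" "k - 1 < N" using ne less.prems by auto
        then show thesis using less.IH that by blast
      qed
      have k1: "int (k - 1) = int k - 1" using less.prems by simp
      have "\<not> int N dvd int (k - 1) + 1" using less.prems k1 zdvd_not_zless[of "int k" "int N"] by simp
      then obtain A' where A': "alg_int A'" "G (int (k - 1)) * G 1 = A' * G (int k)"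
        using G_mult[of "int (k - 1)" 1] k1 by auto
      have "G 1 ^ Suc S = (A * A') * G (int k)" using AS(3) A'(2) by (simp add: mult_ac)
      moreover have "real (Suc S) = (real p - 1) * stick (int k)"
        using AS(2) step k1 p2 by (simp add: field_simps)
      ultimately show ?thesis using AS(1) A'(1) alg_int_mult by blast
    qed
  qed
qed

lemma stickelberger:
  assumes k: "\<not> int N dvd k"
  shows "has_val (G k) (stick k)"
proof -
  have p2: "p \<ge> 2" using prime_p by (rule prime_ge_2_nat)
  have fac: "\<exists>A S. alg_int A \<and> real S = (real p - 1) * stick k \<and> G 1 ^ S = A * G k" if k: "\<not> int N dvd k" for k
  proof -
    define l where "l = nat (k mod int N)"
    have l: "int l = k mod int N" using N_pos by (simp add: l_def)
    have lk: "[int l = k] (mod int N)" using l by (simp add: cong_def)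
    have "l < N" using l N_pos by (metis of_nat_0_less_iff of_nat_less_iff pos_mod_bound)
    moreover have "l \<noteq> 0" using l k by (auto simp: dvd_eq_mod_eq_0)
    ultimately show ?thesis
      using G_one_power_factorization[of l] stick_cong[OF lk] G_cong[OF lk] by simp
  qed
  obtain A S where A: "alg_int A" "real S = (real p - 1) * stick k" "G 1 ^ S = A * G k"
    using fac[OF k] by blast
  obtain A' S' where A': "alg_int A'" "real S' = (real p - 1) * stick (- k)" "G 1 ^ S' = A' * G (- k)"
    using fac[of "- k"] k by auto
  have "N \<ge> 2" using k N_pos by (cases "N = 1") auto
  then obtain U where U: "alg_int U" "U \<notin> P" "G 1 = (1 - \<zeta>) * U" using G_one_factorization by blast
  obtain \<eta> where \<eta>: "alg_int \<eta>" "\<eta> \<notin> P" "of_nat p = (1 - \<zeta>) ^ (p - 1) * \<eta>"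
    using zeta_prime_factorization by blast
  \<comment> \<open>The factors 1 - \<zeta> cancel, so \<open>G 1\<close> has valuation exactly 1/(p
    - 1).\<close>
  have key: "\<eta> * G 1 ^ (p - 1) = of_nat p * U ^ (p - 1)"
    by (simp add: U(3) \<eta>(3) power_mult_distrib mult_ac)
  obtain B where B: "alg_int B" "of_nat N * (G k * G (- k)) = of_nat (p ^ f) * B"
    using G_mult_uminus[OF k] by blast
  have SS: "S + S' = (p - 1) * f"
  proof -
    have "real (S + S') = (real p - 1) * (stick k + stick (- k))" using A A' by (simp add: algebra_simps)
    also have "\<dots> = real ((p - 1) * f)" using stick_uminus[OF k] p2 by (simp add: of_nat_diff)
    finally show ?thesis by (simp only: of_nat_eq_iff)
  qed
  \<comment> \<open>The factorizations for k and -k are multiplied. Their exponents add up to (p -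
    1) f, so p^f cancels and an element outside \<open>P\<close> becomes a multiple of
    \<open>A\<close>; hence \<open>A\<close> is a unit at \<open>P\<close> and the upper bound for k
    is attained.\<close>
  have "of_nat p ^ f * (of_nat N * U ^ ((p - 1) * f)) = of_nat N * (\<eta> * G 1 ^ (p - 1)) ^ f"
    unfolding key by (simp add: power_mult_distrib power_mult[symmetric] mult_ac)
  also have "\<dots> = of_nat N * \<eta> ^ f * G 1 ^ (S + S')"
    by (simp add: SS power_mult_distrib power_mult[symmetric])
  also have "\<dots> = \<eta> ^ f * A * A' * (of_nat N * (G k * G (- k)))"
    by (simp add: power_add A(3) A'(3) mult_ac)
  also have "\<dots> = of_nat p ^ f * (A * (\<eta> ^ f * A' * B))" by (simp add: B(2) mult_ac)
  finally have "of_nat N * U ^ ((p - 1) * f) = A * (\<eta> ^ f * A' * B)" using of_nat_p_nz by simp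
  moreover have "of_nat N * U ^ ((p - 1) * f) \<notin> P"
    using U N_notin_P by (intro notin_P_mult notin_P_power alg_int_power) auto
  moreover have "alg_int (\<eta> ^ f * A' * B)" using \<eta>(1) A'(1) B(1) by (intro alg_int_mult alg_int_power)
  ultimately have AP: "A \<notin> P" using P_mult' by metis
  \<comment> \<open>The witness for the valuation uses the power p - 1 of \<open>G k\<close>, where
    the ramified element 1 - \<zeta> has been absorbed into p.\<close>
  have "(A ^ (p - 1) * \<eta> ^ S) * G k ^ (p - 1) = \<eta> ^ S * (A * G k) ^ (p - 1)"
    by (simp add: power_mult_distrib mult_ac)
  also have "\<dots> = (\<eta> * G 1 ^ (p - 1)) ^ S"
    by (simp add: A(3)[symmetric] power_mult_distrib power_mult[symmetric] mult_ac)
  also have "\<dots> = of_nat p powi int S * (U ^ (p - 1)) ^ S"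
    unfolding key by (simp add: power_mult_distrib)
  finally have "(A ^ (p - 1) * \<eta> ^ S) * G k ^ (p - 1) = of_nat p powi int S * (U ^ (p - 1)) ^ S" .
  moreover have "stick k = real_of_int (int S) / real (p - 1)" using A(2) p2 by (simp add: of_nat_diff)
  moreover have "A ^ (p - 1) * \<eta> ^ S \<notin> P" "(U ^ (p - 1)) ^ S \<notin> P"
    using A(1) AP \<eta>(1,2) U(1,2) by (simp_all add: notin_P_mult notin_P_power alg_int_power)
  moreover have "alg_int (A ^ (p - 1) * \<eta> ^ S)" "alg_int ((U ^ (p - 1)) ^ S)"
    using A(1) \<eta>(1) U(1) by (intro alg_int_mult alg_int_power; simp)+
  moreover have "p - 1 > 0" using p2 by simp
  ultimately show ?thesis unfolding has_val_def by blast
qed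

end

section \<open>Conjugates of roots of unity\<close>

definition rat_eval :: "rat poly \<Rightarrow> complex \<Rightarrow> complex" where
  "rat_eval Q z = poly (map_poly of_rat Q) z"

lemma rat_eval_0 [simp]: "rat_eval 0 z = 0"
  and rat_eval_pCons [simp]: "rat_eval (pCons a Q) z = of_rat a + z * rat_eval Q z"
  by (simp_all add: rat_eval_def map_poly_pCons)

lemma rat_eval_add: "rat_eval (A + B) z = rat_eval A z + rat_eval B z"
proof -
  have "map_poly of_rat (A + B) = map_poly of_rat A + (map_poly of_rat B :: complex poly)"
    by (rule poly_eqI) (simp add: coeff_map_poly of_rat_add)
  then show ?thesis by (simp add: rat_eval_def)
qed

lemma rat_eval_smult: "rat_eval (Polynomial.smult a B) z = of_rat a * rat_eval B z"
  by (induction B) (simp_all add: of_rat_mult algebra_simps)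

lemma rat_eval_mult: "rat_eval (A * B) z = rat_eval A z * rat_eval B z"
  by (induction A) (simp_all add: rat_eval_add rat_eval_smult algebra_simps)

lemma rat_eval_monom: "rat_eval (Polynomial.monom 1 n) z = z ^ n"
  by (simp add: rat_eval_def map_poly_monom poly_monom)

text \<open>Replacing the argument z by z^s plays the part of a Galois automorphism on values of
  such functions at roots of unity.\<close>

definition rat_poly_fun :: "(complex \<Rightarrow> complex) \<Rightarrow> bool" where
  "rat_poly_fun g \<longleftrightarrow> (\<exists>Q. g = rat_eval Q)"

lemma rat_poly_fun_const: "rat_poly_fun (\<lambda>z. of_rat a)"
  unfolding rat_poly_fun_def by (intro exI[of _ "[:a:]"]) auto

lemma rat_poly_fun_power: "rat_poly_fun (\<lambda>z. z ^ n)"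
  unfolding rat_poly_fun_def by (intro exI[of _ "Polynomial.monom 1 n"]) (auto simp: rat_eval_monom)

lemma rat_poly_fun_add: "rat_poly_fun g \<Longrightarrow> rat_poly_fun h \<Longrightarrow> rat_poly_fun (\<lambda>z. g z + h z)"
  unfolding rat_poly_fun_def by (auto simp: rat_eval_add[symmetric])

lemma rat_poly_fun_mult: "rat_poly_fun g \<Longrightarrow> rat_poly_fun h \<Longrightarrow> rat_poly_fun (\<lambda>z. g z * h z)"
  unfolding rat_poly_fun_def by (auto simp: rat_eval_mult[symmetric])

lemma rat_poly_fun_uminus: "rat_poly_fun g \<Longrightarrow> rat_poly_fun (\<lambda>z. - g z)"
  using rat_poly_fun_mult[OF rat_poly_fun_const[of "-1"], of g] by simp

lemma rat_poly_fun_diff: "rat_poly_fun g \<Longrightarrow> rat_poly_fun h \<Longrightarrow> rat_poly_fun (\<lambda>z. g z - h z)"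
  using rat_poly_fun_add[OF _ rat_poly_fun_uminus, of g h] by simp

lemma rat_poly_fun_sum: "(\<And>i. i \<in> A \<Longrightarrow> rat_poly_fun (g i)) \<Longrightarrow> rat_poly_fun (\<lambda>z. \<Sum>i\<in>A. g i z)"
  by (induction A rule: infinite_finite_induct)
    (use rat_poly_fun_const[of 0] in \<open>simp_all add: rat_poly_fun_add\<close>)

lemma rat_poly_fun_prod: "(\<And>i. i \<in> A \<Longrightarrow> rat_poly_fun (g i)) \<Longrightarrow> rat_poly_fun (\<lambda>z. \<Prod>i\<in>A. g i z)"
  by (induction A rule: infinite_finite_induct)
    (use rat_poly_fun_const[of 1] in \<open>simp_all add: rat_poly_fun_mult\<close>)

lemma rat_poly_fun_pow: "rat_poly_fun g \<Longrightarrow> rat_poly_fun (\<lambda>z. g z ^ n)"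
  by (induction n) (use rat_poly_fun_const[of 1] in \<open>simp_all add: rat_poly_fun_mult\<close>)

lemma rat_poly_fun_comp_power:
  assumes "rat_poly_fun g"
  shows "rat_poly_fun (\<lambda>z. g (z ^ s))"
proof -
  obtain Q where Q: "g = rat_eval Q" using assms by (auto simp: rat_poly_fun_def)
  have "rat_poly_fun (\<lambda>z. rat_eval Q (z ^ s))"
  proof (induction Q)
    case 0
    then show ?case using rat_poly_fun_const[of 0] by simp
  next
    case (pCons a Q)
    then show ?case
      by (simp add: rat_poly_fun_add rat_poly_fun_mult rat_poly_fun_const rat_poly_fun_power)
  qed
  then show ?thesis using Q by simp
qed

text \<open>Dedekind's argument works with integer coefficients; the constant c records the primes
  it has to avoid.\<close>

lemma rat_poly_clear_denominators:
  "\<exists>(c::int) A :: int poly. c \<noteq> 0 \<and> (\<forall>z. of_int c * rat_eval Q z = poly (map_poly of_int A) z)"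
proof (induction Q)
  case 0
  then show ?case by (intro exI[of _ 1] exI[of _ 0]) simp
next
  case (pCons a Q)
  then obtain c A where cA: "c \<noteq> 0" "\<And>z. of_int c * rat_eval Q z = poly (map_poly of_int A) z" by blast
  obtain u v where uv: "quotient_of a = (u, v)" by fastforce
  have v: "v > 0" using quotient_of_denom_pos[OF uv] .
  have a: "a = of_int u / of_int v" using quotient_of_div[OF uv] .
  have sm: "poly (map_poly of_int (Polynomial.smult v A)) z = (of_int v * poly (map_poly of_int A) z :: complex)" for z
    by (induction A) (simp_all add: map_poly_pCons algebra_simps)
  have "of_int (c * v) * rat_eval (pCons a Q) z = poly (map_poly of_int (pCons (c * u) (Polynomial.smult v A))) z" for z
  proof -
    have "of_int (c * v) * rat_eval (pCons a Q) z
        = of_int c * (of_int v * of_rat a) + z * (of_int v * (of_int c * rat_eval Q z))"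
      by (simp add: algebra_simps)
    also have "of_int v * of_rat a = (of_int u :: complex)"
      using v by (simp add: a of_rat_divide)
    finally show ?thesis by (simp add: cA(2) map_poly_pCons sm)
  qed
  then show ?case using cA(1) v by (intro exI[of _ "c * v"] exI[of _ "pCons (c * u) (Polynomial.smult v A)"]) auto
qed

lemma minimal_rat_poly:
  assumes "Q \<noteq> 0" "rat_eval Q x = 0"
  obtains D where "D \<noteq> 0" "rat_eval D x = 0" "\<And>B. rat_eval B x = 0 \<Longrightarrow> D dvd B"
proof -
  obtain D where D: "D \<noteq> 0" "rat_eval D x = 0"
    and least: "\<And>B. B \<noteq> 0 \<Longrightarrow> rat_eval B x = 0 \<Longrightarrow> degree D \<le> degree B"
    using ex_has_least_nat[of "\<lambda>D. D \<noteq> 0 \<and> rat_eval D x = 0" Q degree] assms by blast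
  have "D dvd B" if B: "rat_eval B x = 0" for B
  proof -
    have "rat_eval (B div D * D + B mod D) x = 0" using B by (simp only: div_mult_mod_eq)
    then have "rat_eval (B mod D) x = 0"
      unfolding rat_eval_add rat_eval_mult using D(2) by simp
    then have "B mod D = 0" using least[of "B mod D"] degree_mod_less[OF D(1), of B] by fastforce
    then show ?thesis by auto
  qed
  then show thesis using that D by blast
qed

context prime_above
begin

lemma alg_int_poly:
  assumes "alg_int x" "\<And>i. poly.coeff Q i \<in> \<int>"
  shows "alg_int (poly Q x)"
proof -
  have "alg_int (poly.coeff Q i)" for i using assms(2)[of i] by (auto elim: Ints_cases)
  then show ?thesis unfolding poly_altdef using assms(1) by (intro alg_int_sum alg_int_mult alg_int_power)
qed

text \<open>Fermat's little theorem treats the coefficients and \<open>frobenius_add\<close> the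
  sums. The congruence is modulo l among all algebraic integers, as l is unrelated to
  \<open>P\<close>.\<close>

lemma frobenius_int_poly:
  assumes l: "prime l" and x: "alg_int x"
  shows "\<exists>w. alg_int w \<and> poly (map_poly of_int A) (x ^ l) = poly (map_poly of_int A) x ^ l + of_nat l * w"
proof (induction A)
  case 0
  then show ?case using prime_gt_0_nat[OF l] by (intro exI[of _ 0]) simp
next
  case (pCons a A)
  let ?A = "poly (map_poly of_int A) :: complex \<Rightarrow> complex"
  obtain w where w: "alg_int w" "?A (x ^ l) = ?A x ^ l + of_nat l * w" using pCons by blast
  have Ax: "alg_int (?A x)" using x by (intro alg_int_poly) (simp_all add: coeff_map_poly)
  obtain v where v: "alg_int v" "(of_int a + x * ?A x) ^ l = of_int a ^ l + (x * ?A x) ^ l + of_nat l * v"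
    using frobenius_add[OF l, of "of_int a" "x * ?A x"] x Ax by auto
  obtain m where m: "a ^ l = a + int l * m"
  proof -
    have "[a ^ l = a] (mod int l)"
    proof (cases "int l dvd a")
      case True
      then have "int l dvd a ^ l" using prime_gt_0_nat[OF l] by (simp add: dvd_power_le dvd_power dvd_trans)
      then show ?thesis using True by (simp add: cong_def mod_eq_0_iff_dvd)
    next
      case False
      define b where "b = nat (a mod int l)"
      have b: "int b = a mod int l" using prime_gt_0_nat[OF l] by (simp add: b_def)
      have "\<not> l dvd b" using False b by (metis dvd_mod_iff dvd_refl int_dvd_int_iff)
      then have "[b ^ (l - 1) * b = 1 * b] (mod l)" using fermat_theorem[OF l] by (intro cong_mult) auto
      moreover have "b ^ (l - 1) * b = b ^ l" using prime_gt_0_nat[OF l] by (metis power_minus_mult)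
      ultimately have "[b ^ l = b] (mod l)" by simp
      then have "[int b ^ l = int b] (mod int l)" by (metis cong_int_iff of_nat_power)
      moreover have "[a = int b] (mod int l)" by (simp add: b cong_def)
      ultimately show ?thesis by (metis cong_pow cong_sym cong_trans)
    qed
    then show thesis using that unfolding cong_iff_dvd_diff dvd_def by (metis add.commute diff_add_cancel)
  qed
  have "of_int a ^ l = of_int a + of_nat l * (of_int m :: complex)"
    using arg_cong[OF m, of "of_int :: int \<Rightarrow> complex"] by simp
  then have "poly (map_poly of_int (pCons a A)) (x ^ l)
      = poly (map_poly of_int (pCons a A)) x ^ l + of_nat l * (x ^ l * w - of_int m - v)"
    by (simp add: map_poly_pCons w(2) v(2) power_mult_distrib algebra_simps)
  moreover have "alg_int (x ^ l * w - of_int m - v)" using x w v by (intro alg_int_diff alg_int_mult alg_int_power) auto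
  ultimately show ?case by blast
qed

lemma dvd_of_alg_int_multiple:
  assumes "of_int k = of_nat l * y" "alg_int y" "l > 0"
  shows "int l dvd k"
proof -
  have y: "y = of_int k / of_nat l" using assms by (simp add: field_simps)
  have "y \<in> \<rat>" unfolding y by (intro Rats_divide) auto
  then have "y \<in> \<int>" using assms(2) rational_algebraic_int_is_int by (simp add: alg_int_iff)
  then obtain m where "y = of_int m" by (auto elim: Ints_cases)
  then have "(of_int k :: complex) = of_int (int l * m)" using assms(1) by simp
  then have "k = int l * m" by (simp only: of_int_eq_iff)
  then show ?thesis by simp
qed

text \<open>Dedekind's argument. If a factor \<open>A\<close> of \<open>c (X^m - 1)\<close> vanishes at \<open>x\<close> but not at \<open>x^l\<close>, then
  \<open>A(x^l)\<close> divides \<open>c m\<close> (differentiate), while \<open>l\<close> divides \<open>A(x^l)\<close> (Frobenius).\<close>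

lemma int_poly_root_power_prime:
  fixes x :: complex
  assumes fac: "\<And>z. poly (map_poly of_int A) z * poly (map_poly of_int B) z = of_int c * (z ^ m - 1 :: complex)"
    and m: "m > 0" and x: "x ^ m = 1" "poly (map_poly of_int A) x = 0"
    and l: "prime l" "\<not> int l dvd c * int m"
  shows "poly (map_poly of_int A) (x ^ l) = 0"
proof (rule ccontr)
  let ?A = "map_poly of_int A :: complex poly" and ?B = "map_poly of_int B :: complex poly"
  assume ne: "poly ?A (x ^ l) \<noteq> 0"
  define y where "y = x ^ l"
  have ym: "y ^ m = 1" unfolding y_def using x(1) by (metis mult.commute power_mult power_one)
  have alg: "alg_int x" "alg_int y" using alg_int_root_of_unity x(1) ym m by blast+
  have By: "poly ?B y = 0" using fac[of y] ym ne by (simp add: y_def)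
  have "poly (?A * ?B) z = poly (Polynomial.smult (of_int c) (Polynomial.monom 1 m - 1)) z" for z
    using fac[of z] by (simp add: poly_monom)
  then have "?A * ?B = Polynomial.smult (of_int c) (Polynomial.monom 1 m - 1)"
    by (simp only: poly_eq_poly_eq_iff[symmetric] fun_eq_iff) simp
  then have "poly (pderiv (?A * ?B)) y = poly (pderiv (Polynomial.smult (of_int c) (Polynomial.monom 1 m - 1))) y" by simp
  then have "poly ?A y * poly (pderiv ?B) y = of_int c * (of_nat m * y ^ (m - 1))"
    using By by (simp add: pderiv_mult pderiv_smult pderiv_diff pderiv_monom poly_monom pderiv_1)
  moreover obtain w where w: "alg_int w" "poly ?A y = of_nat l * w"
    using frobenius_int_poly[OF l(1) alg(1), of A] x(2) prime_gt_0_nat[OF l(1)] by (auto simp: y_def)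
  ultimately have "of_nat l * (w * poly (pderiv ?B) y * y) = of_int c * (of_nat m * (y ^ (m - 1) * y))"
    by (simp add: mult_ac)
  also have "y ^ (m - 1) * y = 1" using m ym by (metis power_minus_mult)
  finally have "of_int (c * int m) = of_nat l * (w * poly (pderiv ?B) y * y)" by simp
  moreover have "alg_int (w * poly (pderiv ?B) y * y)"
    using w(1) alg by (intro alg_int_mult alg_int_poly) (auto simp: coeff_pderiv coeff_map_poly)
  ultimately have "int l dvd c * int m" using dvd_of_alg_int_multiple prime_gt_0_nat[OF l(1)] by blast
  then show False using l(2) by simp
qed

lemma root_of_unity_power_cong:
  fixes x :: complex
  assumes "x ^ m = 1" "[s = t] (mod m)"
  shows "x ^ s = x ^ t"
proof -
  have "x ^ s = x ^ (s mod m)" for s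
    by (metis assms(1) div_mult_mod_eq mult.commute mult_1 power_add power_mult power_one)
  then show ?thesis using assms(2) unfolding cong_def by metis
qed

text \<open>The irreducibility of cyclotomic polynomials in usable form. Within its class modulo m,
  s is replaced by some t that is also prime to the cleared denominators; the prime factors of t are
  then applied one at a time to the minimal polynomial of x.\<close>

lemma cyclotomic_conjugate:
  assumes g: "rat_poly_fun g" "g x = 0" and m: "m > 0" and x: "x ^ m = 1" and s: "coprime s m"
  shows "g (x ^ s) = 0"
proof -
  obtain Q where Q: "g = rat_eval Q" using g(1) by (auto simp: rat_poly_fun_def)
  define R :: "rat poly" where "R = Polynomial.monom 1 m + [:-1:]"
  have Rz: "rat_eval R z = z ^ m - 1" for z by (simp add: R_def rat_eval_add rat_eval_monom)
  have "degree R = m" unfolding R_def using m by (subst degree_add_eq_left) (simp_all add: degree_monom_eq)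
  then have "R \<noteq> 0" using m by auto
  moreover have "rat_eval R x = 0" using x by (simp add: Rz)
  ultimately obtain D where D: "D \<noteq> 0" "rat_eval D x = 0" "\<And>B. rat_eval B x = 0 \<Longrightarrow> D dvd B"
    using minimal_rat_poly by blast
  obtain E where E: "Q = D * E" using D(3)[of Q] g(2) Q by auto
  obtain B where B: "R = D * B" using D(3)[of R] \<open>rat_eval R x = 0\<close> by auto
  obtain c1 A' where A: "c1 \<noteq> 0" "\<And>z. of_int c1 * rat_eval D z = poly (map_poly of_int A') z"
    using rat_poly_clear_denominators[of D] by blast
  obtain c2 B' where B': "c2 \<noteq> 0" "\<And>z. of_int c2 * rat_eval B z = poly (map_poly of_int B') z"
    using rat_poly_clear_denominators[of B] by blast
  let ?c = "c1 * c2"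
  have fac: "poly (map_poly of_int A') z * poly (map_poly of_int B') z = of_int ?c * (z ^ m - 1 :: complex)" for z
    unfolding Rz[symmetric] B rat_eval_mult by (simp add: A(2)[symmetric] B'(2)[symmetric] mult_ac)
  have root: "poly (map_poly of_int A') (x ^ t) = (0 :: complex)" if "t > 0" "coprime (int t) (?c * int m)" for t
    using that
  proof (induction t rule: less_induct)
    case (less t)
    show ?case
    proof (cases "t = 1")
      case True
      then show ?thesis using D(2) A(2)[of x] by simp
    next
      case False
      then obtain l where l: "prime l" "l dvd t" using prime_factor_nat by blast
      then obtain u where u: "t = l * u" by blast
      have u0: "u > 0" using u less.prems by (cases u) auto
      have "u < t" using u u0 prime_gt_1_nat[OF l(1)] by simp
      moreover have "coprime (int u) (?c * int m)" using less.prems(2) u by simp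
      ultimately have IH: "poly (map_poly of_int A') (x ^ u) = (0 :: complex)" using less.IH u0 by blast
      have "\<not> int l dvd ?c * int m"
      proof
        assume "int l dvd ?c * int m"
        moreover have "int l dvd int t" using u by simp
        ultimately have "is_unit (int l)" using less.prems(2) coprime_common_divisor by blast
        then show False using l(1) by simp
      qed
      moreover have "(x ^ u) ^ m = 1" using x by (metis mult.commute power_mult power_one)
      ultimately have "poly (map_poly of_int A') ((x ^ u) ^ l) = (0 :: complex)"
        using int_poly_root_power_prime[OF fac m _ IH l(1)] by blast
      then show ?thesis by (simp add: u power_mult[symmetric] mult.commute)
    qed
  qed
  have "m * nat \<bar>?c\<bar> > 0" using m A(1) B'(1) by simp
  then obtain t where t: "[t = s] (mod m)" "coprime t (m * nat \<bar>?c\<bar>)"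
    using exists_coprime_in_residue_class[OF s] by blast
  have xt: "x ^ s = x ^ t" using root_of_unity_power_cong[OF x] t(1) by (metis cong_sym)
  have "poly (map_poly of_int A') (x ^ t) = (0 :: complex)"
  proof (cases "t = 0")
    case True
    then have "m = 1" using t(2) by auto
    then have "x ^ t = x" using x True by simp
    then show ?thesis using D(2) A(2)[of x] by simp
  next
    case False
    have "coprime (int t) (int (m * nat \<bar>?c\<bar>))" using t(2) by (simp only: coprime_int_iff)
    then have "coprime (int t) (?c * int m)" by simp
    then show ?thesis using root False by simp
  qed
  then have "rat_eval D (x ^ s) = 0" using A(1) A(2)[of "x ^ t"] by (simp add: xt)
  then show ?thesis by (simp add: Q E rat_eval_mult)
qed

end

section \<open>Stabilisers and degrees\<close>

lemma alg_degree_attained: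
  assumes "Q \<noteq> 0" "\<And>i. poly.coeff Q i \<in> K" "poly Q x = 0"
  obtains R where "R \<noteq> 0" "degree R = alg_degree K x" "\<And>i. poly.coeff R i \<in> K" "poly R x = 0"
proof -
  have "\<exists>n. \<exists>R :: complex poly. R \<noteq> 0 \<and> degree R = n \<and> (\<forall>i. poly.coeff R i \<in> K) \<and> poly R x = 0"
    using assms by blast
  then have "\<exists>R :: complex poly. R \<noteq> 0 \<and> degree R = alg_degree K x \<and> (\<forall>i. poly.coeff R i \<in> K) \<and> poly R x = 0"
    unfolding alg_degree_def by (rule LeastI_ex)
  then show thesis using that by blast
qed

lemma Rats_subset_cyc_field:
  assumes "e > 0"
  shows "\<rat> \<subseteq> cyc_field e"
proof
  fix x :: complex assume "x \<in> \<rat>"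
  then obtain q where q: "x = of_rat q" by (auto elim: Rats_cases)
  have "(\<Sum>k<e. of_rat (if k = 0 then q else 0) * exp (2 * pi * \<i> * of_nat k / of_nat e))
      = (\<Sum>k<e. if k = 0 then of_rat q else (0 :: complex))"
    by (intro sum.cong) auto
  also have "\<dots> = x" using assms q by simp
  finally show "x \<in> cyc_field e" unfolding cyc_field_def by (auto intro!: exI[of _ "\<lambda>k. if k = 0 then q else 0"])
qed

lemma cyc_field_1: "cyc_field 1 = \<rat>"
proof
  show "cyc_field 1 \<subseteq> \<rat>" by (auto simp: cyc_field_def)
qed (rule Rats_subset_cyc_field, simp)

text \<open>This provides an annihilating polynomial, so that the least degree in
  \<open>alg_degree\<close> is attained. The factor k is meant for Jacobi sums, which become visibly
  integral after multiplication by q - 1.\<close>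

lemma alg_int_multiple_rat_poly:
  assumes "alg_int (of_nat k * x)" "k > 0"
  shows "\<exists>Q :: complex poly. Q \<noteq> 0 \<and> (\<forall>i. poly.coeff Q i \<in> \<rat>) \<and> poly Q x = 0"
proof -
  obtain A :: "int poly" where A: "lead_coeff A = 1" "poly (map_poly of_int A) (of_nat k * x) = 0"
    using assms(1) unfolding alg_int_def by blast
  let ?A = "map_poly of_int A :: complex poly"
  let ?Q = "pcompose ?A [:0, of_nat k:]"
  have "poly.coeff ?A (degree A) = 1" using A(1) by (simp add: coeff_map_poly)
  then have "?A \<noteq> 0" by auto
  then have "?Q \<noteq> 0" using assms(2) by (subst pcompose_eq_0_iff) auto
  moreover have "poly ?Q x = 0" using A(2) by (simp add: poly_pcompose mult.commute)
  moreover have "poly.coeff ?Q i \<in> \<rat>" for i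
    by (simp add: coeff_pcompose_linear coeff_map_poly)
  ultimately show ?thesis by blast
qed

lemma root_of_unity_cis:
  assumes "v ^ d = 1" "d > 0"
  obtains l :: nat where "v = cis (2 * pi * (real l / real d))"
proof -
  have "v \<in> {exp (2 * of_real pi * \<i> * of_nat j / of_nat d) | j. j < d}"
    using complex_roots_unity[of d] assms by auto
  then obtain j where "v = exp (2 * of_real pi * \<i> * of_nat j / of_nat d)" by blast
  then have "v = cis (2 * pi * (real j / real d))" by (simp add: cis_conv_exp mult_ac)
  then show thesis using that by blast
qed

context prime_above
begin

text \<open>The Galois group of \<open>\<rat>(\<mu>\<^bsub>ed\<^esub>)\<close> over \<open>\<rat>(\<mu>\<^bsub>e\<^esub>)\<close> is \<open>(\<int>/d)\<^sup>*\<close>. It acts on the conjugates \<open>X t\<close> of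
  \<open>X 1\<close>, and the stabiliser of \<open>X 1\<close> has index at most the degree.\<close>

lemma galois_stabiliser:
  fixes X :: "int \<Rightarrow> complex" and e d n :: nat
  defines "\<xi> \<equiv> cis (2 * pi * (1 / real (e * d)))"
  defines "H \<equiv> {t. t < d \<and> coprime t d \<and> X (int t) = X 1}"
  assumes ed: "coprime e d" "e > 0" "d > 0"
    and g: "rat_poly_fun g" "\<And>s. [s = 1] (mod e) \<Longrightarrow> g (\<xi> ^ s) = X (int s)"
    and per: "\<And>s t. [s = t] (mod int d) \<Longrightarrow> X s = X t"
    and alg: "k > 0" "alg_int (of_nat k * X 1)"
    and deg: "alg_degree (cyc_field e) (X 1) \<le> n"
  shows "unit_subgroup d H" "totient d \<le> n * card H"
proof -
  have xi: "\<xi> ^ (e * d) = 1"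
    using ed cis_multiple_2pi[of 1] by (simp add: \<xi>_def Complex.DeMoivre)
  have ed0: "e * d > 0" using ed by simp
  \<comment> \<open>A unit modulo \<open>d\<close> is lifted to an exponent that is 1 modulo
    \<open>e\<close>, so that the conjugation fixes the \<open>e\<close>-th roots of unity.\<close>
  have lift: "\<exists>s. [s = 1] (mod e) \<and> [s = t] (mod d) \<and> coprime s (e * d)" if "coprime t d" for t
  proof -
    obtain s where s: "[s = 1] (mod e)" "[s = t] (mod d)"
      using binary_chinese_remainder_nat[OF ed(1)] by blast
    have "coprime s e" using s(1) by (metis cong_imp_coprime coprime_1_left cong_sym)
    moreover have "coprime s d" using s(2) that by (metis cong_imp_coprime cong_sym)
    ultimately show ?thesis using s by auto
  qed
  have Xeq: "g (\<xi> ^ s) = X (int t)" if "[s = 1] (mod e)" "[s = t] (mod d)" for s t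
    using g(2)[OF that(1)] per[of "int s" "int t"] that(2) by (simp add: cong_int_iff)
  have X1: "g \<xi> = X 1" using g(2)[of 1] by simp
  \<comment> \<open>An equality between two conjugates is itself conjugated by u. This gives closure
    of \<open>H\<close> and moves fibres of t -> X t into \<open>H\<close>.\<close>
  have trans: "X (int (t * u)) = X (int (t' * u))"
    if X: "X (int t) = X (int t')" and cop: "coprime t d" "coprime t' d" "coprime u d" for t t' u
  proof -
    obtain s where s: "[s = 1] (mod e)" "[s = t] (mod d)" using lift[OF cop(1)] by blast
    obtain s' where s': "[s' = 1] (mod e)" "[s' = t'] (mod d)" using lift[OF cop(2)] by blast
    obtain r where r: "[r = 1] (mod e)" "[r = u] (mod d)" "coprime r (e * d)" using lift[OF cop(3)] by blast
    have "rat_poly_fun (\<lambda>z. g (z ^ s) - g (z ^ s'))"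
      by (intro rat_poly_fun_diff rat_poly_fun_comp_power g(1))
    moreover have "g (\<xi> ^ s) - g (\<xi> ^ s') = 0" using Xeq[OF s] Xeq[OF s'] X by simp
    ultimately have "g ((\<xi> ^ r) ^ s) - g ((\<xi> ^ r) ^ s') = 0"
      using cyclotomic_conjugate[of "\<lambda>z. g (z ^ s) - g (z ^ s')", OF _ _ ed0 xi r(3)] by blast
    then have "g (\<xi> ^ (s * r)) = g (\<xi> ^ (s' * r))" by (simp add: power_mult[symmetric] mult.commute)
    moreover have "g (\<xi> ^ (s * r)) = X (int (t * u))"
      using cong_mult[OF s(1) r(1)] cong_mult[OF s(2) r(2)] by (intro Xeq) simp_all
    moreover have "g (\<xi> ^ (s' * r)) = X (int (t' * u))"
      using cong_mult[OF s'(1) r(1)] cong_mult[OF s'(2) r(2)] by (intro Xeq) simp_all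
    ultimately show ?thesis by simp
  qed
  have modX: "X (int (t mod d)) = X (int t)" for t
    by (intro per) (simp add: cong_def zmod_int)
  show Hg: "unit_subgroup d H"
  proof -
    have "1 mod d \<in> H" using ed modX[of 1] by (simp add: H_def)
    moreover have "s * t mod d \<in> H" if st: "s \<in> H" "t \<in> H" for s t
    proof -
      have "X (int (s * t)) = X (int (1 * t))"
        using st by (intro trans) (auto simp: H_def)
      then show ?thesis using st ed modX[of "s * t"] by (simp add: H_def)
    qed
    ultimately show ?thesis unfolding unit_subgroup_def by (auto simp: H_def)
  qed
  define V where "V = {t. t < d \<and> coprime t d}"
  have V: "finite V" "card V = totient d" using card_coprime_less[OF ed(3)] by (auto simp: V_def)
  let ?Y = "\<lambda>t. X (int t)"
  have "card V \<le> card H * card (?Y ` V)"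
  proof (rule card_le_mult_card_image[OF V(1)])
    fix y assume "y \<in> ?Y ` V"
    then obtain t0 where t0: "t0 \<in> V" "y = X (int t0)" by blast
    then obtain u where u: "[t0 * u = 1] (mod d)"
      using cong_solve_coprime_nat[of t0 d] by (auto simp: V_def)
    have "coprime (t0 * u) d" using u by (metis cong_imp_coprime coprime_1_left cong_sym)
    then have cu: "coprime u d" by simp
    \<comment> \<open>Multiplication by the inverse u of t0 moves the fibre over X t0 into the fibre
      over X 1, which is \<open>H\<close>. So no fibre is larger than \<open>H\<close>.\<close>
    have "inj_on (\<lambda>t. t * u mod d) {t \<in> V. ?Y t = y}"
    proof (rule inj_onI)
      fix s t assume st: "s \<in> {t \<in> V. ?Y t = y}" "t \<in> {t \<in> V. ?Y t = y}" "s * u mod d = t * u mod d"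
      then have "[s = t] (mod d)" using cu by (simp add: cong_def[symmetric] cong_mult_rcancel_nat)
      then show "s = t" using st by (simp add: V_def cong_def)
    qed
    moreover have "(\<lambda>t. t * u mod d) ` {t \<in> V. ?Y t = y} \<subseteq> H"
    proof clarify
      fix t assume t: "t \<in> V" "y = X (int t)"
      have "X (int (t * u)) = X (int (t0 * u))"
        using t t0 cu by (intro trans) (auto simp: V_def)
      also have "\<dots> = X (int 1)" using u by (intro per) (simp only: cong_int_iff)
      finally show "t * u mod d \<in> H" using t cu ed modX[of "t * u"] by (simp add: H_def V_def)
    qed
    ultimately show "card {t \<in> V. ?Y t = y} \<le> card H"
      using unit_subgroupD(2)[OF Hg] by (rule card_inj_on_le)
  qed
  also have "card (?Y ` V) \<le> n"
  proof -
    obtain Q :: "complex poly" where Q: "Q \<noteq> 0" "\<And>i. poly.coeff Q i \<in> \<rat>" "poly Q (X 1) = 0"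
      using alg_int_multiple_rat_poly[OF alg(2,1)] by blast
    have "poly.coeff Q i \<in> cyc_field e" for i using Q(2) Rats_subset_cyc_field[OF ed(2)] by blast
    then obtain R where R: "R \<noteq> 0" "degree R = alg_degree (cyc_field e) (X 1)"
      "\<And>i. poly.coeff R i \<in> cyc_field e" "poly R (X 1) = 0"
      using alg_degree_attained[OF Q(1) _ Q(3)] by metis
    have "\<exists>r :: nat \<Rightarrow> rat. poly.coeff R i = (\<Sum>j<e. of_rat (r j) * \<xi> ^ (d * j))" for i
    proof -
      have "\<xi> ^ (d * j) = exp (2 * pi * \<i> * of_nat j / of_nat e)" for j
      proof -
        have "\<xi> ^ (d * j) = cis (real (d * j) * (2 * pi * (1 / real (e * d))))"
          unfolding \<xi>_def by (rule Complex.DeMoivre)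
        also have "real (d * j) * (2 * pi * (1 / real (e * d))) = 2 * pi * real j / real e"
          using ed by simp
        finally show ?thesis by (simp add: cis_conv_exp mult_ac)
      qed
      then show ?thesis using R(3)[of i] unfolding cyc_field_def by auto
    qed
    then obtain r :: "nat \<Rightarrow> nat \<Rightarrow> rat"
      where r: "\<And>i. poly.coeff R i = (\<Sum>j<e. of_rat (r i j) * \<xi> ^ (d * j))" by metis
    \<comment> \<open>\<Phi> is R(g z) with the coefficients written through z^d. These are fixed
      when the exponent is 1 modulo \<open>e\<close>, so each conjugate X t is again a root of
      \<open>R\<close>, whose degree bounds their number.\<close>
    define \<Phi> where "\<Phi> z = (\<Sum>i\<le>degree R. (\<Sum>j<e. of_rat (r i j) * z ^ (d * j)) * g z ^ i)" for z
    have \<Phi>: "rat_poly_fun \<Phi>"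
      unfolding \<Phi>_def
      by (intro rat_poly_fun_sum rat_poly_fun_mult rat_poly_fun_const rat_poly_fun_power rat_poly_fun_pow g(1))
    have "\<Phi> \<xi> = 0" using R(4) unfolding \<Phi>_def poly_altdef r X1 .
    have root: "poly R (X (int t)) = 0" if cop: "coprime t d" for t
    proof -
      obtain s where s: "[s = 1] (mod e)" "[s = t] (mod d)" "coprime s (e * d)" using lift[OF cop] by blast
      have "(\<xi> ^ s) ^ (d * j) = \<xi> ^ (d * j)" for j
      proof -
        have "[d * s = d * 1] (mod (d * e))" using s(1) by (simp only: cong_def mult_mod_right[symmetric])
        from cong_mult[OF this cong_refl[of j]]
        have "[s * (d * j) = d * j] (mod (e * d))" by (simp add: mult_ac)
        then have "\<xi> ^ (s * (d * j)) = \<xi> ^ (d * j)" by (rule root_of_unity_power_cong[OF xi])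
        then show ?thesis by (simp only: power_mult)
      qed
      then have "\<Phi> (\<xi> ^ s) = poly R (X (int t))"
        unfolding \<Phi>_def poly_altdef r Xeq[OF s(1,2)] by simp
      then show ?thesis using cyclotomic_conjugate[OF \<Phi> \<open>\<Phi> \<xi> = 0\<close> ed0 xi s(3)] by simp
    qed
    have "card (?Y ` V) \<le> card {x. poly R x = 0}"
      using root by (intro card_mono poly_roots_finite R(1)) (auto simp: V_def)
    also have "\<dots> \<le> degree R" by (rule card_poly_roots_bound[OF R(1)])
    finally show ?thesis using deg R(2) by simp
  qed
  finally show "totient d \<le> n * card H" using V(2) by (simp add: mult.commute)
qed

end

section \<open>Valuations of Gauss and Jacobi sums as orbit means\<close>

context gauss_sums
begin

lemma gauss_eq_G: "gauss P p c f d a = G (a * int (N div d))"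
  by (simp add: gauss_def G_def chr_def N_def)

context
  fixes d :: nat
  assumes dN: "d dvd N"
begin

lemma d_pos: "d > 0" using dN N_pos by (metis dvd_0_left not_gr_zero)

lemma coprime_p_d: "coprime p d"
  using coprime_p_N[of 1] dN by (simp add: coprime_divisors[of p p d N])

lemma N_dvd_iff: "int N dvd a * int (N div d) \<longleftrightarrow> int d dvd a"
proof -
  have "N div d > 0" using dN N_pos d_pos by (simp add: div_greater_zero_iff dvd_imp_le)
  moreover have "int N = int d * int (N div d)" using dN by (simp flip: of_nat_mult)
  ultimately show ?thesis by simp
qed

lemma stick_eq: "stick (a * int (N div d)) = (\<Sum>i<f. frac (real_of_int (int (p ^ i) * a) / real d))"
proof -
  have "real N = real d * real (N div d)" using dN by (simp flip: of_nat_mult)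
  moreover have "N div d > 0" using dN N_pos d_pos by (simp add: div_greater_zero_iff dvd_imp_le)
  ultimately show ?thesis unfolding stick_def by (simp add: mult.assoc[symmetric])
qed

lemma has_val_gauss:
  assumes "\<not> int d dvd a"
  shows "has_val (gauss P p c f d a) (\<Sum>i<f. frac (real_of_int (int (p ^ i) * a) / real d))"
  using stickelberger[of "a * int (N div d)"] assms by (simp add: gauss_eq_G N_dvd_iff stick_eq)

lemma gauss_mult_p_power: "gauss P p c f d (int (p ^ i) * a) = gauss P p c f d a"
proof (induction i)
  case (Suc i)
  have "gauss P p c f d (int (p ^ Suc i) * a) = G (int p * (int (p ^ i) * a * int (N div d)))"
    by (simp add: gauss_eq_G mult_ac)
  then show ?case using Suc by (simp only: G_mult_p gauss_eq_G)
qed simp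

lemma gauss_cong: "[a = b] (mod int d) \<Longrightarrow> gauss P p c f d a = gauss P p c f d b"
proof -
  assume "[a = b] (mod int d)"
  then have "int d dvd a - b" by (simp add: cong_iff_dvd_diff)
  then have "int N dvd (a - b) * int (N div d)" by (simp add: N_dvd_iff)
  then show ?thesis unfolding gauss_eq_G by (intro G_cong) (simp add: cong_iff_dvd_diff left_diff_distrib)
qed

text \<open>The exponent l does not depend on t, so one polynomial in a root of unity produces the
  sums for all multiples t a.\<close>

lemma chr_root_of_unity:
  assumes "z \<in> mu N"
  shows "\<exists>l::nat. \<forall>t. chr (p ^ f) d (t * a) z = cis (2 * pi * (real l / real d)) powi t"
proof -
  define v where "v = z powi (- (a * int (N div d)))"
  have "v ^ d = z powi (- a * int N)"
  proof -
    have "v ^ d = v powi int d" by simp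
    also have "\<dots> = z powi (- (a * int (N div d)) * int d)" unfolding v_def by (rule power_int_mult[symmetric])
    also have "- (a * int (N div d)) * int d = - a * int N"
      using dN by (simp add: mult.assoc flip: of_nat_mult)
    finally show ?thesis .
  qed
  also have "\<dots> = z powi 0" using assms by (intro mu_powi_cong) (auto simp: cong_0_iff)
  finally have "v ^ d = 1" by simp
  then obtain l :: nat where l: "v = cis (2 * pi * (real l / real d))" using root_of_unity_cis d_pos by blast
  have "chr (p ^ f) d (t * a) z = v powi t" for t
    unfolding v_def chr_def N_def[symmetric] power_int_mult[symmetric] by (simp add: mult_ac)
  then show ?thesis using l by blast
qed

lemma gauss_stabiliser:
  fixes n :: nat and a :: int
  defines "H \<equiv> {t. t < d \<and> coprime t d \<and> gauss P p c f d (int t * a) = gauss P p c f d a}"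
  assumes deg: "alg_degree (cyc_field p) (gauss P p c f d a) \<le> n"
  shows "unit_subgroup d H" "totient d \<le> n * card H"
proof -
  define X where "X t = gauss P p c f d (t * a)" for t
  have p0: "p > 0" using prime_p by (rule prime_gt_0_nat)
  define \<xi> where "\<xi> = cis (2 * pi * (1 / real (p * d)))"
  obtain l where l: "\<And>z t. z \<in> mu N \<Longrightarrow> chr (p ^ f) d (t * a) z = cis (2 * pi * (real (l z) / real d)) powi t"
    using chr_root_of_unity[of _ a] by metis
  have "\<exists>u::nat. \<psi> z = cis (2 * pi * (real u / real p))" for z
    using root_of_unity_cis[OF psi_power_p p0] by blast
  then obtain u :: "complex \<Rightarrow> nat" where u: "\<And>z. \<psi> z = cis (2 * pi * (real (u z) / real p))" by metis
  \<comment> \<open>With y a primitive root of order p d, powers of y^p are the values of the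
    multiplicative character and powers of y^d those of the additive one. An exponent s that is 1
    modulo p affects only the former and replaces a by s a.\<close>
  define g where "g y = - (\<Sum>z\<in>mu N. y ^ (p * l z) * y ^ (d * u z))" for y :: complex
  have g1: "rat_poly_fun g" unfolding g_def
    by (intro rat_poly_fun_uminus rat_poly_fun_sum rat_poly_fun_mult rat_poly_fun_power)
  have g2: "g (\<xi> ^ s) = X (int s)" if s: "[s = 1] (mod p)" for s
  proof -
    have "(\<xi> ^ s) ^ (p * l z) = cis (2 * pi * (real (l z) / real d)) ^ s" for z
      using p0 d_pos by (simp add: \<xi>_def Complex.DeMoivre field_simps)
    moreover have "(\<xi> ^ s) ^ (d * u z) = \<psi> z" for z
    proof -
      have "(\<xi> ^ s) ^ (d * u z) = \<psi> z ^ s"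
        using p0 d_pos by (simp add: \<xi>_def u Complex.DeMoivre field_simps)
      also have "\<dots> = \<psi> z ^ 1" using psi_power_p s by (rule root_of_unity_power_cong)
      finally show ?thesis by simp
    qed
    ultimately show ?thesis unfolding g_def X_def gauss_def N_def[symmetric] using l by simp
  qed
  have per: "X s = X t" if "[s = t] (mod int d)" for s t
    unfolding X_def using that by (intro gauss_cong cong_mult cong_refl)
  have alg: "(1::nat) > 0" "alg_int (of_nat 1 * X 1)" by (simp_all add: X_def gauss_eq_G alg_int_G)
  have degX: "alg_degree (cyc_field p) (X 1) \<le> n" using deg by (simp add: X_def)
  note galois_stabiliser[OF coprime_p_d p0 d_pos g1 g2[unfolded \<xi>_def] per alg degX]
  then show "unit_subgroup d H" "totient d \<le> n * card H" by (simp_all add: X_def H_def)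
qed

text \<open>After exchanging the sums, multiplication by p^i permutes \<open>H\<close>, so the inner
  sum is the same for every i.\<close>

lemma sum_orbit_mean:
  assumes H: "unit_subgroup d H" and pH: "\<And>i. p ^ i mod d \<in> H"
  shows "(\<Sum>t\<in>H. \<Sum>i<f. frac (real_of_int (int (p ^ i) * (int t * a)) / real d)) = real f * (real (card H) * orbit_mean d H a)"
proof -
  let ?fr = "\<lambda>t. frac (real_of_int (int t * a) / real d)"
  have "(\<Sum>t\<in>H. \<Sum>i<f. frac (real_of_int (int (p ^ i) * (int t * a)) / real d))
      = (\<Sum>i<f. \<Sum>t\<in>H. frac (real_of_int (int (p ^ i) * (int t * a)) / real d))" by (rule sum.swap)
  also have "\<dots> = (\<Sum>i<f. \<Sum>t\<in>H. ?fr (p ^ i mod d * t mod d))"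
  proof (intro sum.cong refl frac_cong)
    fix i t
    have "[int (p ^ i) * int t = int (p ^ i mod d * t mod d)] (mod int d)"
      unfolding of_nat_mult[symmetric] cong_int_iff by (simp add: cong_def mod_mult_left_eq)
    from cong_mult[OF this cong_refl[of a]]
    show "[int (p ^ i) * (int t * a) = int (p ^ i mod d * t mod d) * a] (mod int d)" by (simp add: mult.assoc)
  qed
  also have "\<dots> = (\<Sum>i<f. \<Sum>t\<in>H. ?fr t)"
    by (intro sum.cong refl sum.reindex_bij_betw[OF unit_subgroup_mult_bij[OF H pH]])
  also have "\<dots> = real f * (real (card H) * orbit_mean d H a)"
    using unit_subgroupD(4)[OF H] by (simp add: orbit_mean_def)
  finally show ?thesis .
qed

text \<open>The Gauss sums at t a with t in \<open>H\<close> coincide, so Stickelberger's formula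
  may be averaged over these t.\<close>

lemma val_gauss_eq_orbit_mean:
  assumes deg: "alg_degree (cyc_field p) (gauss P p c f d a) \<le> n" and a: "\<not> int d dvd a"
  obtains H where "unit_subgroup d H" "totient d \<le> n * card H"
    "val P p (gauss P p c f d a) = real f * orbit_mean d H a"
proof -
  define H where "H = {t. t < d \<and> coprime t d \<and> gauss P p c f d (int t * a) = gauss P p c f d a}"
  have H: "unit_subgroup d H" "totient d \<le> n * card H" unfolding H_def by (rule gauss_stabiliser[OF deg])+
  have pH: "p ^ i mod d \<in> H" for i
  proof -
    have "[int (p ^ i mod d) * a = int (p ^ i) * a] (mod int d)"
      by (intro cong_mult cong_refl) (simp add: cong_def zmod_int)
    then show ?thesis using gauss_cong gauss_mult_p_power[of i a] coprime_p_d d_pos by (simp add: H_def)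
  qed
  have v: "val P p (gauss P p c f d a) = (\<Sum>i<f. frac (real_of_int (int (p ^ i) * (int t * a)) / real d))" if "t \<in> H" for t
  proof -
    have "\<not> int d dvd int t * a"
      using a unit_subgroupD(6)[OF H(1) that] by (metis coprime_commute coprime_dvd_mult_right_iff coprime_int_iff)
    from has_val_imp_val[OF has_val_gauss[OF this]] show ?thesis using that by (simp add: H_def)
  qed
  have "real (card H) * val P p (gauss P p c f d a) = (\<Sum>t\<in>H. val P p (gauss P p c f d a))" by simp
  also have "\<dots> = (\<Sum>t\<in>H. \<Sum>i<f. frac (real_of_int (int (p ^ i) * (int t * a)) / real d))"
    using v by (intro sum.cong refl)
  also have "\<dots> = real f * (real (card H) * orbit_mean d H a)" by (rule sum_orbit_mean[OF H(1) pH])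
  finally have "val P p (gauss P p c f d a) = real f * orbit_mean d H a"
    using unit_subgroupD(4)[OF H(1)] by simp
  then show thesis using that H by blast
qed

lemma jacobi_eq_J_part:
  "of_nat N * jacobi P (p ^ f) d w a = J_part {..w+1} (\<lambda>i. a i * int (N div d)) 0"
  using N_pos unfolding jacobi_def J_part_def tuples_def chr_def N_def[symmetric] diff_zero by simp

text \<open>The factor 1/(q - 1) of the Jacobi sum absorbs the \<open>N\<close> of
  \<open>prod_G_trivial\<close>. The power of p is the source of the -1 in the valuation divided by
  \<open>f\<close>.\<close>

lemma jacobi_eq_prod_gauss:
  assumes "int d dvd (\<Sum>i\<le>w+1. a i)" "\<not> int d dvd a 0"
  shows "jacobi P (p ^ f) d w a = (\<Prod>i\<le>w+1. - gauss P p c f d (a i)) * of_nat p powi (- int f)"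
proof -
  have "of_nat N * (\<Prod>i\<le>w+1. - G (a i * int (N div d)))
      = of_nat (p ^ f) * J_part {..w+1} (\<lambda>i. a i * int (N div d)) 0"
  proof (rule prod_G_trivial[of _ _ 0])
    show "int N dvd (\<Sum>i\<le>w+1. a i * int (N div d))"
      using assms(1) by (simp only: sum_distrib_right[symmetric] N_dvd_iff)
  qed (use assms(2) in \<open>simp_all add: N_dvd_iff\<close>)
  then have "of_nat N * (\<Prod>i\<le>w+1. - gauss P p c f d (a i)) = of_nat N * (of_nat p ^ f * jacobi P (p ^ f) d w a)"
    unfolding jacobi_eq_J_part[symmetric] gauss_eq_G by (simp add: mult_ac)
  then have "(\<Prod>i\<le>w+1. - gauss P p c f d (a i)) = of_nat p ^ f * jacobi P (p ^ f) d w a"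
    using N_pos by (simp only: mult_cancel_left of_nat_eq_0_iff) auto
  moreover have "of_nat p ^ f * jacobi P (p ^ f) d w a * of_nat p powi (- int f) = jacobi P (p ^ f) d w a"
    using of_nat_p_nz by (simp add: power_int_minus)
  ultimately show ?thesis by simp
qed

lemma has_val_jacobi:
  assumes "int d dvd (\<Sum>i\<le>w+1. a i)" "\<And>i. i \<le> w + 1 \<Longrightarrow> \<not> int d dvd a i"
  shows "has_val (jacobi P (p ^ f) d w a)
    ((\<Sum>i\<le>w+1. \<Sum>j<f. frac (real_of_int (int (p ^ j) * a i) / real d)) - real f)"
proof -
  have "has_val ((\<Prod>i\<le>w+1. - gauss P p c f d (a i)) * of_nat p powi (- int f))
    ((\<Sum>i\<le>w+1. \<Sum>j<f. frac (real_of_int (int (p ^ j) * a i) / real d)) + real_of_int (- int f))"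
    using assms by (intro has_val_mult has_val_prod has_val_p_power has_val_uminus has_val_gauss) auto
  then show ?thesis using assms by (subst jacobi_eq_prod_gauss) auto
qed

lemma jacobi_cong:
  assumes "\<And>i. i \<le> w + 1 \<Longrightarrow> [a i = b i] (mod int d)"
  shows "jacobi P (p ^ f) d w a = jacobi P (p ^ f) d w b"
proof -
  have "chr (p ^ f) d (a i) z = chr (p ^ f) d (b i) z" if "i \<le> w + 1" "z \<in> mu N" for i z
  proof -
    have "int d dvd b i - a i" using assms[OF that(1)] by (metis cong_iff_dvd_diff cong_sym)
    then have "int N dvd (b i - a i) * int (N div d)" by (simp add: N_dvd_iff)
    then show ?thesis unfolding chr_def N_def[symmetric]
      by (intro mu_powi_cong that) (simp add: cong_iff_dvd_diff left_diff_distrib)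
  qed
  then show ?thesis unfolding jacobi_def N_def[symmetric]
    by (intro arg_cong2[where f = "(*)"] refl sum.cong prod.cong) auto
qed

text \<open>No additive character remains, so the Galois argument applies with e = 1, where the base
  field is that of the rationals; integrality holds after multiplication by
  \<open>N\<close>.\<close>

lemma jacobi_stabiliser:
  fixes n w :: nat and a :: "nat \<Rightarrow> int"
  defines "H \<equiv> {t. t < d \<and> coprime t d \<and> jacobi P (p ^ f) d w (\<lambda>i. int t * a i) = jacobi P (p ^ f) d w a}"
  assumes deg: "alg_degree \<rat> (jacobi P (p ^ f) d w a) \<le> n"
  shows "unit_subgroup d H" "totient d \<le> n * card H"
proof -
  define X where "X t = jacobi P (p ^ f) d w (\<lambda>i. t * a i)" for t
  define \<xi> where "\<xi> = cis (2 * pi * (1 / real (1 * d)))"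
  define l where "l i z = (SOME l::nat. \<forall>t. chr (p ^ f) d (t * a i) z = cis (2 * pi * (real l / real d)) powi t)" for i z
  have l: "chr (p ^ f) d (t * a i) z = cis (2 * pi * (real (l i z) / real d)) powi t" if "z \<in> mu N" for i z t
    unfolding l_def using someI_ex[OF chr_root_of_unity[OF that, of "a i"]] by blast
  let ?X = "{x \<in> PiE {..w+1} (\<lambda>_. mu N). (\<Sum>i\<le>w+1. x i) \<in> P}"
  define g where "g y = of_rat (1 / of_nat N) * (\<Sum>x\<in>?X. \<Prod>i\<le>w+1. y ^ l i (x i))" for y :: complex
  have g1: "rat_poly_fun g" unfolding g_def
    by (rule rat_poly_fun_mult[OF rat_poly_fun_const], rule rat_poly_fun_sum, rule rat_poly_fun_prod,
        rule rat_poly_fun_power)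
  have g2: "g (\<xi> ^ s) = X (int s)" if s: "[s = 1] (mod 1)" for s
  proof -
    have "(\<xi> ^ s) ^ l i z = cis (2 * pi * (real (l i z) / real d)) powi int s" for i z
      using d_pos by (simp add: \<xi>_def Complex.DeMoivre field_simps)
    then have "(\<Prod>i\<le>w+1. (\<xi> ^ s) ^ l i (x i)) = (\<Prod>i\<le>w+1. chr (p ^ f) d (int s * a i) (x i))" if "x \<in> ?X" for x
      using that by (intro prod.cong refl) (subst l, auto)
    then show ?thesis unfolding g_def X_def jacobi_def N_def[symmetric]
      by (simp add: of_rat_divide)
  qed
  have per: "X s = X t" if "[s = t] (mod int d)" for s t
    unfolding X_def using that by (intro jacobi_cong cong_mult cong_refl)
  have alg: "alg_int (of_nat N * X 1)" unfolding X_def mult_1 jacobi_eq_J_part by (rule alg_int_J_part)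
  have degX: "alg_degree (cyc_field 1) (X 1) \<le> n" using deg unfolding cyc_field_1 X_def by simp
  note galois_stabiliser[OF coprime_1_left zero_less_one d_pos g1 g2[unfolded \<xi>_def] per N_pos alg degX]
  then show "unit_subgroup d H" "totient d \<le> n * card H" by (simp_all add: X_def H_def)
qed

lemma val_jacobi_eq_orbit_mean:
  assumes deg: "alg_degree \<rat> (jacobi P (p ^ f) d w a) \<le> n"
    and sum: "int d dvd (\<Sum>i\<le>w+1. a i)" and a: "\<And>i. i \<le> w + 1 \<Longrightarrow> \<not> int d dvd a i"
  obtains H where "unit_subgroup d H" "totient d \<le> n * card H"
    "val P p (jacobi P (p ^ f) d w a) = real f * ((\<Sum>i\<le>w+1. orbit_mean d H (a i)) - 1)"
proof -
  let ?J = "jacobi P (p ^ f) d w"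
  define H where "H = {t. t < d \<and> coprime t d \<and> ?J (\<lambda>i. int t * a i) = ?J a}"
  have H: "unit_subgroup d H" "totient d \<le> n * card H" unfolding H_def by (rule jacobi_stabiliser[OF deg])+
  have cop: "\<not> int d dvd int t * a i" if "coprime t d" "i \<le> w + 1" for t i
    using a[OF that(2)] that(1) by (metis coprime_commute coprime_dvd_mult_right_iff coprime_int_iff)
  have sumt: "int d dvd (\<Sum>i\<le>w+1. int t * a i)" for t
    using sum by (simp only: sum_distrib_left[symmetric] dvd_mult)
  \<comment> \<open>Invariance under p is inherited from the Gauss sums through the product
    formula.\<close>
  have pH: "p ^ j mod d \<in> H" for j
  proof -
    have "?J (\<lambda>i. int (p ^ j mod d) * a i) = ?J (\<lambda>i. int (p ^ j) * a i)"
      by (intro jacobi_cong cong_mult cong_refl) (simp add: cong_def zmod_int)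
    also have "\<dots> = ?J a"
    proof -
      have "coprime (p ^ j) d" using coprime_p_d by simp
      from cop[OF this, of 0] show ?thesis
        using sumt[of "p ^ j"] sum a[of 0] by (simp add: jacobi_eq_prod_gauss gauss_mult_p_power del: of_nat_power)
    qed
    finally show ?thesis using coprime_p_d d_pos by (simp add: H_def)
  qed
  have v: "val P p (?J a) = (\<Sum>i\<le>w+1. \<Sum>j<f. frac (real_of_int (int (p ^ j) * (int t * a i)) / real d)) - real f"
    if "t \<in> H" for t
    using has_val_imp_val[OF has_val_jacobi[where w = w and a = "\<lambda>i. int t * a i"]] sumt[of t] cop[of t]
      unit_subgroupD(6)[OF H(1) that] that by (simp add: H_def)
  have "real (card H) * val P p (?J a) = (\<Sum>t\<in>H. val P p (?J a))" by simp
  also have "\<dots> = (\<Sum>t\<in>H. (\<Sum>i\<le>w+1. \<Sum>j<f. frac (real_of_int (int (p ^ j) * (int t * a i)) / real d)) - real f)"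
    using v by (intro sum.cong refl)
  also have "\<dots> = (\<Sum>i\<le>w+1. \<Sum>t\<in>H. \<Sum>j<f. frac (real_of_int (int (p ^ j) * (int t * a i)) / real d)) - real (card H) * real f"
    unfolding sum_subtractf by (subst sum.swap) simp
  also have "\<dots> = (\<Sum>i\<le>w+1. real f * (real (card H) * orbit_mean d H (a i))) - real (card H) * real f"
    by (simp only: sum_orbit_mean[OF H(1) pH])
  also have "\<dots> = real (card H) * (real f * ((\<Sum>i\<le>w+1. orbit_mean d H (a i)) - 1))"
    by (simp add: sum_distrib_left algebra_simps)
  finally have "val P p (?J a) = real f * ((\<Sum>i\<le>w+1. orbit_mean d H (a i)) - 1)"
    using unit_subgroupD(4)[OF H(1)] by simp
  then show thesis using that H by blast
qed

end

end

section \<open>Uniform bounds for both kinds of sums\<close>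

theorem theorem2p4:
  shows "(\<forall>(\<epsilon>::real) > 0. \<forall>n::nat > 0. \<exists>C::real. \<forall>p P c d f a.
            prime p \<longrightarrow> prime_over P p \<longrightarrow> \<not> int p dvd c \<longrightarrow>
            real d > C \<longrightarrow> f > 0 \<longrightarrow> p ^ f mod d = 1 mod d \<longrightarrow> coprime a (int d) \<longrightarrow>
            alg_degree (cyc_field p) (gauss P p c f d a) \<le> n \<longrightarrow>
            \<bar>val P p (gauss P p c f d a) / real f - 1 / 2\<bar> < \<epsilon>)
       \<and> (\<forall>n::nat > 0. \<exists>C::real. \<exists>\<epsilon>::real > 0. \<forall>p P d f w a.
            prime p \<longrightarrow> prime_over P p \<longrightarrow>
            real d > C \<longrightarrow> f > 0 \<longrightarrow> p ^ f mod d = 1 mod d \<longrightarrow> w \<ge> 1 \<longrightarrow> a \<in> A'_set d w \<longrightarrow>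
            alg_degree \<rat> (jacobi P (p ^ f) d w a) \<le> n \<longrightarrow>
            val P p (jacobi P (p ^ f) d w a) / real f > \<epsilon>)"
proof (intro conjI allI impI)
  fix \<epsilon> :: real and n :: nat
  assume "\<epsilon> > 0" "n > 0"
  obtain B where B: "\<And>d H a. d > B \<Longrightarrow> unit_subgroup d H \<Longrightarrow> totient d \<le> n * card H \<Longrightarrow>
      coprime a (int d) \<Longrightarrow> \<bar>orbit_mean d H a - 1 / 2\<bar> < \<epsilon>"
    using orbit_mean_unit_equidistributed[OF \<open>\<epsilon> > 0\<close>, of n] by blast
  show "\<exists>C::real. \<forall>p P c d f a.
            prime p \<longrightarrow> prime_over P p \<longrightarrow> \<not> int p dvd c \<longrightarrow>
            real d > C \<longrightarrow> f > 0 \<longrightarrow> p ^ f mod d = 1 mod d \<longrightarrow> coprime a (int d) \<longrightarrow>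
            alg_degree (cyc_field p) (gauss P p c f d a) \<le> n \<longrightarrow>
            \<bar>val P p (gauss P p c f d a) / real f - 1 / 2\<bar> < \<epsilon>"
  \<comment> \<open>Requiring d > 1 as well ensures that a unit modulo \<open>d\<close> is not
    divisible by \<open>d\<close>, so the character is nontrivial.\<close>
  proof (intro exI[of _ "real (max B 1)"] allI impI)
    fix p P c d f and a :: int
    assume A: "prime p" "prime_over P p" "\<not> int p dvd c" "real d > real (max B 1)" "f > 0"
      "p ^ f mod d = 1 mod d" "coprime a (int d)" "alg_degree (cyc_field p) (gauss P p c f d a) \<le> n"
    interpret gauss_sums P p f c by unfold_locales (rule A)+
    have d: "d > B" "d > 1" using A(4) by (auto simp: of_nat_less_iff)
    have "[p ^ f = 1] (mod d)" using A(6) by (simp add: cong_def)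
    then have dN: "d dvd N" unfolding N_def using q_ge_2 by (simp add: cong_altdef_nat)
    have "\<not> int d dvd a"
    proof
      assume "int d dvd a"
      then have "is_unit (int d)" using A(7) coprime_common_divisor[of a "int d" "int d"] by simp
      then show False using d by simp
    qed
    then obtain H where "unit_subgroup d H" "totient d \<le> n * card H"
      "val P p (gauss P p c f d a) = real f * orbit_mean d H a"
      using val_gauss_eq_orbit_mean[OF dN A(8)] by blast
    then show "\<bar>val P p (gauss P p c f d a) / real f - 1 / 2\<bar> < \<epsilon>"
      using B[OF d(1), of H a] A(5,7) by simp
  qed
next
  fix n :: nat
  obtain C \<epsilon> where C: "\<epsilon> > 0" "\<And>d H w a. d > C \<Longrightarrow> unit_subgroup d H \<Longrightarrow> totient d \<le> n * card H \<Longrightarrow>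
     w \<ge> 1 \<Longrightarrow> a \<in> A'_set d w \<Longrightarrow> (\<Sum>i\<le>w+1. orbit_mean d H (a i)) > 1 + \<epsilon>"
    using sum_orbit_mean_gt[of n] by blast
  show "\<exists>C::real. \<exists>\<epsilon>::real > 0. \<forall>p P d f w a.
            prime p \<longrightarrow> prime_over P p \<longrightarrow>
            real d > C \<longrightarrow> f > 0 \<longrightarrow> p ^ f mod d = 1 mod d \<longrightarrow> w \<ge> 1 \<longrightarrow> a \<in> A'_set d w \<longrightarrow>
            alg_degree \<rat> (jacobi P (p ^ f) d w a) \<le> n \<longrightarrow>
            val P p (jacobi P (p ^ f) d w a) / real f > \<epsilon>"
  proof (rule exI[of _ "real C"], rule exI[of _ \<epsilon>], intro conjI allI impI C(1))
    fix p P d f w and a :: "nat \<Rightarrow> int"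
    assume A: "prime p" "prime_over P p" "real d > real C" "f > 0"
      "p ^ f mod d = 1 mod d" "w \<ge> 1" "a \<in> A'_set d w" "alg_degree \<rat> (jacobi P (p ^ f) d w a) \<le> n"
    \<comment> \<open>The Jacobi sum involves no additive character; c = 1 is one choice that makes
      Gauss sums available.\<close>
    have "\<not> int p dvd 1" using prime_gt_1_nat[OF A(1)] by simp
    then interpret gauss_sums P p f 1 by unfold_locales (rule A)+
    have "[p ^ f = 1] (mod d)" using A(5) by (simp add: cong_def)
    then have dN: "d dvd N" unfolding N_def using q_ge_2 by (simp add: cong_altdef_nat)
    have "int d dvd (\<Sum>i\<le>w+1. a i)" "\<And>i. i \<le> w + 1 \<Longrightarrow> \<not> int d dvd a i"
      using A(7) by (auto simp: A'_set_def)
    then obtain H where H: "unit_subgroup d H" "totient d \<le> n * card H"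
      "val P p (jacobi P (p ^ f) d w a) = real f * ((\<Sum>i\<le>w+1. orbit_mean d H (a i)) - 1)"
      using val_jacobi_eq_orbit_mean[OF dN A(8)] by blast
    have "(\<Sum>i\<le>w+1. orbit_mean d H (a i)) > 1 + \<epsilon>" using A(3) H by (intro C(2) A(6,7)) auto
    then show "val P p (jacobi P (p ^ f) d w a) / real f > \<epsilon>" using H(3) A(4) by simp
  qed
qed

end
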